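(* Let $D$ be a simply connected domain with a marked boundary point $q$, let $a,b\in\mathbb R$ with $2a(a+b)=1$, and let $\mathcal V=\mathcal V^{ia}_{(b)}=e^{*ia\Phi_{(b)}}$ be the non-chiral vertex field. With $T=T_{(b)}$ the Virasoro field of $\Phi_{(b)}$, $$T*\mathcal V=\frac1{2a^2}\,\partial^2\mathcal V .$$
   Context: Correlation functionals. Let $G$ be the Dirichlet Green's function of $D$ and $\Phi_{(0)}$ the (formal) Gaussian free field in $D$. Functionals are finite linear combinations of commutative Wick products $\odot$ of $1$, of $\partial^j\bar\partial^k\Phi_{(0)}(z)$ and of $e^{\odot\alpha\Phi_{(0)}(z)}=\sum_n\alpha^n\Phi_{(0)}^{\odot n}(z)/n!$; the points $z$ are the nodes. $\mathbf E$ is linear, $\mathbf E[1]=1$, and $\mathbf E$ of a Wick product of one or more derivatives of $\Phi_{(0)}$ is $0$. The product of functionals with disjoint node sets is given by Wick's formula: the sum over all partial pairings of the factors with no pair inside one functional, of the product of pair expectations $\mathbf E[\partial^j\bar\partial^k\Phi_{(0)}(\zeta)\partial^l\bar\partial^m\Phi_{(0)}(z)]=2\,\partial_\zeta^j\bar\partial_\zeta^k\partial_z^l\bar\partial_z^mG(\zeta,z)$ times the Wick product of unpaired factors. Equalities and limits of functionals are understood in correlations: after multiplying by any functional with other nodes and applying $\mathbf E$. Fields. A non-random conformal field assigns to each local chart $\phi$ a smooth function $(f\|\phi)$. A Fock space field is a linear combination, with non-random conformal fields as coefficients, of Wick products of derivatives (in local charts) and Wick exponentials of $\Phi_{(0)}$.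 An equation of fields means equality in every chart. For a holomorphic field $X$ ($\bar\partial X=0$ in correlations) the operator product expansion is $X(\zeta)Y(z)=\sum_n C_n(z)(\zeta-z)^n$ as $\zeta\to z$ (same chart at both points), and $X*Y:=C_0$. Modified free field. Let $w:(D,q)\to(\mathbb H,\infty)$ be a conformal map; in a chart $\phi$ it is expressed as $w\circ\phi^{-1}$. Put $\Phi_{(b)}=\Phi_{(0)}-2b\arg w'$, $J_{(b)}=\partial\Phi_{(b)}=J_{(0)}+ib\,w''/w'$ with $J_{(0)}=\partial\Phi_{(0)}$, and $T_{(b)}=-\frac12J_{(b)}*J_{(b)}+ib\,\partial J_{(b)}$. The vertex field is the OPE exponential $\mathcal V^\alpha_{(b)}=e^{*\alpha\Phi_{(b)}}=\sum_n\frac{\alpha^n}{n!}\Phi_{(b)}^{*n}$, which equals $$\mathcal V_{(b)}^\alpha=e^{-2\alpha b\arg w'}\,C^{\alpha^2}\,e^{\odot\alpha\Phi_{(0)}},\qquad C=\left|\frac{w-\overline w}{w'}\right| .$$ *)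

theory Defs
  imports "HOL-Complex_Analysis.Complex_Analysis"
begin

section \<open>Wirtinger calculus and the Dirichlet Green's function\<close>

definition dz :: "(complex \<Rightarrow> complex) \<Rightarrow> complex \<Rightarrow> complex" where
  "dz f z = (let L = frechet_derivative f (at z) in (L 1 - \<i> * L \<i>) / 2)"

definition dzbar :: "(complex \<Rightarrow> complex) \<Rightarrow> complex \<Rightarrow> complex" where
  "dzbar f z = (let L = frechet_derivative f (at z) in (L 1 + \<i> * L \<i>) / 2)"

text \<open>Real differentiability classes of complex-valued functions on open sets.\<close>

primrec Ck_on :: "nat \<Rightarrow> complex set \<Rightarrow> (complex \<Rightarrow> complex) \<Rightarrow> bool" where
  "Ck_on 0 U f \<longleftrightarrow> continuous_on U f"
| "Ck_on (Suc n) U f \<longleftrightarrow>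
     (\<forall>z\<in>U. f differentiable (at z)) \<and> Ck_on n U (dz f) \<and> Ck_on n U (dzbar f)"

definition smooth_on :: "complex set \<Rightarrow> (complex \<Rightarrow> complex) \<Rightarrow> bool" where
  "smooth_on U f \<longleftrightarrow> (\<forall>n. Ck_on n U f)"

text \<open>The Laplacian is four times the composition of the two Wirtinger operators.\<close>

definition harmonic_on :: "complex set \<Rightarrow> (complex \<Rightarrow> real) \<Rightarrow> bool" where
  "harmonic_on U u \<longleftrightarrow>
     Ck_on 2 U (\<lambda>z. of_real (u z)) \<and>
     (\<forall>z\<in>U. 4 * dz (dzbar (\<lambda>z. of_real (u z))) z = 0)"

text \<open>The last clause says that the function tends to zero at the boundary of the domain taken
  in the Riemann sphere. The values on the diagonal are irrelevant.\<close>

definition dirichlet_green :: "complex set \<Rightarrow> (complex \<Rightarrow> complex \<Rightarrow> real) \<Rightarrow> bool" where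
  "dirichlet_green D G \<longleftrightarrow>
     (\<forall>z\<in>D.
        (\<exists>h. harmonic_on D h \<and> (\<forall>\<zeta>\<in>D - {z}. G \<zeta> z = - ln (cmod (\<zeta> - z)) + h \<zeta>)) \<and>
        (\<forall>\<epsilon>>0. \<exists>K. compact K \<and> K \<subseteq> D \<and> (\<forall>\<zeta>\<in>D - K - {z}. \<bar>G \<zeta> z\<bar> < \<epsilon>)))"


section \<open>Marked domains and charts\<close>

definition conformal_onto :: "complex set \<Rightarrow> complex set \<Rightarrow> (complex \<Rightarrow> complex) \<Rightarrow> bool" where
  "conformal_onto D E f \<longleftrightarrow> f holomorphic_on D \<and> inj_on f D \<and> f ` D = E"

definition upper_half_plane :: "complex set" where
  "upper_half_plane = {z. Im z > 0}"

text \<open>A marked boundary point of a simply connected domain is a prime end. It is represented by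
  the filter on the domain obtained by pulling back the neighbourhoods of a point of the unit
  circle under a conformal map onto the unit disc (Caratheodory's correspondence).\<close>

definition prime_end :: "complex set \<Rightarrow> complex filter \<Rightarrow> bool" where
  "prime_end D q \<longleftrightarrow>
     (\<exists>f \<xi>. conformal_onto D (ball 0 1) f \<and> cmod \<xi> = 1 \<and>
            q = inf (filtercomap f (nhds \<xi>)) (principal D))"

definition conformal_to_half_plane ::
    "complex set \<Rightarrow> complex filter \<Rightarrow> (complex \<Rightarrow> complex) \<Rightarrow> bool" where
  "conformal_to_half_plane D q w \<longleftrightarrow>
     conformal_onto D upper_half_plane w \<and> filterlim w at_infinity q"

text \<open>A chart is its domain together with the coordinate map. Domains of charts are simply
  connected, so that a branch of \<open>arg w'\<close> exists in each chart. Since every statement about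
  fields is local, this is no restriction.\<close>

type_synonym chart = "complex set \<times> (complex \<Rightarrow> complex)"

definition local_chart :: "complex set \<Rightarrow> chart \<Rightarrow> bool" where
  "local_chart D c \<longleftrightarrow>
     open (fst c) \<and> simply_connected (fst c) \<and> fst c \<subseteq> D \<and>
     snd c holomorphic_on fst c \<and> inj_on (snd c) (fst c)"

definition coords :: "chart \<Rightarrow> complex set" where
  "coords c = snd c ` fst c"

definition point_of :: "chart \<Rightarrow> complex \<Rightarrow> complex" where
  "point_of c = the_inv_into (fst c) (snd c)"


section \<open>Correlation functionals of the Gaussian free field\<close>

text \<open>The factors of Wick products: \<open>Der j k\<close> is the derivative of the free field of order \<open>j\<close>
  in the holomorphic and \<open>k\<close> in the antiholomorphic direction; \<open>WExp \<alpha>\<close> is the Wick exponential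
  with exponent \<open>\<alpha>\<close>.\<close>

datatype factor = Der nat nat | WExp complex

type_synonym placed = "chart \<times> complex \<times> factor"

text \<open>A functional is a finite formal linear combination of Wick products; the empty Wick product
  is the constant 1. In a placed factor the second component is the coordinate of the node in the
  chart, and derivatives are taken with respect to that coordinate.\<close>

type_synonym functional = "(complex \<times> placed list) list"

definition nodes :: "functional \<Rightarrow> complex set" where
  "nodes F = (\<Union>(_, m) \<in> set F. (\<lambda>(c, z, _). point_of c z) ` set m)"

definition functional_in :: "complex set \<Rightarrow> functional \<Rightarrow> bool" where
  "functional_in D F \<longleftrightarrow>
     (\<forall>(_, m) \<in> set F. \<forall>(c, z, _) \<in> set m. local_chart D c \<and> z \<in> coords c)"

type_synonym elementary = "chart \<times> complex \<times> nat \<times> nat"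

fun pair_expectation ::
    "(complex \<Rightarrow> complex \<Rightarrow> real) \<Rightarrow> elementary \<Rightarrow> elementary \<Rightarrow> complex" where
  "pair_expectation G (c, \<zeta>, j, k) (d, z, l, m) =
     2 * (dz ^^ j) ((dzbar ^^ k)
           (\<lambda>x. (dz ^^ l) ((dzbar ^^ m)
                  (\<lambda>y. of_real (G (point_of c x) (point_of d y)))) z)) \<zeta>"

text \<open>The sum over all complete pairings of a list of elementary factors, tagged by the functional
  they come from, in which no pair lies inside one functional. The recursion chooses the partner
  of the first factor.\<close>

fun pairings_sum ::
    "(complex \<Rightarrow> complex \<Rightarrow> real) \<Rightarrow> (nat \<times> elementary) list \<Rightarrow> complex" where
  "pairings_sum G [] = 1"
| "pairings_sum G (x # xs) =
     (\<Sum>p<length xs.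
        (if fst (xs ! p) = fst x then 0
         else pair_expectation G (snd x) (snd (xs ! p)) *
              pairings_sum G (take p xs @ drop (Suc p) xs)))"

text \<open>Every factor is a power series, with respect to the Wick product, in one elementary factor:
  the factor \<open>Der j k\<close> is that factor itself and \<open>WExp \<alpha>\<close> is the exponential series in \<open>\<alpha>\<close> times
  the free field.\<close>

fun series_coeff :: "factor \<Rightarrow> nat \<Rightarrow> complex" where
  "series_coeff (Der j k) n = (if n = 1 then 1 else 0)"
| "series_coeff (WExp \<alpha>) n = \<alpha> ^ n / fact n"

fun elementary_of :: "placed \<Rightarrow> elementary" where
  "elementary_of (c, z, Der j k) = (c, z, j, k)"
| "elementary_of (c, z, WExp \<alpha>) = (c, z, 0, 0)"

definition tagged :: "placed list list \<Rightarrow> (nat \<times> placed) list" where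
  "tagged ms = concat (map (\<lambda>(i, m). map (Pair i) m) (List.enumerate 0 ms))"

text \<open>The expectation of the product of several Wick products with pairwise disjoint node sets.
  Wick exponentials are expanded into their series, and each resulting product is multiplied out
  by Wick's formula; the expectation retains exactly the complete pairings.\<close>

definition wick_correlation ::
    "(complex \<Rightarrow> complex \<Rightarrow> real) \<Rightarrow> placed list list \<Rightarrow> complex" where
  "wick_correlation G ms =
     (let L = tagged ms in
      \<Sum>\<^sub>\<infinity> ns \<in> {ns. length ns = length L}.
        (\<Prod>i<length L. series_coeff (snd (snd (snd (L ! i)))) (ns ! i)) *
        pairings_sum G
          (concat (map2 (\<lambda>n (i, u). replicate n (i, elementary_of u)) ns L)))"

text \<open>The expectation of the product of several functionals with pairwise disjoint node sets, by
  multilinearity.\<close>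

definition correlation ::
    "(complex \<Rightarrow> complex \<Rightarrow> real) \<Rightarrow> functional list \<Rightarrow> complex" where
  "correlation G Fs =
     (\<Sum>ts\<leftarrow>product_lists Fs. prod_list (map fst ts) * wick_correlation G (map snd ts))"

text \<open>Identities in correlations are tested against products of functionals; such a product is
  represented by the list of its factors.\<close>

definition test_product :: "complex set \<Rightarrow> functional list \<Rightarrow> bool" where
  "test_product D Zs \<longleftrightarrow>
     (\<forall>Z\<in>set Zs. functional_in D Z) \<and> sorted_wrt (\<lambda>Y Z. nodes Y \<inter> nodes Z = {}) Zs"

definition all_nodes :: "functional list \<Rightarrow> complex set" where
  "all_nodes Zs = (\<Union>Z \<in> set Zs. nodes Z)"


section \<open>Fock space fields\<close>

type_synonym scalar_field = "chart \<Rightarrow> complex \<Rightarrow> complex"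

text \<open>A finite linear combination of Wick products (all factors at one point and in one chart)
  with non-random conformal fields as coefficients.\<close>

type_synonym field = "(scalar_field \<times> factor list) list"

definition fock_space_field :: "complex set \<Rightarrow> field \<Rightarrow> bool" where
  "fock_space_field D X \<longleftrightarrow>
     (\<forall>(f, _) \<in> set X. \<forall>c. local_chart D c \<longrightarrow> smooth_on (coords c) (f c))"

definition at_point :: "field \<Rightarrow> chart \<Rightarrow> complex \<Rightarrow> functional" where
  "at_point X c z = map (\<lambda>(f, p). (f c z, map (\<lambda>u. (c, z, u)) p)) X"

definition field_scale :: "complex \<Rightarrow> field \<Rightarrow> field" where
  "field_scale s X = map (\<lambda>(f, p). (\<lambda>c z. s * f c z, p)) X"

definition field_add :: "field \<Rightarrow> field \<Rightarrow> field" where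
  "field_add X Y = X @ Y"

text \<open>The holomorphic derivative of a field in charts: Leibniz' rule for Wick products, where the
  derivative of a Wick exponential is \<open>\<alpha>\<close> times its Wick product with \<open>Der 1 0\<close>.\<close>

fun d_factor :: "factor \<Rightarrow> complex \<times> factor list" where
  "d_factor (Der j k) = (1, [Der (Suc j) k])"
| "d_factor (WExp \<alpha>) = (\<alpha>, [Der 1 0, WExp \<alpha>])"

fun d_wick :: "factor list \<Rightarrow> (complex \<times> factor list) list" where
  "d_wick [] = []"
| "d_wick (u # us) =
     (fst (d_factor u), snd (d_factor u) @ us) # map (\<lambda>(s, vs). (s, u # vs)) (d_wick us)"

definition d_field :: "field \<Rightarrow> field" where
  "d_field X =
     concat (map (\<lambda>(f, p).
       (\<lambda>c. dz (f c), p) # map (\<lambda>(s, q). (\<lambda>c z. s * f c z, q)) (d_wick p)) X)"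

definition field_eq ::
    "complex set \<Rightarrow> (complex \<Rightarrow> complex \<Rightarrow> real) \<Rightarrow> field \<Rightarrow> field \<Rightarrow> bool" where
  "field_eq D G X Y \<longleftrightarrow>
     (\<forall>c z Zs. local_chart D c \<and> z \<in> coords c \<and> test_product D Zs \<and>
        point_of c z \<notin> all_nodes Zs \<longrightarrow>
        correlation G (at_point X c z # Zs) = correlation G (at_point Y c z # Zs))"

definition holomorphic_field ::
    "complex set \<Rightarrow> (complex \<Rightarrow> complex \<Rightarrow> real) \<Rightarrow> field \<Rightarrow> bool" where
  "holomorphic_field D G X \<longleftrightarrow>
     (\<forall>c Zs. local_chart D c \<and> test_product D Zs \<longrightarrow>
        (\<lambda>z. correlation G (at_point X c z # Zs))
          holomorphic_on {z \<in> coords c. point_of c z \<notin> all_nodes Zs})"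

text \<open>The operator product expansion of a holomorphic field \<open>X\<close> with \<open>Y\<close>: a Laurent expansion in
  the difference \<open>\<epsilon>\<close> of the coordinates, in correlations with any product of functionals.\<close>

definition ope ::
    "complex set \<Rightarrow> (complex \<Rightarrow> complex \<Rightarrow> real) \<Rightarrow> field \<Rightarrow> field \<Rightarrow> (int \<Rightarrow> field) \<Rightarrow> bool" where
  "ope D G X Y C \<longleftrightarrow>
     holomorphic_field D G X \<and> (\<forall>n. fock_space_field D (C n)) \<and>
     (\<forall>c z Zs. local_chart D c \<and> z \<in> coords c \<and> test_product D Zs \<and>
        point_of c z \<notin> all_nodes Zs \<longrightarrow>
        (\<exists>F. (\<lambda>\<epsilon>. correlation G (at_point X c (z + \<epsilon>) # at_point Y c z # Zs))
               has_laurent_expansion F \<and>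
             (\<forall>n. fls_nth F n = correlation G (at_point (C n) c z # Zs))))"

definition has_ope ::
    "complex set \<Rightarrow> (complex \<Rightarrow> complex \<Rightarrow> real) \<Rightarrow> field \<Rightarrow> field \<Rightarrow> bool" where
  "has_ope D G X Y \<longleftrightarrow> (\<exists>C. ope D G X Y C)"

text \<open>The coefficient of order zero. The expansion determines it up to \<open>field_eq\<close>; a representative
  is chosen, and the value is meaningful only if \<open>has_ope D G X Y\<close>.\<close>

definition ope_product ::
    "complex set \<Rightarrow> (complex \<Rightarrow> complex \<Rightarrow> real) \<Rightarrow> field \<Rightarrow> field \<Rightarrow> field" where
  "ope_product D G X Y = (SOME C. ope D G X Y C) 0"


section \<open>The modified free field\<close>

definition in_chart :: "(complex \<Rightarrow> complex) \<Rightarrow> chart \<Rightarrow> complex \<Rightarrow> complex" where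
  "in_chart w c = w \<circ> point_of c"

text \<open>A choice, in each chart, of a continuous branch of \<open>arg w'\<close>.\<close>

definition arg_branch ::
    "complex set \<Rightarrow> (complex \<Rightarrow> complex) \<Rightarrow> (chart \<Rightarrow> complex \<Rightarrow> real) \<Rightarrow> bool" where
  "arg_branch D w \<theta> \<longleftrightarrow>
     (\<forall>c. local_chart D c \<longrightarrow>
        continuous_on (coords c) (\<theta> c) \<and>
        (\<forall>z\<in>coords c. deriv (in_chart w c) z =
                         of_real (cmod (deriv (in_chart w c) z)) * cis (\<theta> c z)))"

definition free_field :: "(chart \<Rightarrow> complex \<Rightarrow> real) \<Rightarrow> real \<Rightarrow> field" where
  "free_field \<theta> b = [(\<lambda>c z. 1, [Der 0 0]), (\<lambda>c z. of_real (- 2 * b * \<theta> c z), [])]"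

definition current :: "(chart \<Rightarrow> complex \<Rightarrow> real) \<Rightarrow> real \<Rightarrow> field" where
  "current \<theta> b = d_field (free_field \<theta> b)"

definition virasoro ::
    "complex set \<Rightarrow> (complex \<Rightarrow> complex \<Rightarrow> real) \<Rightarrow> (chart \<Rightarrow> complex \<Rightarrow> real) \<Rightarrow> real \<Rightarrow> field" where
  "virasoro D G \<theta> b =
     field_add (field_scale (- 1 / 2) (ope_product D G (current \<theta> b) (current \<theta> b)))
               (field_scale (\<i> * of_real b) (d_field (current \<theta> b)))"

definition conformal_radius :: "(complex \<Rightarrow> complex) \<Rightarrow> chart \<Rightarrow> complex \<Rightarrow> real" where
  "conformal_radius w c z =
     cmod ((in_chart w c z - cnj (in_chart w c z)) / deriv (in_chart w c) z)"

text \<open>The OPE exponential of \<open>\<alpha>\<close> times the modified free field, in its closed form.\<close>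

definition vertex_field ::
    "(complex \<Rightarrow> complex) \<Rightarrow> (chart \<Rightarrow> complex \<Rightarrow> real) \<Rightarrow> real \<Rightarrow> complex \<Rightarrow> field" where
  "vertex_field w \<theta> b \<alpha> =
     [(\<lambda>c z. exp (- 2 * \<alpha> * of_real b * of_real (\<theta> c z)) *
             of_real (conformal_radius w c z) powr \<alpha>\<^sup>2, [WExp \<alpha>])]"

end

theory Submission
  imports Defs
begin

text \<open>
  By the maximum principle the Dirichlet Green's function is the pullback under \<open>w\<close> of
      the one of the
  half-plane. Wick's formula contracts a derivative of the free field with every factor of the other
  functionals (a Wick exponential \<open>WExp \<alpha>\<close> survives the contraction and
      contributes \<open>\<alpha>\<close>). Hence
  correlations of products of currents are polynomials in the contractions, which are holomorphic in
  the position of the current, with poles only where the contraction is with a field at the nearby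
  point. These poles are read off from \<open>w\<close>: for the current against itself
  \<open>- w'(\<zeta>) w'(z) / (w(\<zeta>) - w(z))\<^sup>2\<close>, and for the current against the
      vertex field \<open>\<alpha>\<close> times
  \<open>w'(\<zeta>) / (w(\<zeta>) - cnj (w(z))) - w'(\<zeta>) / (w(\<zeta>) - w(z))\<close>. Taylor
      expansion of the regular factors
  gives both operator product expansions. With \<open>N = w''/w'\<close> and \<open>u = w'/(w - cnj
      w)\<close> the vertex
  coefficient has the logarithmic derivative \<open>\<alpha>\<^sup>2 u + (\<i> \<alpha> b -
      \<alpha>\<^sup>2/2) N\<close>, and the claim becomes an identity
  between polynomials in \<open>N\<close>, \<open>N'\<close> and \<open>u\<close> which holds modulo
      \<open>2a(a + b) = 1\<close>.
\<close>

section \<open>Wirtinger calculus\<close>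

text \<open>\<open>ope_product\<close> is a representative picked by \<open>SOME\<close>, so nothing
  can be computed from its definition. Every product is handled through a complete expansion with
  all its Laurent coefficients, and uniqueness of these coefficients fixes the value up to
  \<open>field_eq\<close>. As the coefficients must be Fock space fields, smoothness in the base
  point has to be followed for every Taylor coefficient, and also for the non-holomorphic
  coefficient of the vertex field. The Virasoro field itself contains such a choice; it is replaced
  by the explicit \<open>stress_field\<close> before it is multiplied with the vertex field. Wick
  exponentials are infinite series of pairings, so even a single contraction rests on absolute
  convergence. The relation \<open>2 * a * (a + b) = 1\<close> is exactly the equality of the two
  coefficients of \<open>[Der 2 0, WExp \<alpha>]\<close>: \<open>\<alpha> + \<i> b\<close> in the
  operator product and \<open>\<alpha> / (2 a\<^sup>2)\<close> in the second derivative, where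
  \<open>\<alpha> = \<i> a\<close>. The coefficients of
  \<open>[Der 1 0, Der 1 0, WExp \<alpha>]\<close> agree for every nonzero \<open>a\<close>.\<close>

lemma dz_eq: "(f has_derivative L) (at z) \<Longrightarrow> dz f z = (L 1 - \<i> * L \<i>) / 2"
  by (simp add: dz_def Let_def frechet_derivative_at[symmetric])

lemma dzbar_eq: "(f has_derivative L) (at z) \<Longrightarrow> dzbar f z = (L 1 + \<i> * L \<i>) / 2"
  by (simp add: dzbar_def Let_def frechet_derivative_at[symmetric])

lemma frechet_derivative_cong_open:
  assumes "open U" "z \<in> U" "\<And>x. x \<in> U \<Longrightarrow> f x = g x"
  shows "frechet_derivative f (at z) = frechet_derivative g (at z)"
proof -
  have "(f has_derivative L) (at z) \<longleftrightarrow> (g has_derivative L) (at z)" for L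
    using assms by (metis has_derivative_transform_within_open)
  thus ?thesis
    by (simp add: frechet_derivative_def)
qed

lemma dz_cong_open:
  assumes "open U" "z \<in> U" "\<And>x. x \<in> U \<Longrightarrow> f x = g x"
  shows "dz f z = dz g z"
  using frechet_derivative_cong_open[OF assms] by (simp add: dz_def)

lemma dzbar_cong_open:
  assumes "open U" "z \<in> U" "\<And>x. x \<in> U \<Longrightarrow> f x = g x"
  shows "dzbar f z = dzbar g z"
  using frechet_derivative_cong_open[OF assms] by (simp add: dzbar_def)

lemma dz_funpow_cong_open:
  assumes "open U" "z \<in> U" "\<And>x. x \<in> U \<Longrightarrow> f x = g x"
  shows "(dz ^^ n) f z = (dz ^^ n) g z"
  using assms(2)
proof (induction n arbitrary: z)
  case (Suc n)
  then show ?case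
    using assms(1) by (auto intro!: dz_cong_open[of U])
qed (use assms in auto)

lemma differentiable_cong_open:
  assumes "open U" "z \<in> U" "\<And>x. x \<in> U \<Longrightarrow> f x = g x" "f differentiable (at z)"
  shows "g differentiable (at z)"
  using assms unfolding differentiable_def by (metis has_derivative_transform_within_open)

lemma dz_holomorphic: "(f has_field_derivative D) (at z) \<Longrightarrow> dz f z = D"
  unfolding has_field_derivative_def by (subst dz_eq) (auto simp: complex_eq_iff)

lemma dzbar_holomorphic: "(f has_field_derivative D) (at z) \<Longrightarrow> dzbar f z = 0"
  unfolding has_field_derivative_def by (subst dzbar_eq) (auto simp: complex_eq_iff)

lemma dz_const [simp]: "dz (\<lambda>x. c) = (\<lambda>x. 0)"
  by (simp add: fun_eq_iff dz_holomorphic)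

lemma dzbar_const [simp]: "dzbar (\<lambda>x. c) = (\<lambda>x. 0)"
  by (intro ext dzbar_holomorphic[where D = 0]) auto

lemma dz_add:
  assumes "f differentiable (at z)" "g differentiable (at z)"
  shows "dz (\<lambda>x. f x + g x) z = dz f z + dz g z"
proof -
  obtain L M where *: "(f has_derivative L) (at z)" "(g has_derivative M) (at z)"
    using assms by (auto simp: differentiable_def)
  show ?thesis
    unfolding dz_eq[OF has_derivative_add[OF *]] dz_eq[OF *(1)] dz_eq[OF *(2)]
    by (simp add: field_simps)
qed

lemma dzbar_add:
  assumes "f differentiable (at z)" "g differentiable (at z)"
  shows "dzbar (\<lambda>x. f x + g x) z = dzbar f z + dzbar g z"
proof -
  obtain L M where *: "(f has_derivative L) (at z)" "(g has_derivative M) (at z)"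
    using assms by (auto simp: differentiable_def)
  show ?thesis
    unfolding dzbar_eq[OF has_derivative_add[OF *]] dzbar_eq[OF *(1)] dzbar_eq[OF *(2)]
    by (simp add: field_simps)
qed

lemma dz_mult:
  assumes "f differentiable (at z)" "g differentiable (at z)"
  shows "dz (\<lambda>x. f x * g x) z = dz f z * g z + f z * dz g z"
proof -
  obtain L M where *: "(f has_derivative L) (at z)" "(g has_derivative M) (at z)"
    using assms by (auto simp: differentiable_def)
  show ?thesis
    unfolding dz_eq[OF has_derivative_mult[OF *]] dz_eq[OF *(1)] dz_eq[OF *(2)]
    by (simp add: field_simps)
qed

lemma dzbar_mult:
  assumes "f differentiable (at z)" "g differentiable (at z)"
  shows "dzbar (\<lambda>x. f x * g x) z = dzbar f z * g z + f z * dzbar g z"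
proof -
  obtain L M where *: "(f has_derivative L) (at z)" "(g has_derivative M) (at z)"
    using assms by (auto simp: differentiable_def)
  show ?thesis
    unfolding dzbar_eq[OF has_derivative_mult[OF *]] dzbar_eq[OF *(1)] dzbar_eq[OF *(2)]
    by (simp add: field_simps)
qed

lemma dz_cmult: "f differentiable (at z) \<Longrightarrow> dz (\<lambda>x. c * f x) z = c * dz f z"
  by (subst dz_mult) auto

lemma dz_cnj:
  assumes "f differentiable (at z)"
  shows "dz (\<lambda>x. cnj (f x)) z = cnj (dzbar f z)"
proof -
  obtain L where *: "(f has_derivative L) (at z)"
    using assms by (auto simp: differentiable_def)
  show ?thesis
    unfolding dz_eq[OF has_derivative_cnj[OF *]] dzbar_eq[OF *] by simp
qed

lemma dzbar_cnj:
  assumes "f differentiable (at z)"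
  shows "dzbar (\<lambda>x. cnj (f x)) z = cnj (dz f z)"
proof -
  obtain L where *: "(f has_derivative L) (at z)"
    using assms by (auto simp: differentiable_def)
  show ?thesis
    unfolding dzbar_eq[OF has_derivative_cnj[OF *]] dz_eq[OF *] by simp
qed

lemma differentiable_cnj:
  "f differentiable (at z) \<Longrightarrow> (\<lambda>x. cnj (f x)) differentiable (at z)"
  unfolding differentiable_def using has_derivative_cnj by blast

lemma holomorphic_on_imp_differentiable:
  "f holomorphic_on U \<Longrightarrow> open U \<Longrightarrow> z \<in> U \<Longrightarrow> f
      differentiable (at z)"
  using holomorphic_derivI[of f U z] by (auto simp: differentiable_def has_field_derivative_def)

lemma dz_holomorphic_on: "f holomorphic_on U \<Longrightarrow> open U \<Longrightarrow> z \<in> U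
    \<Longrightarrow> dz f z = deriv f z"
  by (intro dz_holomorphic holomorphic_derivI)

lemma dzbar_holomorphic_on: "f holomorphic_on U \<Longrightarrow> open U \<Longrightarrow> z \<in> U
    \<Longrightarrow> dzbar f z = 0"
  by (rule dzbar_holomorphic[OF holomorphic_derivI])

lemma dz_funpow_holomorphic_on:
  assumes "f holomorphic_on U" "open U" "z \<in> U"
  shows "(dz ^^ n) f z = (deriv ^^ n) f z"
  using assms(3)
proof (induction n arbitrary: z)
  case (Suc n)
  have "dz ((dz ^^ n) f) z = dz ((deriv ^^ n) f) z"
    using Suc assms(2) by (auto intro!: dz_cong_open[of U])
  also have "\<dots> = deriv ((deriv ^^ n) f) z"
    using Suc assms by (intro dz_holomorphic_on[of _ U] holomorphic_higher_deriv)
  finally show ?case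
    by simp
qed auto

text \<open>The Cauchy-Riemann equation in Wirtinger form says \<open>L \<i> = \<i> * L 1\<close>,
  and a real-linear map with this property is multiplication by \<open>L 1\<close>.\<close>

lemma has_field_derivative_dz:
  assumes "f differentiable (at z)" "dzbar f z = 0"
  shows "(f has_field_derivative dz f z) (at z)"
proof -
  obtain L where L: "(f has_derivative L) (at z)"
    using assms by (auto simp: differentiable_def)
  interpret L: bounded_linear L
    using L by (rule has_derivative_bounded_linear)
  have "L 1 + \<i> * L \<i> = 0"
    using assms(2) dzbar_eq[OF L] by simp
  hence Li: "L \<i> = \<i> * L 1"
    by (simp add: complex_eq_iff)
  hence dz: "dz f z = L 1"
    using dz_eq[OF L] by (simp add: algebra_simps)
  have "L h = L 1 * h" for h
  proof -
    have "L h = L (Re h *\<^sub>R 1 + Im h *\<^sub>R \<i>)"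
      by (rule arg_cong[of _ _ L]) (simp add: complex_eq_iff)
    also have "\<dots> = Re h *\<^sub>R L 1 + Im h *\<^sub>R L \<i>"
      by (simp only: L.add L.scaleR)
    finally show ?thesis
      by (simp add: Li complex_eq_iff algebra_simps)
  qed
  hence "L = (\<lambda>h. L 1 * h)"
    by blast
  thus ?thesis
    using L dz unfolding has_field_derivative_def by metis
qed

section \<open>Smooth functions\<close>

lemma Ck_on_cong:
  assumes "open U" "\<And>x. x \<in> U \<Longrightarrow> f x = g x"
  shows "Ck_on n U f = Ck_on n U g"
  using assms(2)
proof (induction n arbitrary: f g)
  case 0
  then show ?case by simp
next
  case (Suc n)
  have "Ck_on n U (dz f) = Ck_on n U (dz g)" "Ck_on n U (dzbar f) = Ck_on n U (dzbar g)"
    by (rule Suc.IH, erule dz_cong_open[OF assms(1)] dzbar_cong_open[OF assms(1)], erule Suc.prems)+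
  moreover have "f differentiable at z \<longleftrightarrow> g differentiable at z" if "z \<in> U" for z
    using differentiable_cong_open[OF assms(1) that] Suc.prems by (metis (no_types))
  ultimately show ?case
    by simp
qed

lemma continuous_on_differentiable:
  "(\<And>z. z \<in> U \<Longrightarrow> f differentiable (at z)) \<Longrightarrow> continuous_on U f"
  by (intro continuous_at_imp_continuous_on ballI differentiable_imp_continuous_within)

text \<open>In the product rule one factor stays undifferentiated and has to be used at one order
  less than assumed; this supplies the lower order.\<close>

lemma Ck_on_Suc_imp: "Ck_on (Suc n) U f \<Longrightarrow> Ck_on n U f"
proof (induction n arbitrary: f)
  case 0
  then show ?case
    by (simp add: continuous_on_differentiable)
next
  case (Suc n)
  have "\<forall>z\<in>U. f differentiable (at z)" "Ck_on (Suc n) U (dz f)" "Ck_on (Suc n) U (dzbar f)"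
    using Suc.prems unfolding Ck_on.simps(2)[of "Suc n"] by blast+
  hence "(\<forall>z\<in>U. f differentiable (at z)) \<and> Ck_on n U (dz f) \<and> Ck_on n U (dzbar f)"
    using Suc.IH by blast
  then show ?case
    by (rule Ck_on.simps(2)[THEN iffD2])
qed

lemma Ck_on_const: "Ck_on n U (\<lambda>x. c)"
  by (induction n arbitrary: c) auto

lemma Ck_on_add:
  assumes "open U" "Ck_on n U f" "Ck_on n U g"
  shows "Ck_on n U (\<lambda>x. f x + g x)"
  using assms(2,3)
proof (induction n arbitrary: f g)
  case (Suc n)
  have "Ck_on n U (dz (\<lambda>x. f x + g x)) = Ck_on n U (\<lambda>x. dz f x + dz g x)"
    "Ck_on n U (dzbar (\<lambda>x. f x + g x)) = Ck_on n U (\<lambda>x. dzbar f x + dzbar g x)"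
    using Suc.prems by (intro Ck_on_cong[OF assms(1)]; auto intro!: dz_add dzbar_add)+
  then show ?case
    using Suc by auto
qed (auto intro: continuous_intros)

lemma Ck_on_mult:
  assumes "open U" "Ck_on n U f" "Ck_on n U g"
  shows "Ck_on n U (\<lambda>x. f x * g x)"
  using assms(2,3)
proof (induction n arbitrary: f g)
  case (Suc n)
  have eq: "Ck_on n U (dz (\<lambda>x. f x * g x)) = Ck_on n U (\<lambda>x. dz f x * g x + f x * dz g x)"
    "Ck_on n U (dzbar (\<lambda>x. f x * g x)) = Ck_on n U (\<lambda>x. dzbar f x * g x + f x * dzbar g x)"
    using Suc.prems by (intro Ck_on_cong[OF assms(1)]; auto intro!: dz_mult dzbar_mult)+
  have fg: "Ck_on n U f" "Ck_on n U g"
    using Suc.prems Ck_on_Suc_imp by blast+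
  show ?case
    using Suc fg by (auto simp: eq intro!: Ck_on_add[OF assms(1)])
qed (auto intro: continuous_intros)

lemma Ck_on_cnj:
  assumes "open U" "Ck_on n U f"
  shows "Ck_on n U (\<lambda>x. cnj (f x))"
  using assms(2)
proof (induction n arbitrary: f)
  case (Suc n)
  have "Ck_on n U (dz (\<lambda>x. cnj (f x))) = Ck_on n U (\<lambda>x. cnj (dzbar f x))"
    "Ck_on n U (dzbar (\<lambda>x. cnj (f x))) = Ck_on n U (\<lambda>x. cnj (dz f x))"
    using Suc.prems by (intro Ck_on_cong[OF assms(1)]; auto intro!: dz_cnj dzbar_cnj)+
  then show ?case
    using Suc by (auto intro: differentiable_cnj)
qed (auto intro: continuous_intros)

lemma Ck_on_holomorphic:
  assumes "open U" "f holomorphic_on U"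
  shows "Ck_on n U f"
  using assms(2)
proof (induction n arbitrary: f)
  case (Suc n)
  have "Ck_on n U (dz f) = Ck_on n U (deriv f)"
    "Ck_on n U (dzbar f) = Ck_on n U (\<lambda>_. 0)"
    using Suc.prems assms(1)
    by (intro Ck_on_cong[OF assms(1)]; auto intro!: dz_holomorphic_on dzbar_holomorphic_on)+
  then show ?case
    using Suc assms(1) by (auto intro!: Ck_on_const holomorphic_deriv holomorphic_on_imp_differentiable)
qed (auto intro: holomorphic_on_imp_continuous_on)

lemma smooth_on_cong:
  "open U \<Longrightarrow> (\<And>x. x \<in> U \<Longrightarrow> f x = g x) \<Longrightarrow>
      smooth_on U f = smooth_on U g"
  unfolding smooth_on_def using Ck_on_cong by metis

lemma smooth_on_const: "smooth_on U (\<lambda>x. c)"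
  by (simp add: smooth_on_def Ck_on_const)

lemma smooth_on_add:
  "open U \<Longrightarrow> smooth_on U f \<Longrightarrow> smooth_on U g \<Longrightarrow>
      smooth_on U (\<lambda>x. f x + g x)"
  by (simp add: smooth_on_def Ck_on_add)

lemma smooth_on_mult:
  "open U \<Longrightarrow> smooth_on U f \<Longrightarrow> smooth_on U g \<Longrightarrow>
      smooth_on U (\<lambda>x. f x * g x)"
  by (simp add: smooth_on_def Ck_on_mult)

lemma smooth_on_cnj: "open U \<Longrightarrow> smooth_on U f \<Longrightarrow> smooth_on U
    (\<lambda>x. cnj (f x))"
  by (simp add: smooth_on_def Ck_on_cnj)

lemma smooth_on_holomorphic: "open U \<Longrightarrow> f holomorphic_on U \<Longrightarrow> smooth_on U f"
  by (simp add: smooth_on_def Ck_on_holomorphic)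

lemma smooth_on_cmult: "open U \<Longrightarrow> smooth_on U f \<Longrightarrow> smooth_on U
    (\<lambda>x. c * f x)"
  by (intro smooth_on_mult smooth_on_const)

lemma smooth_on_sum:
  "open U \<Longrightarrow> (\<And>i. i \<in> I \<Longrightarrow> smooth_on U (f i))
      \<Longrightarrow> smooth_on U (\<lambda>x. \<Sum>i\<in>I. f i x)"
  by (induction I rule: infinite_finite_induct) (auto intro: smooth_on_add smooth_on_const)

lemma smooth_on_imp_differentiable: "smooth_on U f \<Longrightarrow> z \<in> U \<Longrightarrow> f
    differentiable (at z)"
  unfolding smooth_on_def by (metis Ck_on.simps(2))

text \<open>A solution of this linear first order system gains one derivative at a time.\<close>

lemma smooth_on_log_derivative:
  assumes "open U" "\<And>z. z \<in> U \<Longrightarrow> v differentiable (at z)"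
    "\<And>z. z \<in> U \<Longrightarrow> dz v z = v z * g z" "\<And>z. z \<in> U \<Longrightarrow>
        dzbar v z = v z * h z"
    "smooth_on U g" "smooth_on U h"
  shows "smooth_on U v"
proof -
  have "Ck_on n U v" for n
  proof (induction n)
    case 0
    then show ?case
      using assms(2) by (simp add: continuous_on_differentiable)
  next
    case (Suc n)
    have "Ck_on n U (dz v) = Ck_on n U (\<lambda>z. v z * g z)"
      "Ck_on n U (dzbar v) = Ck_on n U (\<lambda>z. v z * h z)"
      using assms by (intro Ck_on_cong; auto)+
    then show ?case
      using Suc assms by (auto intro!: Ck_on_mult simp: smooth_on_def)
  qed
  thus ?thesis
    by (simp add: smooth_on_def)
qed

text \<open>Differentiating \<open>inverse (f z) * f z = 1\<close> expresses both Wirtinger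
  derivatives of the inverse through the inverse itself and derivatives of \<open>f\<close>, so its
  regularity climbs one order at a time.\<close>

lemma smooth_on_inverse:
  assumes "open U" "smooth_on U f" "\<And>z. z \<in> U \<Longrightarrow> f z \<noteq> 0"
  shows "smooth_on U (\<lambda>z. inverse (f z))"
proof -
  have "Ck_on n U (\<lambda>z. inverse (f z))" for n
  proof (induction n)
    case 0
    have "Ck_on 0 U f"
      using assms(2) unfolding smooth_on_def by blast
    thus ?case
      using assms(3) by (auto intro!: continuous_intros)
  next
    case (Suc n)
    have f: "f differentiable (at z)" if "z \<in> U" for z
      using assms(2) that by (rule smooth_on_imp_differentiable)
    have d: "(\<lambda>z. inverse (f z)) differentiable (at z)" if "z \<in> U" for z
      using f[OF that] assms(3)[OF that] by (rule differentiable_inverse)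
    have "dz (\<lambda>z. inverse (f z) * f z) z = 0" "dzbar (\<lambda>z. inverse (f z) * f z) z = 0"
      if "z \<in> U" for z
      using dz_cong_open[OF assms(1) that, of "\<lambda>z. inverse (f z) * f z" "\<lambda>_. 1"]
        dzbar_cong_open[OF assms(1) that, of "\<lambda>z. inverse (f z) * f z" "\<lambda>_. 1"]
            assms(3) by auto
    hence "dz (\<lambda>z. inverse (f z)) z * f z + inverse (f z) * dz f z = 0"
      "dzbar (\<lambda>z. inverse (f z)) z * f z + inverse (f z) * dzbar f z = 0" if "z \<in> U" for z
      using that by (simp_all only: dz_mult[OF d f] dzbar_mult[OF d f])
    moreover have "X = -1 * (Y * (inverse a * inverse a))"
      if "X * a + inverse a * Y = 0" "a \<noteq> 0" for X Y a :: complex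
    proof -
      have "X * a = - (inverse a * Y)"
        using that(1) by (simp add: add_eq_0_iff2)
      hence "X * a * inverse a = - (inverse a * Y) * inverse a"
        by simp
      moreover have "X * a * inverse a = X"
        using that(2) by (simp add: mult.assoc)
      ultimately show ?thesis
        by (simp add: mult_ac)
    qed
    ultimately have inv_d: "dz (\<lambda>z. inverse (f z)) z = -1 * (dz f z * (inverse (f z) *
        inverse (f z)))"
      "dzbar (\<lambda>z. inverse (f z)) z = -1 * (dzbar f z * (inverse (f z) * inverse (f z)))"
      if "z \<in> U" for z
      using that assms(3) by blast+
    have "Ck_on n U (dz (\<lambda>z. inverse (f z))) =
        Ck_on n U (\<lambda>z. -1 * (dz f z * (inverse (f z) * inverse (f z))))"
      "Ck_on n U (dzbar (\<lambda>z. inverse (f z))) =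
        Ck_on n U (\<lambda>z. -1 * (dzbar f z * (inverse (f z) * inverse (f z))))"
      by (rule Ck_on_cong[OF assms(1)], erule inv_d)+
    moreover have "Ck_on (Suc n) U f"
      using assms(2) unfolding smooth_on_def by blast
    hence df: "Ck_on n U (dz f)" "Ck_on n U (dzbar f)"
      by auto
    moreover have "Ck_on n U (\<lambda>z. -1 * (dz f z * (inverse (f z) * inverse (f z))))"
      "Ck_on n U (\<lambda>z. -1 * (dzbar f z * (inverse (f z) * inverse (f z))))"
      by (intro Ck_on_mult[OF assms(1)] Ck_on_const df Suc)+
    ultimately show ?case
      using d by simp
  qed
  thus ?thesis
    by (simp add: smooth_on_def)
qed

section \<open>Power series in the coordinate difference with coefficients smooth in the base
  point\<close>

definition smooth_fps :: "complex set \<Rightarrow> (complex \<Rightarrow> complex fps)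
    \<Rightarrow> bool" where
  "smooth_fps U P \<longleftrightarrow> (\<forall>n. smooth_on U (\<lambda>z. fps_nth (P z) n))"

lemma smooth_fps_const: "smooth_fps U (\<lambda>z. P)"
  by (simp add: smooth_fps_def smooth_on_const)

lemma smooth_fps_fps_const: "smooth_on U f \<Longrightarrow> smooth_fps U (\<lambda>z. fps_const (f z))"
  unfolding smooth_fps_def
proof
  fix n assume "smooth_on U f"
  thus "smooth_on U (\<lambda>z. fps_nth (fps_const (f z)) n)"
    by (cases n) (simp_all add: smooth_on_const)
qed

lemma smooth_fps_add:
  "open U \<Longrightarrow> smooth_fps U P \<Longrightarrow> smooth_fps U Q \<Longrightarrow>
      smooth_fps U (\<lambda>z. P z + Q z)"
  by (auto simp: smooth_fps_def intro!: smooth_on_add)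

lemma smooth_fps_mult:
  "open U \<Longrightarrow> smooth_fps U P \<Longrightarrow> smooth_fps U Q \<Longrightarrow>
      smooth_fps U (\<lambda>z. P z * Q z)"
  by (auto simp: smooth_fps_def fps_mult_nth intro!: smooth_on_sum smooth_on_mult)

lemma smooth_fps_minus: "open U \<Longrightarrow> smooth_fps U P \<Longrightarrow> smooth_fps U
    (\<lambda>z. - P z)"
  using smooth_fps_mult[OF _ smooth_fps_const[of U "-1"], of P] by simp

lemma smooth_fps_diff:
  "open U \<Longrightarrow> smooth_fps U P \<Longrightarrow> smooth_fps U Q \<Longrightarrow>
      smooth_fps U (\<lambda>z. P z - Q z)"
  using smooth_fps_add[OF _ _ smooth_fps_minus, of U P Q] by simp

lemma smooth_fps_deriv:
  "open U \<Longrightarrow> smooth_fps U P \<Longrightarrow> smooth_fps U (\<lambda>z. fps_deriv (P z))"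
  by (auto simp: smooth_fps_def intro!: smooth_on_cmult)

text \<open>The coefficients of a reciprocal obey a recursion in which only the constant term is
  inverted, so smoothness follows by strong induction on the index.\<close>

lemma smooth_fps_inverse:
  assumes "open U" "smooth_fps U P" "\<And>z. z \<in> U \<Longrightarrow> fps_nth (P z) 0 \<noteq> 0"
  shows "smooth_fps U (\<lambda>z. inverse (P z))"
proof -
  have "smooth_on U (\<lambda>z. fps_nth (inverse (P z)) n)" for n
  proof (induction n rule: less_induct)
    case (less n)
    have inv0: "smooth_on U (\<lambda>z. inverse (fps_nth (P z) 0))"
      using assms by (intro smooth_on_inverse) (auto simp: smooth_fps_def)
    show ?case
    proof (cases n)
      case 0
      then show ?thesis
        using inv0 by simp
    next
      case (Suc m)
      have "fps_nth (inverse (P z)) n =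
          -1 * (inverse (fps_nth (P z) 0) * (\<Sum>i=1..n. fps_nth (P z) i * fps_nth (inverse (P z))
              (n - i)))"
        if "z \<in> U" for z
      proof -
        have "fps_nth (P z * inverse (P z)) n = 0"
          using inverse_mult_eq_1'[OF assms(3)[OF that]] Suc by simp
        moreover have "fps_nth (P z * inverse (P z)) n = fps_nth (P z) 0 * fps_nth (inverse (P z)) n +
            (\<Sum>i=1..n. fps_nth (P z) i * fps_nth (inverse (P z)) (n - i))"
          by (simp add: fps_mult_nth sum.atLeast_Suc_atMost)
        ultimately show ?thesis
          using assms(3)[OF that] by (simp add: field_simps add_eq_0_iff)
      qed
      moreover have "smooth_on U (\<lambda>z. -1 * (inverse (fps_nth (P z) 0) *
          (\<Sum>i=1..n. fps_nth (P z) i * fps_nth (inverse (P z)) (n - i))))"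
        using assms less inv0
        by (intro smooth_on_mult smooth_on_const smooth_on_sum) (auto simp: smooth_fps_def)
      ultimately show ?thesis
        using smooth_on_cong[OF assms(1)] by (metis (no_types, lifting))
    qed
  qed
  thus ?thesis
    by (simp add: smooth_fps_def)
qed

lemma smooth_fps_expansion:
  assumes "open U" "f holomorphic_on U"
  shows "smooth_fps U (\<lambda>z. fps_expansion f z)"
  unfolding smooth_fps_def fps_expansion_def fps_nth_Abs_fps
proof
  fix n
  show "smooth_on U (\<lambda>z. (deriv ^^ n) f z / fact n)"
    using assms by (intro smooth_on_holomorphic holomorphic_intros holomorphic_higher_deriv) auto
qed

section \<open>The Green's function of a simply connected domain\<close>

text \<open>Harmonicity makes \<open>dz u\<close> holomorphic. A primitive of its double exists by
  simple connectivity, and the real part of this primitive has the same differential as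
  \<open>u\<close>.\<close>

lemma harmonic_on_imp_Re_holomorphic:
  assumes "open D" "simply_connected D" "harmonic_on D u"
  obtains F where "F holomorphic_on D" "\<And>z. z \<in> D \<Longrightarrow> u z = Re (F z)"
proof -
  define U where "U = (\<lambda>z. complex_of_real (u z))"
  have "Ck_on (Suc (Suc 0)) D U"
    using assms(3) by (simp add: harmonic_on_def U_def numeral_2_eq_2)
  hence dU: "\<And>z. z \<in> D \<Longrightarrow> U differentiable (at z)"
    and ddU: "\<And>z. z \<in> D \<Longrightarrow> dz U differentiable (at z)" "\<And>z. z \<in> D
        \<Longrightarrow> dzbar U differentiable (at z)"
    by auto
  have lap: "dz (dzbar U) z = 0" if "z \<in> D" for z
    using assms(3) that by (simp add: harmonic_on_def U_def)
  have cnjU: "dz U z = cnj (dzbar U z)" if "z \<in> D" for z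
    using dz_cnj[OF dU[OF that]] by (simp add: U_def)
  \<comment> \<open>The order of the two derivatives is exchanged by conjugation, \<open>u\<close>
    being real, rather than by symmetry of second derivatives.\<close>
  have "dzbar (dz U) z = 0" if z: "z \<in> D" for z
  proof -
    have "dzbar (dz U) z = dzbar (\<lambda>x. cnj (dzbar U x)) z"
      by (rule dzbar_cong_open[OF assms(1) z]) (rule cnjU)
    also have "\<dots> = cnj (dz (dzbar U) z)"
      by (rule dzbar_cnj) (rule ddU(2)[OF z])
    finally show ?thesis
      using lap[OF z] by simp
  qed
  hence "(dz U has_field_derivative dz (dz U) z) (at z)" if "z \<in> D" for z
    using has_field_derivative_dz ddU(1) that by blast
  hence "dz U holomorphic_on D"
    using assms(1) by (auto simp: holomorphic_on_open)
  \<comment> \<open>The factor 2 compensates for \<open>dz (Re H) = H' / 2\<close>.\<close>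
  hence "(\<lambda>z. 2 * dz U z) holomorphic_on D"
    by (intro holomorphic_intros)
  then obtain H where H: "\<And>z. z \<in> D \<Longrightarrow> (H has_field_derivative 2 * dz U z) (at z)"
    using assms(1,2) simply_connected_eq_global_primitive by metis
  have conn: "connected D"
    using assms(2) simply_connected_imp_connected by blast
  have "((\<lambda>z. U z - of_real (Re (H z))) has_derivative (\<lambda>h. 0)) (at z)" if z: "z
      \<in> D" for z
  proof -
    obtain L where L: "(U has_derivative L) (at z)"
      using dU[OF z] by (auto simp: differentiable_def)
    interpret L: bounded_linear L
      using L by (rule has_derivative_bounded_linear)
    have "((\<lambda>z. Im (U z)) has_derivative (\<lambda>h. Im (L h))) (at z)"
      using L by (rule has_derivative_Im)
    hence "((\<lambda>z. 0) has_derivative (\<lambda>h. Im (L h))) (at z)"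
      by (simp add: U_def)
    hence "(\<lambda>h. Im (L h)) = (\<lambda>h. 0)"
      using has_derivative_const has_derivative_unique by blast
    hence Im0: "Im (L h) = 0" for h
      by meson
    \<comment> \<open>A real-valued differential is determined by its holomorphic half.\<close>
    have "L h = of_real (Re (2 * dz U z * h))" for h
    proof -
      have "L h = L (Re h *\<^sub>R 1 + Im h *\<^sub>R \<i>)"
        by (rule arg_cong[of _ _ L]) (simp add: complex_eq_iff)
      also have "\<dots> = Re h *\<^sub>R L 1 + Im h *\<^sub>R L \<i>"
        by (simp only: L.add L.scaleR)
      finally show ?thesis
        by (simp add: dz_eq[OF L] complex_eq_iff Im0)
    qed
    hence "L = (\<lambda>h. of_real (Re (2 * dz U z * h)))"
      by blast
    moreover have "((\<lambda>z. of_real (Re (H z)) :: complex) has_derivative (\<lambda>h. of_real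
        (Re (2 * dz U z * h)))) (at z)"
      using H[OF z] unfolding has_field_derivative_def
      by (intro has_derivative_of_real has_derivative_Re)
    ultimately show "((\<lambda>z. U z - of_real (Re (H z))) has_derivative (\<lambda>h. 0)) (at z)"
      using has_derivative_diff[OF L] by fastforce
  qed
  hence const: "U x - of_real (Re (H x)) = U y - of_real (Re (H y))" if "x \<in> D" "y \<in> D" for x y
    using has_derivative_zero_unique_connected[OF assms(1) conn _ that] by blast
  obtain c where c: "\<And>z. z \<in> D \<Longrightarrow> U z - of_real (Re (H z)) = c"
    using const by (cases "D = {}") blast+
  have "H holomorphic_on D"
    using H assms(1) by (auto simp: holomorphic_on_open)
  hence "(\<lambda>z. H z + c) holomorphic_on D"
    by (intro holomorphic_intros)
  moreover have "u z = Re (H z + c)" if "z \<in> D" for z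
    using arg_cong[OF c[OF that], of Re] by (simp add: U_def)
  ultimately show ?thesis
    using that by blast
qed

text \<open>Boundary values are expressed by a bound outside a compact set. If the bound failed, the
  modulus of \<open>exp F\<close> would attain its maximum over \<open>D\<close> at a point of
  \<open>K\<close>, so \<open>exp F\<close> would be constant, against the bound off
  \<open>K\<close>.\<close>

lemma Re_le_of_boundary:
  assumes "open D" "connected D" "D \<noteq> {}" "F holomorphic_on D"
    "compact K" "K \<subseteq> D" "\<And>z. z \<in> D - K \<Longrightarrow> Re (F z) \<le> e" "z \<in> D"
  shows "Re (F z) \<le> e"
proof (rule ccontr)
  assume neg: "\<not> Re (F z) \<le> e"
  hence zK: "z \<in> K"
    using assms(7,8) by blast
  have cont: "continuous_on K (\<lambda>x. cmod (exp (F x)))"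
    using holomorphic_on_imp_continuous_on[OF assms(4)] assms(6)
    by (intro continuous_intros) (auto intro: continuous_on_subset)
  obtain \<xi> where \<xi>: "\<xi> \<in> K" "\<And>y. y \<in> K \<Longrightarrow> cmod (exp (F y))
      \<le> cmod (exp (F \<xi>))"
    using continuous_attains_sup[OF assms(5) _ cont] zK by blast
  have big: "Re (F \<xi>) > e"
    using \<xi>(2)[OF zK] neg by simp
  have "(\<lambda>x. exp (F x)) constant_on D"
  proof (rule maximum_modulus_principle[OF _ assms(1,2,1) subset_refl])
    show "(\<lambda>x. exp (F x)) holomorphic_on D"
      using assms(4) by (intro holomorphic_intros)
    show "\<xi> \<in> D"
      using \<xi>(1) assms(6) by blast
    show "cmod (exp (F x)) \<le> cmod (exp (F \<xi>))" if "x \<in> D" for x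
      using \<xi>(2)[of x] assms(7)[of x] big that by (cases "x \<in> K") auto
  qed
  \<comment> \<open>A nonempty open subset of the plane is not compact, so a point of
    \<open>D\<close> lies outside \<open>K\<close>.\<close>
  moreover have "D \<noteq> K"
    using assms(1,3,5) compact_open by blast
  then obtain y where "y \<in> D - K"
    using assms(6) by blast
  ultimately have "exp (F y) = exp (F \<xi>)"
    using \<xi>(1) assms(6) by (auto simp: constant_on_def)
  hence "cmod (exp (F y)) = cmod (exp (F \<xi>))"
    by simp
  thus False
    using assms(7)[OF \<open>y \<in> D - K\<close>] big by simp
qed

text \<open>Method of images: the logarithmic potential of a source at \<open>y\<close> minus that
  of its mirror image \<open>cnj y\<close>. The quotient is split into two logarithms so that each
  can be differentiated alone.\<close>

definition half_plane_green :: "complex \<Rightarrow> complex \<Rightarrow> real" where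
  "half_plane_green x y = ln (cmod (x - cnj y)) - ln (cmod (x - y))"

lemma cnj_upper_half_plane_neq:
  "x \<in> upper_half_plane \<Longrightarrow> y \<in> upper_half_plane \<Longrightarrow> x - cnj y \<noteq> 0"
  by (auto simp: upper_half_plane_def complex_eq_iff)

text \<open>The squares of the two distances differ by \<open>4 * Im a * Im x\<close>.\<close>

lemma cmod_diff_le_cnj_iff:
  assumes "Im a > 0"
  shows "cmod (x - a) < cmod (x - cnj a) \<longleftrightarrow> Im x > 0"
proof -
  have "cmod (x - a) < cmod (x - cnj a) \<longleftrightarrow> (cmod (x - a))\<^sup>2 < (cmod (x -
      cnj a))\<^sup>2"
    by (smt (verit) norm_ge_zero power2_less_imp_less power_strict_mono zero_less_numeral)
  also have "(cmod (x - cnj a))\<^sup>2 = (cmod (x - a))\<^sup>2 + 4 * (Im a * Im x)"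
    unfolding cmod_power2 by (simp add: power2_eq_square algebra_simps)
  also have "(cmod (x - a))\<^sup>2 < (cmod (x - a))\<^sup>2 + 4 * (Im a * Im x)
      \<longleftrightarrow> 0 < Im a * Im x"
    by simp
  finally show ?thesis
    using assms by (simp add: zero_less_mult_iff)
qed

text \<open>This is the set where the half-plane Green's function with pole \<open>a\<close> is at
  least \<open>e\<close>; its compactness inside the half-plane expresses the zero boundary values.
  Written without logarithms, it contains the pole and is visibly closed.\<close>

lemma compact_green_superlevel:
  assumes "Im a > 0" "e > 0"
  shows "compact {x. exp e * cmod (x - a) \<le> cmod (x - cnj a)}" (is "compact ?C")
    and "{x. exp e * cmod (x - a) \<le> cmod (x - cnj a)} \<subseteq> upper_half_plane"
proof -
  have deriv_fps: "exp e > 1"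
    using assms by simp
  have "cmod x \<le> cmod a + 2 * Im a / (exp e - 1)" if "x \<in> ?C" for x
  proof -
    have "cmod (x - cnj a) \<le> cmod (x - a) + cmod (a - cnj a)"
      using norm_triangle_ineq[of "x - a" "a - cnj a"] by simp
    also have "cmod (a - cnj a) = 2 * Im a"
      using assms by (simp add: complex_diff_cnj norm_mult)
    finally have "(exp e - 1) * cmod (x - a) \<le> 2 * Im a"
      using that by (simp add: algebra_simps)
    hence "cmod (x - a) \<le> 2 * Im a / (exp e - 1)"
      using deriv_fps by (simp add: pos_le_divide_eq mult.commute)
    thus ?thesis
      using norm_triangle_ineq2[of x a] by linarith
  qed
  hence "bounded ?C"
    by (auto simp: bounded_iff)
  moreover have "closed ?C"
    by (intro closed_Collect_le continuous_intros)
  ultimately show "compact ?C"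
    by (simp add: compact_eq_bounded_closed)
  show "?C \<subseteq> upper_half_plane"
  proof
    fix x assume x: "x \<in> ?C"
    show "x \<in> upper_half_plane"
    proof (cases "x = a")
      case False
      hence "1 * cmod (x - a) < exp e * cmod (x - a)"
        using deriv_fps by (intro mult_strict_right_mono) auto
      thus ?thesis
        using x cmod_diff_le_cnj_iff[OF assms(1), of x] by (simp add: upper_half_plane_def)
    qed (use assms in \<open>simp add: upper_half_plane_def\<close>)
  qed
qed

text \<open>As functions of the first variable, both sides are \<open>- ln (cmod (x - z))\<close>
  plus the real part of a function holomorphic on all of \<open>D\<close>. The singularities cancel
  in the difference \<open>F1 - F0\<close>, whose real part is small off compact sets; the maximum
  principle is applied to both signs.\<close>

theorem dirichlet_green_formula:
  assumes "open D" "D \<noteq> {}" "simply_connected D" "dirichlet_green D G"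
    "conformal_onto D upper_half_plane w" "z \<in> D" "\<zeta> \<in> D" "\<zeta> \<noteq> z"
  shows "G \<zeta> z = half_plane_green (w \<zeta>) (w z)"
proof -
  have w: "w holomorphic_on D" "inj_on w D" "w ` D = upper_half_plane"
    using assms(5) by (auto simp: conformal_onto_def)
  define a where "a = w z"
  have a: "Im a > 0"
    using w(3) assms(6) by (auto simp: a_def upper_half_plane_def)
  have conn: "connected D"
    using assms(3) simply_connected_imp_connected by blast
  obtain h where h: "harmonic_on D h" "\<And>x. x \<in> D - {z} \<Longrightarrow> G x z = - ln (cmod
      (x - z)) + h x"
    and bd: "\<And>e. e > 0 \<Longrightarrow> \<exists>K. compact K \<and> K \<subseteq> D \<and>
        (\<forall>x\<in>D - K - {z}. \<bar>G x z\<bar> < e)"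
    using assms(4,6) unfolding dirichlet_green_def by metis
  obtain F1 where F1: "F1 holomorphic_on D" "\<And>x. x \<in> D \<Longrightarrow> h x = Re (F1 x)"
    using harmonic_on_imp_Re_holomorphic[OF assms(1,3) h(1)] by blast
  \<comment> \<open>The difference quotient of \<open>w\<close>, continued over \<open>z\<close>.
    Injectivity of \<open>w\<close> keeps it free of zeros (at \<open>z\<close> because the
    derivative does not vanish), so \<open>(w x - cnj a) / Q x\<close> has a holomorphic logarithm
    \<open>F0\<close>.\<close>
  define Q where "Q = (\<lambda>x. if x = z then deriv w z else (w x - a) / (x - z))"
  have Q: "Q holomorphic_on D"
    unfolding Q_def a_def using w(1) assms(1) by (rule pole_lemma_open)
  have Q0: "Q x \<noteq> 0" if "x \<in> D" for x
    using holomorphic_injective_imp_regular[OF w(1) assms(1) w(2) assms(6)] inj_onD[OF w(2) _ that assms(6)]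
    by (auto simp: Q_def a_def)
  have N0: "w x - cnj a \<noteq> 0" if "x \<in> D" for x
    using that w(3) a by (intro cnj_upper_half_plane_neq) (auto simp: upper_half_plane_def)
  have "(\<lambda>x. (w x - cnj a) / Q x) holomorphic_on D"
    using w(1) Q Q0 by (intro holomorphic_intros) auto
  moreover have "(w x - cnj a) / Q x \<noteq> 0" if "x \<in> D" for x
    using N0[OF that] Q0[OF that] by simp
  ultimately obtain F0 where F0: "F0 holomorphic_on D" "\<And>x. x \<in> D \<Longrightarrow> (w x -
      cnj a) / Q x = exp (F0 x)"
    using simply_connected_eq_holomorphic_log[OF assms(1), THEN iffD1, OF assms(3), THEN conjunct2,
        THEN spec[of _ "\<lambda>x. (w x - cnj a) / Q x"]] by blast
  have model: "half_plane_green (w x) a = - ln (cmod (x - z)) + Re (F0 x)" if "x \<in> D - {z}" for x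
  proof -
    have "cmod (exp (F0 x)) = cmod (w x - cnj a) / (cmod (w x - a) / cmod (x - z))"
      using that by (simp add: F0(2)[symmetric] Q_def norm_divide norm_mult)
    moreover have "w x \<noteq> a" "x \<noteq> z"
      using that inj_onD[OF w(2), of x z] assms(6) by (auto simp: a_def)
    ultimately have "Re (F0 x) = ln (cmod (w x - cnj a) / (cmod (w x - a) / cmod (x - z)))"
      by (metis ln_exp norm_exp_eq_Re)
    also have "\<dots> = ln (cmod (w x - cnj a)) - (ln (cmod (w x - a)) - ln (cmod (x - z)))"
      using \<open>w x \<noteq> a\<close> \<open>x \<noteq> z\<close> N0[of x] that by (subst
          ln_div; simp add: ln_div)+
    finally show ?thesis
      by (simp add: half_plane_green_def)
  qed
  obtain g where g: "g holomorphic_on upper_half_plane" "\<And>x. x \<in> D \<Longrightarrow> g (w x) = x"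
    using holomorphic_has_inverse[OF w(1) assms(1) w(2)] w(3) by metis
  \<comment> \<open>Each of the two Green's functions is below \<open>e / 2\<close> off a compact
    set; for the pulled-back one this set is the image under the inverse map \<open>g\<close> of the
    superlevel set in the half-plane.\<close>
  have small: "\<exists>K. compact K \<and> K \<subseteq> D \<and> (\<forall>x\<in>D - K - {z}.
      \<bar>Re (F1 x - F0 x)\<bar> < e)"
    if e: "e > 0" for e
  proof -
    define C where "C = {x. exp (e / 2) * cmod (x - a) \<le> cmod (x - cnj a)}"
    have C: "compact C" "C \<subseteq> upper_half_plane"
      using compact_green_superlevel[OF a, of "e / 2"] e by (auto simp: C_def)
    have "compact (g ` C)"
      using C g(1) by (intro compact_continuous_image)
        (auto intro: continuous_on_subset holomorphic_on_imp_continuous_on)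
    moreover have gC: "g ` C \<subseteq> D"
      using C(2) w(3) g(2) by force
    obtain K where K: "compact K" "K \<subseteq> D" "\<And>x. x \<in> D - K - {z} \<Longrightarrow>
        \<bar>G x z\<bar> < e / 2"
      using bd[of "e / 2"] e by auto
    have "\<bar>Re (F1 x - F0 x)\<bar> < e" if x: "x \<in> D - (K \<union> g ` C) - {z}" for x
    proof -
      have "w x \<notin> C"
        using x g(2)[of x] by (metis DiffD1 DiffD2 UnI2 image_eqI)
      hence less: "cmod (w x - cnj a) < exp (e / 2) * cmod (w x - a)"
        by (simp add: C_def)
      have wa: "w x \<noteq> a"
        using x inj_onD[OF w(2), of x z] assms(6) by (auto simp: a_def)
      have "ln (cmod (w x - cnj a)) < ln (exp (e / 2) * cmod (w x - a))"
        using less N0[of x] x wa by (subst ln_less_cancel_iff) auto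
      hence "half_plane_green (w x) a < e / 2"
        using wa by (simp add: half_plane_green_def ln_mult)
      moreover have "cmod (w x - a) < cmod (w x - cnj a)"
        using cmod_diff_le_cnj_iff[OF a, of "w x"] x w(3) by (auto simp: upper_half_plane_def)
      hence "half_plane_green (w x) a > 0"
        using wa N0[of x] x by (simp add: half_plane_green_def)
      moreover have "Re (F1 x - F0 x) = G x z - half_plane_green (w x) a"
        using x h(2)[of x] F1(2)[of x] model[of x] by auto
      ultimately show ?thesis
        using K(3)[of x] x by auto
    qed
    thus ?thesis
      using K(1,2) gC \<open>compact (g ` C)\<close> by (intro exI[of _ "K \<union> g ` C"]) auto
  qed
  have le: "\<bar>Re (F1 \<zeta> - F0 \<zeta>)\<bar> \<le> e" if e: "e > 0" for e
  proof -
    obtain K where K: "compact K" "K \<subseteq> D" "\<And>x. x \<in> D - K - {z} \<Longrightarrow>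
        \<bar>Re (F1 x - F0 x)\<bar> < e"
      using small[OF e] by blast
    \<comment> \<open>The estimate off \<open>K\<close> leaves out the pole, so the pole is put into
      the compact set.\<close>
    have K': "compact (insert z K)" "insert z K \<subseteq> D"
      using K assms(6) by auto
    have "Re (F1 \<zeta> - F0 \<zeta>) \<le> e"
      by (rule Re_le_of_boundary[OF assms(1) conn assms(2) _ K' _ assms(7)])
         (use K(3) F0(1) F1(1) in \<open>force intro!: holomorphic_intros\<close>)+
    moreover have "Re (F0 \<zeta> - F1 \<zeta>) \<le> e"
      by (rule Re_le_of_boundary[OF assms(1) conn assms(2) _ K' _ assms(7)])
         (use K(3) F0(1) F1(1) in \<open>force intro!: holomorphic_intros\<close>)+
    ultimately show ?thesis
      by simp
  qed
  have "\<bar>Re (F1 \<zeta> - F0 \<zeta>)\<bar> \<le> 0"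
    using le by (rule field_le_epsilon) simp
  thus ?thesis
    using h(2)[of \<zeta>] F1(2)[of \<zeta>] model[of \<zeta>] assms(7,8) by (simp add: a_def)
qed

section \<open>The Green's function in local charts\<close>

lemma half_plane_green_commute: "half_plane_green x y = half_plane_green y x"
proof -
  have "cmod (x - cnj y) = cmod (cnj (x - cnj y))"
    by (rule complex_mod_cnj[symmetric])
  also have "cnj (x - cnj y) = - (y - cnj x)"
    by simp
  finally show ?thesis
    by (simp add: half_plane_green_def norm_minus_commute)
qed

text \<open>The differential comes from that of the norm, so no branch of the logarithm of
  \<open>f\<close> is chosen.\<close>

lemma has_derivative_ln_cmod:
  assumes "(f has_field_derivative f') (at z)" "f z \<noteq> 0"
  shows "((\<lambda>z. complex_of_real (ln (cmod (f z)))) has_derivative (\<lambda>h. of_real (Re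
      (f' / f z * h)))) (at z)"
proof -
  have f: "(f has_derivative (\<lambda>h. f' * h)) (at z)"
    using assms(1) by (simp add: has_field_derivative_def)
  have "((\<lambda>z. norm (f z)) has_derivative (\<lambda>h. inner (f' * h) (sgn (f z)))) (at z)"
    using has_derivative_compose[OF f has_derivative_norm[OF assms(2)]] by simp
  hence "((\<lambda>z. ln (norm (f z))) has_derivative (\<lambda>h. inner (f' * h) (sgn (f z)) *
      inverse (norm (f z)))) (at z)"
    using assms(2) by (intro has_derivative_ln) auto
  moreover have "inner (f' * h) (sgn (f z)) * inverse (norm (f z)) = Re (f' / f z * h)" for h
  proof -
    have "inner (f' * h) (sgn (f z)) * inverse (norm (f z)) =
        Re (f' * h * cnj (f z)) / (norm (f z))\<^sup>2"
      by (simp add: sgn_div_norm inner_complex_def power2_eq_square divide_inverse algebra_simps)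
    also have "\<dots> = Re (f' * h * cnj (f z) / of_real ((norm (f z))\<^sup>2))"
      by (simp only: Re_divide_of_real)
    also have "f' * h * cnj (f z) / of_real ((norm (f z))\<^sup>2) = f' / f z * h"
      by (subst complex_norm_square) (use assms(2) in \<open>simp add: field_simps\<close>)
    finally show ?thesis .
  qed
  ultimately have "((\<lambda>z. ln (norm (f z))) has_derivative (\<lambda>h. Re (f' / f z * h))) (at z)"
    by simp
  thus ?thesis
    by (rule has_derivative_of_real)
qed

lemma dz_Re_linear:
  assumes "(f has_derivative (\<lambda>h. of_real (Re (k * h)))) (at z)"
  shows "dz f z = k / 2" "dzbar f z = cnj k / 2"
  using dz_eq[OF assms] dzbar_eq[OF assms] by (auto simp: complex_eq_iff)

text \<open>The moving point is the second argument. With \<open>a - f y\<close> and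
  \<open>cnj a - f y\<close> in the denominators both terms are Cauchy kernels in a parameter, the
  form whose higher derivatives are computed next.\<close>

lemma half_plane_green_derivative:
  assumes "(f has_field_derivative f') (at y)" "f y \<noteq> a" "f y \<noteq> cnj a"
  shows "(\<lambda>y. complex_of_real (half_plane_green a (f y))) differentiable (at y)"
    and "dz (\<lambda>y. of_real (half_plane_green a (f y))) y = (f' / (a - f y) - f' / (cnj a - f y)) / 2"
proof -
  have "((\<lambda>y. complex_of_real (ln (cmod (f y - cnj a))) - of_real (ln (cmod (f y - a))))
      has_derivative
      (\<lambda>h. of_real (Re (f' / (f y - cnj a) * h)) - of_real (Re (f' / (f y - a) * h)))) (at y)"
    using assms by (intro has_derivative_diff has_derivative_ln_cmod) (auto intro!: derivative_eq_intros)
  moreover have "complex_of_real (half_plane_green a (f y)) =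
      complex_of_real (ln (cmod (f y - cnj a))) - of_real (ln (cmod (f y - a)))" for y
    by (subst half_plane_green_commute) (simp add: half_plane_green_def)
  moreover have "complex_of_real (Re (f' / (f y - cnj a) * h)) - of_real (Re (f' / (f y - a) * h)) =
      of_real (Re ((f' / (a - f y) - f' / (cnj a - f y)) * h))" for h
  proof -
    have "f' / (f y - cnj a) * h - f' / (f y - a) * h = (f' / (a - f y) - f' / (cnj a - f y)) * h"
      by (simp add: minus_divide_right[symmetric] left_diff_distrib
          minus_diff_eq[of "f y" "a", symmetric] minus_diff_eq[of "f y" "cnj a", symmetric]
          del: minus_diff_eq)
    thus ?thesis
      by (metis Re_complex_of_real minus_complex.simps(1) of_real_diff)
  qed
  ultimately have *: "((\<lambda>y. complex_of_real (half_plane_green a (f y))) has_derivative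
      (\<lambda>h. of_real (Re ((f' / (a - f y) - f' / (cnj a - f y)) * h)))) (at y)"
    by simp
  show "(\<lambda>y. complex_of_real (half_plane_green a (f y))) differentiable (at y)"
    using * by (auto simp: differentiable_def)
  show "dz (\<lambda>y. of_real (half_plane_green a (f y))) y = (f' / (a - f y) - f' / (cnj a - f y)) / 2"
    by (rule dz_Re_linear(1)[OF *])
qed

text \<open>The coefficients \<open>C\<close> are the same for all \<open>a\<close>. For fixed
  \<open>y\<close> every derivative of the kernel is therefore a polynomial in
  \<open>1 / (a - W y)\<close>, holomorphic in \<open>a\<close> away from
  \<open>W y\<close>.\<close>

lemma higher_deriv_cauchy_kernel:
  assumes "open U" "W holomorphic_on U"
  obtains C where "\<And>k. C k holomorphic_on U"
    "\<And>a y. y \<in> U \<Longrightarrow> W y \<noteq> a \<Longrightarrow>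
       (deriv ^^ n) (\<lambda>y. deriv W y / (a - W y)) y = (\<Sum>k\<le>n. C k y / (a - W y) ^ Suc k)"
proof -
  have "\<exists>C. (\<forall>k. C k holomorphic_on U) \<and> (\<forall>a. \<forall>y\<in>U. W y
      \<noteq> a \<longrightarrow>
       (deriv ^^ n) (\<lambda>y. deriv W y / (a - W y)) y = (\<Sum>k\<le>n. C k y / (a - W y) ^ Suc k))"
  proof (induction n)
    case 0
    have "deriv W holomorphic_on U"
      using assms by (intro holomorphic_deriv)
    thus ?case
      by (intro exI[of _ "\<lambda>_. deriv W"]) auto
  next
    case (Suc n)
    then obtain C where C: "\<And>k. C k holomorphic_on U"
      "\<And>a y. y \<in> U \<Longrightarrow> W y \<noteq> a \<Longrightarrow>
         (deriv ^^ n) (\<lambda>y. deriv W y / (a - W y)) y = (\<Sum>k\<le>n. C k y / (a - W y) ^ Suc k)"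
      by metis
    \<comment> \<open>Differentiating the term of index \<open>k\<close> keeps the index with
      \<open>deriv (C k)\<close> and feeds index \<open>k + 1\<close> through the denominator. The
      conditionals cut off the first contribution at the new top index and the second at index
      0.\<close>
    define C' where "C' = (\<lambda>k y. (if k \<le> n then deriv (C k) y else 0) +
       (if k = 0 then 0 else of_nat k * deriv W y * C (k - 1) y))"
    have "C' k holomorphic_on U" for k
      unfolding C'_def using assms C(1)
      by (cases "k \<le> n"; cases "k = 0") (auto intro!: holomorphic_intros holomorphic_deriv)
    moreover have "(deriv ^^ Suc n) (\<lambda>y. deriv W y / (a - W y)) y = (\<Sum>k\<le>Suc n. C' k
        y / (a - W y) ^ Suc k)"
      if y: "y \<in> U" "W y \<noteq> a" for a y
    proof -
      let ?U = "U \<inter> W -` (- {a})"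
      have U: "open ?U" "y \<in> ?U"
        using assms y by (auto intro!: continuous_open_preimage holomorphic_on_imp_continuous_on)
      have ne: "a - W y \<noteq> 0"
        using y by simp
      have "(deriv ^^ Suc n) (\<lambda>y. deriv W y / (a - W y)) y =
          deriv (\<lambda>y. \<Sum>k\<le>n. C k y / (a - W y) ^ Suc k) y"
        unfolding funpow.simps o_def
      proof (rule deriv_cong_ev)
        show "\<forall>\<^sub>F x in nhds y. (deriv ^^ n) (\<lambda>y. deriv W y / (a - W y)) x =
                (\<Sum>k\<le>n. C k x / (a - W x) ^ Suc k)"
          by (rule eventually_mono[OF eventually_nhds_in_open[OF U]]) (rule C(2); simp)
      qed auto
      also have "\<dots> = (\<Sum>k\<le>n. deriv (C k) y / (a - W y) ^ Suc k +
          of_nat (Suc k) * deriv W y * C k y / (a - W y) ^ Suc (Suc k))"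
      proof (rule DERIV_imp_deriv, rule DERIV_sum)
        fix k
        have "((\<lambda>y. C k y / (a - W y) ^ Suc k) has_field_derivative
            (deriv (C k) y * (a - W y) ^ Suc k - C k y * (of_nat (Suc k) * (a - W y) ^ k * (- deriv W y))) /
            ((a - W y) ^ Suc k * (a - W y) ^ Suc k)) (at y)"
          using holomorphic_derivI[OF C(1)[of k] assms(1) y(1)] holomorphic_derivI[OF assms(2,1) y(1)] ne
          by (auto intro!: derivative_eq_intros) (cases k; simp add: algebra_simps)
        also have "(deriv (C k) y * (a - W y) ^ Suc k - C k y * (of_nat (Suc k) * (a - W y) ^ k * (-
            deriv W y))) /
            ((a - W y) ^ Suc k * (a - W y) ^ Suc k) =
            deriv (C k) y / (a - W y) ^ Suc k +
          of_nat (Suc k) * deriv W y * C k y / (a - W y) ^ Suc (Suc k)"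
          using ne by (simp add: divide_simps del: of_nat_Suc) (simp add: algebra_simps)
        finally show "((\<lambda>y. C k y / (a - W y) ^ Suc k) has_field_derivative
            deriv (C k) y / (a - W y) ^ Suc k +
          of_nat (Suc k) * deriv W y * C k y / (a - W y) ^ Suc (Suc k)) (at y)" .
      qed
      also have "\<dots> = (\<Sum>k\<le>n. deriv (C k) y / (a - W y) ^ Suc k) +
          (\<Sum>k\<le>n. of_nat (Suc k) * deriv W y * C k y / (a - W y) ^ Suc (Suc k))"
        by (rule sum.distrib)
      also have "(\<Sum>k\<le>n. deriv (C k) y / (a - W y) ^ Suc k) =
          (\<Sum>k\<le>Suc n. (if k \<le> n then deriv (C k) y else 0) / (a - W y) ^ Suc k)"
        by simp
      also have "(\<Sum>k\<le>n. of_nat (Suc k) * deriv W y * C k y / (a - W y) ^ Suc (Suc k)) =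
          (\<Sum>k\<le>Suc n. (if k = 0 then 0 else of_nat k * deriv W y * C (k - 1) y) / (a - W y) ^ Suc k)"
        by (subst sum.atMost_Suc_shift) (simp del: of_nat_Suc)
      finally show ?thesis
        by (simp only: C'_def add_divide_distrib sum.distrib)
    qed
    ultimately show ?case
      by blast
  qed
  thus ?thesis
    using that by blast
qed

text \<open>Away from the diagonal the derivatives of the Green's function with respect to one variable are
  harmonic in the other one.\<close>

lemma half_plane_green_higher_derivatives:
  assumes "open U" "W holomorphic_on U" "\<And>y. y \<in> U \<Longrightarrow> Im (W y) > 0" "y \<in>
      U" "l > 0 \<or> m > 0"
  obtains P Q where "P holomorphic_on upper_half_plane - {W y}" "Q holomorphic_on upper_half_plane - {W y}"
    "\<And>a. a \<in> upper_half_plane - {W y} \<Longrightarrow>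
       (dz ^^ l) ((dzbar ^^ m) (\<lambda>y. of_real (half_plane_green a (W y)))) y = P a + cnj (Q a)"
proof -
  let ?u = "\<lambda>a y. complex_of_real (half_plane_green a (W y))"
  let ?\<kappa> = "\<lambda>a y. deriv W y / (a - W y)"
  let ?S = "upper_half_plane - {W y}"
  let ?U = "\<lambda>a. U \<inter> W -` (- {a})"
  have openU: "open (?U a)" for a
    using assms by (auto intro!: continuous_open_preimage holomorphic_on_imp_continuous_on)
  have cnj_ne: "W x \<noteq> cnj a" if "x \<in> U" "a \<in> ?S" for x a
    using assms(3)[OF that(1)] that(2) by (auto simp: upper_half_plane_def)
  have yU: "y \<in> ?U a" if "a \<in> ?S" for a
    using that assms(4) by auto
  have du: "?u a differentiable (at x)" "dz (?u a) x = (?\<kappa> a x - ?\<kappa> (cnj a) x) / 2"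
    if "a \<in> ?S" "x \<in> ?U a" for a x
    using half_plane_green_derivative[OF holomorphic_derivI[OF assms(2,1)], of x a] that cnj_ne[of x
        a] by auto
  have \<kappa>: "?\<kappa> a holomorphic_on ?U a" "?\<kappa> (cnj a) holomorphic_on ?U a" if "a
      \<in> ?S" for a
  proof -
    have dW: "deriv W holomorphic_on ?U a" and W: "W holomorphic_on ?U a"
      using holomorphic_deriv[OF assms(2,1)] assms(2) by (auto intro: holomorphic_on_subset)
    show "?\<kappa> a holomorphic_on ?U a"
      by (intro holomorphic_on_divide holomorphic_on_diff holomorphic_on_const dW W) auto
    show "?\<kappa> (cnj a) holomorphic_on ?U a"
      by (intro holomorphic_on_divide holomorphic_on_diff holomorphic_on_const dW W)
         (metis IntD1 cnj_ne right_minus_eq that)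
  qed
  have dz_pow: "(dz ^^ Suc n) (?u a) x = ((deriv ^^ n) (?\<kappa> a) x - (deriv ^^ n) (?\<kappa>
      (cnj a)) x) / 2"
    and dz_pow_holo: "(\<lambda>x. ((deriv ^^ n) (?\<kappa> a) x - (deriv ^^ n) (?\<kappa> (cnj a))
        x) / 2) holomorphic_on ?U a"
    if "a \<in> ?S" "x \<in> ?U a" for a n x
  proof -
    have "(dz ^^ Suc n) (?u a) x = (dz ^^ n) (dz (?u a)) x"
      by (simp only: funpow_Suc_right o_def)
    also have "\<dots> = (dz ^^ n) (\<lambda>x. (1 / 2) * (?\<kappa> a x - ?\<kappa> (cnj a) x)) x"
    proof (rule dz_funpow_cong_open[OF openU that(2)])
      fix x assume "x \<in> ?U a"
      from du(2)[OF that(1) this] show "dz (?u a) x = (1 / 2) * (?\<kappa> a x - ?\<kappa> (cnj a) x)"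
        by simp
    qed
    also have "\<dots> = (deriv ^^ n) (\<lambda>x. (1 / 2) * (?\<kappa> a x - ?\<kappa> (cnj a) x)) x"
      by (intro dz_funpow_holomorphic_on[OF _ openU that(2)] holomorphic_on_mult holomorphic_on_const
          holomorphic_on_diff \<kappa>[OF that(1)])
    also have "\<dots> = (1 / 2) * (deriv ^^ n) (\<lambda>x. ?\<kappa> a x - ?\<kappa> (cnj a) x) x"
      by (intro higher_deriv_cmult[OF _ that(2) openU] holomorphic_on_diff \<kappa>[OF that(1)])
    also have "(deriv ^^ n) (\<lambda>x. ?\<kappa> a x - ?\<kappa> (cnj a) x) x = (deriv ^^ n)
        (?\<kappa> a) x - (deriv ^^ n) (?\<kappa> (cnj a)) x"
      using \<kappa>[OF that(1)] openU that(2) by (intro higher_deriv_diff) auto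
    finally show "(dz ^^ Suc n) (?u a) x = ((deriv ^^ n) (?\<kappa> a) x - (deriv ^^ n) (?\<kappa>
        (cnj a)) x) / 2"
      by simp
    show "(\<lambda>x. ((deriv ^^ n) (?\<kappa> a) x - (deriv ^^ n) (?\<kappa> (cnj a)) x) / 2)
        holomorphic_on ?U a"
      by (intro holomorphic_on_divide holomorphic_on_const holomorphic_on_diff
          holomorphic_higher_deriv openU \<kappa>[OF that(1)]) simp
  qed
  have dz_pow_diff: "(dz ^^ n) (?u a) differentiable (at x)" if "a \<in> ?S" "x \<in> ?U a" for a n x
  proof (cases n)
    case (Suc k)
    show ?thesis
      unfolding Suc
      by (rule differentiable_cong_open[OF openU that(2) _
            holomorphic_on_imp_differentiable[OF dz_pow_holo[OF that] openU that(2)]])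
         (use dz_pow[OF that(1)] in auto)
  qed (use du that in auto)
  have dzbar_pow: "(dzbar ^^ n) (?u a) x = cnj ((dz ^^ n) (?u a) x)" if "a \<in> ?S" "x \<in> ?U a" for a n x
    using that(2)
  proof (induction n arbitrary: x)
    case (Suc n)
    have "(dzbar ^^ Suc n) (?u a) x = dzbar (\<lambda>x. cnj ((dz ^^ n) (?u a) x)) x"
      unfolding funpow.simps o_def by (rule dzbar_cong_open[OF openU Suc.prems Suc.IH])
    also have "\<dots> = cnj (dz ((dz ^^ n) (?u a)) x)"
      by (rule dzbar_cnj) (rule dz_pow_diff[OF that(1) Suc.prems])
    finally show ?case
      by simp
  qed auto
  have PQ: "\<exists>P Q. P holomorphic_on ?S \<and> Q holomorphic_on ?S \<and>
              (\<forall>a\<in>?S. (dz ^^ Suc n) (?u a) y = P a + cnj (Q a))" for n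
  proof -
    obtain C where C: "\<And>a y. y \<in> U \<Longrightarrow> W y \<noteq> a \<Longrightarrow>
       (deriv ^^ n) (?\<kappa> a) y = (\<Sum>k\<le>n. C k y / (a - W y) ^ Suc k)"
      using higher_deriv_cauchy_kernel[OF assms(1,2), of n] by metis
    define P where "P = (\<lambda>a. (1 / 2) * (\<Sum>k\<le>n. C k y / (a - W y) ^ Suc k))"
    \<comment> \<open>The kernel at \<open>cnj a\<close> is antiholomorphic in \<open>a\<close>; its
      conjugate has its pole at \<open>cnj (W y)\<close>, outside the half-plane.\<close>
    define Q where "Q = (\<lambda>a. - (1 / 2) * (\<Sum>k\<le>n. cnj (C k y) / (a - cnj (W y)) ^ Suc k))"
    have ne: "a \<noteq> cnj (W y)" if "a \<in> ?S" for a
      using cnj_ne[OF assms(4) that] by (metis complex_cnj_cnj)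
    have "P holomorphic_on ?S" "Q holomorphic_on ?S"
      unfolding P_def Q_def using ne by (auto intro!: holomorphic_intros simp del: power_Suc)
    moreover have "(dz ^^ Suc n) (?u a) y = P a + cnj (Q a)" if "a \<in> ?S" for a
      unfolding dz_pow[OF that yU[OF that]] using that cnj_ne[OF assms(4) that]
      by (subst (1 2) C[OF assms(4)]) (auto simp: P_def Q_def field_simps simp del: power_Suc)
    ultimately show ?thesis
      by blast
  qed
  consider n where "l = Suc n" "m = 0" | n where "l = 0" "m = Suc n" | n k where "l = Suc n" "m = Suc k"
    using assms(5) by (cases l; cases m) auto
  hence "\<exists>P Q. P holomorphic_on ?S \<and> Q holomorphic_on ?S \<and>
           (\<forall>a\<in>?S. (dz ^^ l) ((dzbar ^^ m) (?u a)) y = P a + cnj (Q a))"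
  proof cases
    case 1
    then show ?thesis
      using PQ[of n] by simp
  next
    case 2
    obtain P Q where PQ': "P holomorphic_on ?S" "Q holomorphic_on ?S"
        "\<And>a. a\<in>?S \<Longrightarrow> (dz ^^ Suc n) (?u a) y = P a + cnj (Q a)"
      using PQ[of n] by blast
    \<comment> \<open>The Green's function is real, so conjugation turns a pure \<open>dzbar\<close>
      derivative into a pure \<open>dz\<close> derivative and exchanges the roles of
      \<open>P\<close> and \<open>Q\<close>.\<close>
    have "(dz ^^ l) ((dzbar ^^ m) (?u a)) y = Q a + cnj (P a)" if "a \<in> ?S" for a
    proof -
      have "(dz ^^ l) ((dzbar ^^ m) (?u a)) y = (dzbar ^^ Suc n) (?u a) y"
        by (simp only: 2 funpow.simps(1) id_apply)
      also have "\<dots> = cnj (P a + cnj (Q a))"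
        by (simp only: dzbar_pow[OF that yU[OF that]] PQ'(3)[OF that])
      finally show ?thesis
        by simp
    qed
    thus ?thesis
      using PQ'(1,2) by blast
  next
    case 3
    \<comment> \<open>Mixed derivatives vanish: a pure \<open>dzbar\<close> derivative is the
      conjugate of a holomorphic function and is annihilated by \<open>dz\<close>.\<close>
    have "(dz ^^ l) ((dzbar ^^ m) (?u a)) y = 0 + cnj 0" if a: "a \<in> ?S" for a
    proof -
      have "dz ((dzbar ^^ m) (?u a)) x = 0" if x: "x \<in> ?U a" for x
      proof -
        have "dz ((dzbar ^^ m) (?u a)) x = dz (\<lambda>x. cnj (((deriv ^^ k) (?\<kappa> a) x -
            (deriv ^^ k) (?\<kappa> (cnj a)) x) / 2)) x"
          using dzbar_pow[OF a, where n = m] dz_pow[OF a, where n = k]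
          by (intro dz_cong_open[OF openU x]) (simp only: 3)
        also have "\<dots> = cnj (dzbar (\<lambda>x. ((deriv ^^ k) (?\<kappa> a) x - (deriv ^^ k)
            (?\<kappa> (cnj a)) x) / 2) x)"
          by (rule dz_cnj) (rule holomorphic_on_imp_differentiable[OF dz_pow_holo[OF a x] openU x])
        also have "\<dots> = 0"
          using dzbar_holomorphic_on[OF dz_pow_holo[OF a x] openU x] by simp
        finally show ?thesis .
      qed
      hence "(dz ^^ n) (dz ((dzbar ^^ m) (?u a))) y = (dz ^^ n) (\<lambda>x. 0) y"
        by (intro dz_funpow_cong_open[OF openU yU[OF a]])
      also have "(dz ^^ n) (\<lambda>x. 0) = (\<lambda>x. 0)"
        by (induction n) auto
      finally show ?thesis
        by (simp only: 3(1) funpow_Suc_right o_def) simp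
    qed
    thus ?thesis
      by (intro exI[of _ "\<lambda>_. 0"]) auto
  qed
  thus ?thesis
    using that by blast
qed

section \<open>Wick's formula\<close>

definition expand :: "(nat \<times> placed) list \<Rightarrow> nat list \<Rightarrow> (nat \<times>
    elementary) list" where
  "expand L ns = concat (map2 (\<lambda>n (i, u). replicate n (i, elementary_of u)) ns L)"

definition wick_coeff :: "(nat \<times> placed) list \<Rightarrow> nat list \<Rightarrow> complex" where
  "wick_coeff L ns = (\<Prod>i<length L. series_coeff (snd (snd (snd (L ! i)))) (ns ! i))"

text \<open>The sum in \<open>wick_correlation\<close> for an arbitrary tagged list. Contractions
  act on single entries of the flat list, so the recursion runs over such lists and not over lists
  of monomials.\<close>

definition tagged_wick ::
    "(complex \<Rightarrow> complex \<Rightarrow> real) \<Rightarrow> (nat \<times> placed) list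
        \<Rightarrow> complex" where
  "tagged_wick G L =
     (\<Sum>\<^sub>\<infinity>ns\<in>{ns. length ns = length L}. wick_coeff L ns * pairings_sum G
         (expand L ns))"

lemma wick_correlation_eq: "wick_correlation G ms = tagged_wick G (tagged ms)"
  by (simp add: wick_correlation_def tagged_wick_def wick_coeff_def expand_def Let_def)

lemma expand_Nil [simp]: "expand [] ns = []"
  by (simp add: expand_def)

lemma expand_Cons [simp]:
  "expand (x # L) (n # ns) = replicate n (apsnd elementary_of x) @ expand L ns"
  by (cases x) (simp add: expand_def)

lemma wick_coeff_Nil [simp]: "wick_coeff [] ns = 1"
  by (simp add: wick_coeff_def)

lemma wick_coeff_Cons [simp]:
  "wick_coeff (x # L) (n # ns) = series_coeff (snd (snd (snd x))) n * wick_coeff L ns"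
  by (simp add: wick_coeff_def prod.lessThan_Suc_shift del: prod.lessThan_Suc)

lemma expand_append:
  "length ns1 = length L1 \<Longrightarrow> expand (L1 @ L2) (ns1 @ ns2) = expand L1 ns1 @ expand L2 ns2"
  by (induction ns1 L1 rule: list_induct2) auto

lemma wick_coeff_append:
  "length ns1 = length L1 \<Longrightarrow>
     wick_coeff (L1 @ L2) (ns1 @ ns2) = wick_coeff L1 ns1 * wick_coeff L2 ns2"
  by (induction ns1 L1 rule: list_induct2) auto

definition remove_at :: "nat \<Rightarrow> 'a list \<Rightarrow> 'a list" where
  "remove_at p xs = take p xs @ drop (Suc p) xs"

lemma remove_at_0 [simp]: "remove_at 0 (x # xs) = xs"
  by (simp add: remove_at_def)

lemma remove_at_Suc [simp]: "remove_at (Suc p) (x # xs) = x # remove_at p xs"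
  by (simp add: remove_at_def)

lemma length_remove_at: "p < length xs \<Longrightarrow> length (remove_at p xs) = length xs - 1"
  by (simp add: remove_at_def)

lemma set_remove_at: "set (remove_at p xs) \<subseteq> set xs"
  by (auto simp: remove_at_def dest: in_set_takeD in_set_dropD)

lemma remove_at_replicate: "p < n \<Longrightarrow> remove_at p (replicate n x) = replicate (n - 1) x"
  by (simp add: remove_at_def replicate_add[symmetric])

lemma map_remove_at: "map f (remove_at p xs) = remove_at p (map f xs)"
  by (simp add: remove_at_def take_map drop_map)

text \<open>Leibniz rule for the choice of a partner: it lies in the first or in the second part of
  the list.\<close>

lemma sum_remove_at_append:
  fixes f :: "'a \<Rightarrow> 'b :: comm_ring_1"
  shows "(\<Sum>p<length (xs @ ys). f ((xs @ ys) ! p) * Q (remove_at p (xs @ ys))) =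
         (\<Sum>p<length xs. f (xs ! p) * Q (remove_at p xs @ ys)) +
         (\<Sum>p<length ys. f (ys ! p) * Q (xs @ remove_at p ys))"
proof (induction xs arbitrary: Q)
  case Nil
  then show ?case by simp
next
  case (Cons x xs)
  show ?case
    using Cons[of "\<lambda>zs. Q (x # zs)"]
    by (simp add: sum.lessThan_Suc_shift add.assoc del: sum.lessThan_Suc)
qed

text \<open>The \<open>n\<close> copies of an expanded factor are indistinguishable: choosing one of
  them gives the multiplicity \<open>n\<close> and leaves \<open>n - 1\<close> copies. At
  \<open>n = 0\<close> the truncated subtraction does no harm, since the weight is 0.\<close>

lemma sum_remove_at_expand:
  fixes f :: "nat \<times> elementary \<Rightarrow> 'b :: comm_ring_1"
  assumes "length ns = length L"
  shows "(\<Sum>p<length (expand L ns). f (expand L ns ! p) * Q (remove_at p (expand L ns))) =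
         (\<Sum>p<length L. of_nat (ns ! p) * f (apsnd elementary_of (L ! p)) *
                         Q (expand L (ns[p := ns ! p - 1])))"
  using assms
proof (induction ns L arbitrary: Q rule: list_induct2)
  case Nil
  then show ?case by simp
next
  case (Cons n ns x L)
  let ?e = "apsnd elementary_of x"
  have "(\<Sum>p<n. f (replicate n ?e ! p) * Q (remove_at p (replicate n ?e) @ expand L ns)) =
        (\<Sum>p<n. f ?e * Q (replicate (n - 1) ?e @ expand L ns))"
    by (intro sum.cong) (auto simp: remove_at_replicate)
  also have "\<dots> = of_nat n * f ?e * Q (replicate (n - 1) ?e @ expand L ns)"
    by simp
  finally show ?case
    using sum_remove_at_append[of f "replicate n ?e" "expand L ns" Q]
      Cons.IH[of "\<lambda>zs. Q (replicate n ?e @ zs)"]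
    by (simp add: sum.lessThan_Suc_shift del: sum.lessThan_Suc)
qed

lemma pairings_sum_Cons:
  "pairings_sum G (x # xs) =
     (\<Sum>p<length xs. (if fst (xs ! p) = fst x then 0
         else pair_expectation G (snd x) (snd (xs ! p))) * pairings_sum G (remove_at p xs))"
  by (simp add: remove_at_def if_distrib[of "\<lambda>a. a * _"] cong: if_cong)

declare pairings_sum.simps(2) [simp del]

subsection \<open>Summability\<close>

text \<open>Induction step of the bound below: the first of \<open>n + 1\<close> factors has
  \<open>n\<close> possible partners, and \<open>n - 1\<close> factors remain.\<close>

lemma sqrt_fact_step: "real n * sqrt (fact (n - 1)) \<le> sqrt (fact (n + 1))"
proof (cases n)
  case (Suc m)
  have "(real n * sqrt (fact (n - 1)))\<^sup>2 = real n * (real n * fact m)"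
    by (simp add: power_mult_distrib Suc power2_eq_square)
  also have "\<dots> \<le> real (n + 1) * (real n * fact m)"
    by (intro mult_right_mono) auto
  also have "\<dots> = fact (n + 1)"
    by (simp add: Suc algebra_simps)
  finally show ?thesis
    by (intro real_le_rsqrt) auto
qed auto

text \<open>There are at most \<open>(n - 1)!!\<close> complete pairings of \<open>n\<close>
    factors, and \<open>(n - 1)!! \<le> sqrt (n!)\<close>. After
  division by the factorials of the exponential series, this leaves a summable bound of product form.\<close>

lemma norm_pairings_sum_le:
  assumes "\<And>x y. x \<in> set xs \<Longrightarrow> y \<in> set xs \<Longrightarrow> norm
      (pair_expectation G (snd x) (snd y)) \<le> M\<^sup>2"
    and "M \<ge> 0"
  shows "norm (pairings_sum G xs) \<le> M ^ length xs * sqrt (fact (length xs))"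
  using assms(1)
proof (induction "length xs" arbitrary: xs rule: less_induct)
  case less
  show ?case
  proof (cases xs)
    case Nil
    then show ?thesis by simp
  next
    case (Cons x ys)
    let ?n = "length ys"
    have "norm (pairings_sum G xs) \<le>
            (\<Sum>p<?n. M\<^sup>2 * (M ^ (?n - 1) * sqrt (fact (?n - 1))))"
      unfolding Cons pairings_sum_Cons
    proof (intro sum_norm_le)
      fix p assume p: "p \<in> {..<?n}"
      have len: "length (remove_at p ys) = ?n - 1"
        using p by (simp add: length_remove_at)
      have "norm (pairings_sum G (remove_at p ys)) \<le>
              M ^ length (remove_at p ys) * sqrt (fact (length (remove_at p ys)))"
        using p set_remove_at[of p ys] by (intro less) (auto simp: len Cons)
      moreover have "norm (if fst (ys ! p) = fst x then 0
                      else pair_expectation G (snd x) (snd (ys ! p))) \<le> M\<^sup>2"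
        using p less(2)[of x "ys ! p"] by (auto simp: Cons)
      ultimately show "norm ((if fst (ys ! p) = fst x then 0
           else pair_expectation G (snd x) (snd (ys ! p))) * pairings_sum G (remove_at p ys)) \<le>
          M\<^sup>2 * (M ^ (?n - 1) * sqrt (fact (?n - 1)))"
        unfolding norm_mult len by (intro mult_mono) auto
    qed
    also have "\<dots> = (if ?n = 0 then 0 else M ^ (?n + 1) * (real ?n * sqrt (fact (?n - 1))))"
      by (cases ys) (auto simp: power2_eq_square)
    also have "\<dots> \<le> M ^ (?n + 1) * sqrt (fact (?n + 1))"
      using sqrt_fact_step[of ?n] assms(2) by (auto intro!: mult_left_mono simp del: fact_Suc)
    finally show ?thesis
      by (simp add: Cons)
  qed
qed

lemma fact_add_le: "(fact (m + n) :: real) \<le> 2 ^ (m + n) * (fact m * fact n)"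
proof -
  have "real ((m + n) choose m) \<le> 2 ^ (m + n)"
    using binomial_le_pow2[of "m + n" m] by (metis of_nat_le_iff of_nat_power of_nat_numeral)
  moreover have "(fact (m + n) :: real) = real ((m + n) choose m) * (fact m * fact n)"
    by (simp add: binomial_fact)
  ultimately show ?thesis
    by (simp add: mult_right_mono)
qed

text \<open>A multinomial coefficient is a product of binomial ones. The bound separates the
  factorial of a total into a product over the factors, at the price of a geometric term once the
  number of factors is fixed.\<close>

lemma fact_sum_list_le:
  "(fact (sum_list ns) :: real) \<le> 2 ^ (length ns * sum_list ns) * prod_list (map fact ns)"
proof (induction ns)
  case (Cons n ns)
  let ?N = "sum_list ns"
  have "(fact (n + ?N) :: real) \<le> 2 ^ (n + ?N) * (fact n * fact ?N)"
    by (rule fact_add_le)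
  also have "\<dots> \<le> 2 ^ (n + ?N) * (fact n * (2 ^ (length ns * ?N) * prod_list (map fact ns)))"
    using Cons by (intro mult_left_mono) auto
  also have "\<dots> \<le> 2 ^ (n + ?N) * (fact n * (2 ^ (length ns * (n + ?N)) * prod_list (map fact ns)))"
    by (intro mult_left_mono mult_right_mono power_increasing) (auto intro!: prod_list_nonneg)
  finally show ?case
    by (simp add: power_add algebra_simps)
qed auto

lemma summable_on_lists_prod:
  fixes g :: "nat \<Rightarrow> real"
  assumes "\<And>n. g n \<ge> 0" "summable g"
  shows "(\<lambda>ns. prod_list (map g ns)) summable_on {ns. length ns = k}"
proof (induction k)
  case 0
  then show ?case by simp
next
  case (Suc k)
  let ?S = "{ns :: nat list. length ns = k}"
  have eq: "{ns :: nat list. length ns = Suc k} = (\<lambda>(n, ns). n # ns) ` (UNIV \<times> ?S)"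
    by (auto simp: length_Suc_conv)
  have g: "g summable_on UNIV"
    using assms by (intro norm_summable_imp_summable_on) auto
  have "(\<lambda>(n, ns). g n * prod_list (map g ns)) summable_on UNIV \<times> ?S"
  proof (rule summable_on_SigmaI)
    show "((\<lambda>ns. case (n, ns) of (n, ns) \<Rightarrow> g n * prod_list (map g ns)) has_sum
             g n * (\<Sum>\<^sub>\<infinity>ns\<in>?S. prod_list (map g ns))) ?S" for n
      using Suc by (auto intro!: has_sum_cmult_right)
    show "(\<lambda>n. g n * (\<Sum>\<^sub>\<infinity>ns\<in>?S. prod_list (map g ns))) summable_on UNIV"
      using g by (rule summable_on_cmult_left)
  qed (auto intro!: mult_nonneg_nonneg prod_list_nonneg assms)
  moreover have "inj_on (\<lambda>(n, ns). n # ns) (UNIV \<times> ?S)"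
    by (auto simp: inj_on_def)
  ultimately show ?case
    unfolding eq by (simp add: summable_on_reindex o_def case_prod_unfold)
qed

lemma summable_power_div_sqrt_fact:
  fixes x :: real
  assumes "x \<ge> 0"
  shows "summable (\<lambda>n. x ^ n / sqrt (fact n))"
proof -
  \<comment> \<open>From this index on the ratio \<open>x / sqrt (n + 1)\<close> of consecutive
    terms is at most \<open>1 / 2\<close>.\<close>
  obtain N :: nat where N: "real N \<ge> (2 * x)\<^sup>2"
    using real_arch_simple by blast
  show ?thesis
  proof (rule summable_ratio_test[of "1 / 2" N])
    fix n assume "n \<ge> N"
    hence "(2 * x)\<^sup>2 \<le> 1 + real n"
      using N by linarith
    hence "2 * x \<le> sqrt (1 + real n)"
      by (rule real_le_rsqrt)
    hence *: "x / sqrt (1 + real n) \<le> 1 / 2"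
      by (simp add: field_simps)
    have "x ^ Suc n / sqrt (fact (Suc n)) = (x / sqrt (1 + real n)) * (x ^ n / sqrt (fact n))"
      by (simp add: real_sqrt_mult)
    also have "\<dots> \<le> (1 / 2) * (x ^ n / sqrt (fact n))"
      using * assms by (intro mult_right_mono) auto
    finally show "norm (x ^ Suc n / sqrt (fact (Suc n))) \<le> 1 / 2 * norm (x ^ n / sqrt (fact n))"
      using assms by simp
  qed auto
qed

text \<open>With \<open>\<beta> \<ge> 1\<close> the exponential bound also covers
  \<open>Der\<close>, whose only nonzero coefficient is 1 at \<open>n = 1\<close>.\<close>

lemma norm_series_coeff_le:
  assumes "\<beta> \<ge> 1" "case u of Der _ _ \<Rightarrow> True | WExp \<alpha> \<Rightarrow> norm
      \<alpha> \<le> \<beta>"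
  shows "norm (series_coeff u n) \<le> \<beta> ^ n / fact n"
  using assms by (cases u) (auto simp: norm_divide norm_power intro!: divide_right_mono power_mono)

lemma length_expand: "length ns = length L \<Longrightarrow> length (expand L ns) = sum_list ns"
  by (induction ns L rule: list_induct2) auto

lemma set_expand: "length ns = length L \<Longrightarrow> set (expand L ns) \<subseteq> apsnd
    elementary_of ` set L"
  by (induction ns L rule: list_induct2) auto

lemma norm_wick_coeff_le:
  assumes "length ns = length L" "\<beta> \<ge> 1"
    "\<And>x. x \<in> set L \<Longrightarrow> case snd (snd (snd x)) of Der _ _ \<Rightarrow> True |
        WExp \<alpha> \<Rightarrow> norm \<alpha> \<le> \<beta>"
  shows "norm (wick_coeff L ns) \<le> \<beta> ^ sum_list ns / prod_list (map fact ns)"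
  using assms(1,3)
proof (induction ns L rule: list_induct2)
  case (Cons n ns x L)
  have "norm (series_coeff (snd (snd (snd x))) n) * norm (wick_coeff L ns) \<le>
         (\<beta> ^ n / fact n) * (\<beta> ^ sum_list ns / prod_list (map fact ns))"
    using Cons assms(2) by (intro mult_mono norm_series_coeff_le) auto
  then show ?case
    by (simp add: norm_mult power_add)
qed auto

lemma tagged_wick_summable:
  "(\<lambda>ns. wick_coeff L ns * pairings_sum G (expand L ns)) summable_on {ns. length ns = length L}"
proof -
  define E where "E = elementary_of ` snd ` set L"
  define P where "P = (\<lambda>(x, y). norm (pair_expectation G x y)) ` (E \<times> E)"
  \<comment> \<open>A complete pairing of \<open>N\<close> factors has \<open>N / 2\<close> pairs,
    so a bound \<open>M\<^sup>2\<close> for each pair yields \<open>M ^ N\<close>. The inserted 0,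
    like the 1 in the maximum for \<open>\<beta>\<close>, makes the set nonempty.\<close>
  define M where "M = sqrt (Max (insert 0 P))"
  have fin: "finite P"
    by (auto simp: P_def E_def)
  have M0: "Max (insert 0 P) \<ge> 0"
    using fin by simp
  have M: "norm (pair_expectation G x y) \<le> M\<^sup>2" if "x \<in> E" "y \<in> E" for x y
    using that M0 fin unfolding M_def by (auto simp: P_def intro!: Max_ge)
  have "M \<ge> 0"
    using M0 by (simp add: M_def)
  define B where "B = (\<lambda>x :: nat \<times> placed. case snd (snd (snd x)) of Der _ _
      \<Rightarrow> 0 | WExp \<alpha> \<Rightarrow> norm \<alpha>) ` set L"
  define \<beta> where "\<beta> = Max (insert 1 B)"
  have \<beta>1: "\<beta> \<ge> 1"
    by (auto simp: \<beta>_def B_def)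
  have \<beta>: "case snd (snd (snd x)) of Der _ _ \<Rightarrow> True | WExp \<alpha> \<Rightarrow>
      norm \<alpha> \<le> \<beta>" if "x \<in> set L" for x
  proof (cases "snd (snd (snd x))")
    case (WExp \<alpha>)
    hence "norm \<alpha> \<in> B"
      using that by (force simp: B_def)
    thus ?thesis
      by (simp add: WExp \<beta>_def B_def)
  qed simp
  \<comment> \<open>Per unit of multiplicity, \<open>\<beta>\<close> comes from the series
    coefficients, \<open>M\<close> from the pairs and the square root from separating the factorial.
    Dividing \<open>sqrt F\<close> by \<open>F\<close> leaves the root of the factorials in the
    denominator.\<close>
  define y where "y = \<beta> * M * sqrt (2 ^ length L)"
  have y: "y \<ge> 0"
    using \<beta>1 \<open>M \<ge> 0\<close> by (simp add: y_def)
  define g where "g = (\<lambda>n. y ^ n / sqrt (fact n))"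
  have g: "(\<lambda>ns. prod_list (map g ns)) summable_on {ns. length ns = length L}"
    unfolding g_def using y
    by (intro summable_on_lists_prod summable_power_div_sqrt_fact) auto
  have prod_g: "prod_list (map g ns) = y ^ sum_list ns / sqrt (prod_list (map fact ns))" for ns
    by (induction ns) (auto simp: g_def power_add real_sqrt_mult)
  have bound: "norm (wick_coeff L ns * pairings_sum G (expand L ns)) \<le> norm (prod_list (map g ns))"
    if len: "length ns = length L" for ns
  proof -
    define N where "N = sum_list ns"
    define F :: real where "F = prod_list (map fact ns)"
    have F: "F > 0"
      unfolding F_def by (induction ns) auto
    have "norm (pairings_sum G (expand L ns)) \<le>
            M ^ length (expand L ns) * sqrt (fact (length (expand L ns)))"
      using set_expand[OF len] \<open>M \<ge> 0\<close>
      by (intro norm_pairings_sum_le M) (force simp: E_def)+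
    also have "\<dots> = M ^ N * sqrt (fact N)"
      by (simp add: length_expand[OF len] N_def)
    also have "\<dots> \<le> M ^ N * sqrt (2 ^ (length L * N) * F)"
      using fact_sum_list_le[of ns] \<open>M \<ge> 0\<close>
      by (intro mult_left_mono real_sqrt_le_mono) (auto simp: len N_def F_def)
    also have "\<dots> = (M * sqrt (2 ^ length L)) ^ N * sqrt F"
      by (simp add: real_sqrt_mult power_mult power_mult_distrib real_sqrt_power)
    finally have "norm (wick_coeff L ns * pairings_sum G (expand L ns)) \<le>
        (\<beta> ^ N / F) * ((M * sqrt (2 ^ length L)) ^ N * sqrt F)"
      using norm_wick_coeff_le[OF len \<beta>1 \<beta>] \<open>M \<ge> 0\<close> F \<beta>1
      unfolding norm_mult N_def F_def by (intro mult_mono) auto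
    also have "\<dots> = y ^ N / sqrt F"
      using F by (simp add: y_def power_mult_distrib field_simps)
    finally show ?thesis
      using F y unfolding prod_g N_def F_def by simp
  qed
  have "(\<lambda>ns. norm (prod_list (map g ns))) summable_on {ns. length ns = length L}"
    using g by (rule summable_on_iff_abs_summable_on_real[THEN iffD1])
  hence "(\<lambda>ns. norm (wick_coeff L ns * pairings_sum G (expand L ns))) summable_on
           {ns. length ns = length L}"
    by (rule Infinite_Sum.abs_summable_on_comparison_test) (use bound in blast)
  thus ?thesis
    by (rule abs_summable_summable)
qed

subsection \<open>Contraction of a derivative\<close>

definition contract :: "nat \<Rightarrow> (nat \<times> placed) list \<Rightarrow> (nat \<times>
    placed) list" where
  "contract p L = (case snd (snd (snd (L ! p))) of Der _ _ \<Rightarrow> remove_at p L | WExp _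
      \<Rightarrow> L)"

definition contraction_weight :: "factor \<Rightarrow> complex" where
  "contraction_weight u = (case u of Der _ _ \<Rightarrow> 1 | WExp \<alpha> \<Rightarrow> \<alpha>)"

lemma split_list_nth:
  assumes "p < length L"
  obtains L1 L2 where "L = L1 @ L ! p # L2" "length L1 = p"
  using assms by (metis id_take_nth_drop length_take min.absorb4)

text \<open>For an exponential, \<open>n * \<alpha> ^ n / fact n = \<alpha> * \<alpha> ^ (n - 1) /
  fact (n - 1)\<close>, so the sum is an index shift of the original one. For a derivative only
  multiplicity 1 contributes, and the entry disappears.\<close>

lemma has_sum_contract:
  assumes p: "p < length L"
  shows "((\<lambda>ns. wick_coeff L ns * (of_nat (ns ! p) * pairings_sum G (expand L (ns[p := ns ! p - 1]))))
           has_sum (contraction_weight (snd (snd (snd (L ! p)))) * tagged_wick G (contract p L)))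
         {ns. length ns = length L}"
    (is "(?f has_sum _) ?S")
proof -
  obtain L1 x L2 where L: "L = L1 @ x # L2" and len1: "length L1 = p" and x: "L ! p = x"
    using split_list_nth[OF p] by metis
  show ?thesis
  proof (cases "snd (snd (snd x))")
    case (WExp \<alpha>)
    define h where "h = (\<lambda>ns :: nat list. ns[p := Suc (ns ! p)])"
    have inj: "inj_on h ?S"
    proof
      fix ns ms assume *: "ns \<in> ?S" "ms \<in> ?S" "h ns = h ms"
      have "ns ! i = ms ! i" if "i < length L" for i
        using arg_cong[OF *(3), of "\<lambda>l. l ! i"] *(1,2) that
        by (cases "i = p") (auto simp: h_def)
      thus "ns = ms"
        using * by (intro nth_equalityI) auto
    qed
    have comp: "(?f \<circ> h) ns = \<alpha> * (wick_coeff L ns * pairings_sum G (expand L ns))" if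
        "ns \<in> ?S" for ns
    proof -
      have "p < length ns"
        using that p by simp
      then obtain n1 n n2 where ns: "ns = n1 @ n # n2" and n1: "length n1 = p"
        by (rule split_list_nth)
      have h: "h (n1 @ n # n2) = n1 @ Suc n # n2"
        using n1 by (simp add: h_def list_update_append nth_append)
      have "(of_nat (Suc n) :: complex) \<noteq> 0"
        by (simp only: of_nat_eq_0_iff)
      then show ?thesis
        using n1 len1 by (simp add: h L ns wick_coeff_append WExp list_update_append nth_append)
    qed
    have "((\<lambda>ns. \<alpha> * (wick_coeff L ns * pairings_sum G (expand L ns))) has_sum
        (\<alpha> * tagged_wick G L)) ?S"
      unfolding tagged_wick_def using tagged_wick_summable
      by (intro has_sum_cmult_right has_sum_infsum)
    hence "((?f \<circ> h) has_sum (\<alpha> * tagged_wick G L)) ?S"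
      using comp by (subst has_sum_cong)
    hence "(?f has_sum (\<alpha> * tagged_wick G L)) (h ` ?S)"
      by (subst has_sum_reindex[OF inj])
    \<comment> \<open>Lists outside the image of the shift have multiplicity 0 at \<open>p\<close>,
      and the factor \<open>ns ! p\<close> kills the term.\<close>
    moreover have "?f ns = 0" if "ns \<in> ?S - h ` ?S" for ns
    proof (cases "ns ! p")
      case (Suc m)
      have "ns = h (ns[p := m])"
        using that p Suc by (auto simp: h_def intro!: nth_equalityI simp: nth_list_update)
      thus ?thesis
        using that by force
    qed auto
    ultimately have "(?f has_sum (\<alpha> * tagged_wick G L)) ?S"
      by (subst has_sum_cong_neutral[where T = "h ` ?S" and g = ?f]) (auto simp: h_def)
    thus ?thesis
      by (simp add: x contract_def contraction_weight_def WExp)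
  next
    case (Der j k)
    \<comment> \<open>Inserts at position \<open>p\<close> the only multiplicity a derivative can
      have.\<close>
    define h where "h = (\<lambda>ns :: nat list. take p ns @ 1 # drop p ns)"
    define T where "T = {ns :: nat list. length ns = length (L1 @ L2)}"
    have inj: "inj_on h T"
    proof
      fix ns ms assume *: "ns \<in> T" "ms \<in> T" "h ns = h ms"
      have "take p ns = take p ms \<and> drop p ns = drop p ms"
        using * len1 by (auto simp: h_def T_def)
      thus "ns = ms"
        by (metis append_take_drop_id)
    qed
    have comp: "(?f \<circ> h) ns = wick_coeff (L1 @ L2) ns * pairings_sum G (expand (L1 @ L2) ns)"
      if "ns \<in> T" for ns
    proof -
      define n1 n2 where "n1 = take p ns" and "n2 = drop p ns"
      have ns: "ns = n1 @ n2" and n1: "length n1 = p"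
        using that len1 by (auto simp: n1_def n2_def T_def)
      show ?thesis
        using n1 len1 by (simp add: h_def L ns wick_coeff_append expand_append Der
            list_update_append nth_append)
    qed
    have "((\<lambda>ns. wick_coeff (L1 @ L2) ns * pairings_sum G (expand (L1 @ L2) ns)) has_sum
             tagged_wick G (L1 @ L2)) T"
      unfolding tagged_wick_def T_def using tagged_wick_summable
      by (intro has_sum_infsum)
    hence "((?f \<circ> h) has_sum (tagged_wick G (L1 @ L2))) T"
      using comp by (subst has_sum_cong)
    hence "(?f has_sum (tagged_wick G (L1 @ L2))) (h ` T)"
      by (subst has_sum_reindex[OF inj])
    moreover have "?f ns = 0" if "ns \<in> ?S - h ` T" for ns
    proof (cases "ns ! p = 1")
      case True
      have "ns = h (remove_at p ns)" "remove_at p ns \<in> T"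
        using that p True id_take_nth_drop[of p ns]
        by (auto simp: h_def remove_at_def T_def L)
      thus ?thesis
        using that by blast
    next
      case False
      have "wick_coeff L ns = 0"
        unfolding wick_coeff_def using p False
        by (intro prod_zero bexI[of _ p]) (auto simp: x Der)
      thus ?thesis
        by simp
    qed
    moreover have "h ` T \<subseteq> ?S"
      by (auto simp: h_def T_def L)
    ultimately have "(?f has_sum (tagged_wick G (L1 @ L2))) ?S"
      by (subst has_sum_cong_neutral[where T = "h ` T" and g = ?f]) auto
    moreover have "contract p L = L1 @ L2"
      using len1 by (simp add: contract_def Der remove_at_def L nth_append)
    ultimately show ?thesis
      by (simp add: x contraction_weight_def Der)
  qed
qed

lemma has_sum_finite_sum:
  fixes f :: "'i \<Rightarrow> 'a \<Rightarrow> complex"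
  assumes "finite I" "\<And>i. i \<in> I \<Longrightarrow> (f i has_sum s i) A"
  shows "((\<lambda>x. \<Sum>i\<in>I. f i x) has_sum (\<Sum>i\<in>I. s i)) A"
  using assms
proof (induction I rule: finite_induct)
  case (insert i I)
  have "((\<lambda>x. f i x + (\<Sum>i\<in>I. f i x)) has_sum (s i + (\<Sum>i\<in>I. s i))) A"
    using insert by (intro has_sum_add) auto
  then show ?case
    using insert by simp
qed auto

text \<open>Wick's formula for one derivative: it occurs with multiplicity exactly 1, so the
  recursion of \<open>pairings_sum\<close> on its first entry applies, and for each partner
  \<open>p\<close> the sum over multiplicities is a convergent series of the same kind.\<close>

lemma tagged_wick_Der_Cons:
  "tagged_wick G ((t, c, z, Der j k) # L) =
     (\<Sum>p<length L.
        (if fst (L ! p) = t then 0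
         else pair_expectation G (c, z, j, k) (elementary_of (snd (L ! p))) *
                contraction_weight (snd (snd (snd (L ! p))))) *
        tagged_wick G (contract p L))"
proof -
  let ?x = "(t, c, z, Der j k)" and ?S = "{ns :: nat list. length ns = length L}"
  let ?S' = "{ns :: nat list. length ns = length (?x # L)}"
  let ?f = "\<lambda>ns. wick_coeff (?x # L) ns * pairings_sum G (expand (?x # L) ns)"
  define \<kappa> where "\<kappa> = (\<lambda>y :: nat \<times> elementary.
    if fst y = t then 0 else pair_expectation G (c, z, j, k) (snd y))"
  have inj: "inj_on ((#) 1) ?S"
    by auto
  have "(?f \<circ> (#) 1) ns = (\<Sum>p<length L. \<kappa> (apsnd elementary_of (L ! p)) *
           (wick_coeff L ns * (of_nat (ns ! p) * pairings_sum G (expand L (ns[p := ns ! p - 1])))))"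
    if "ns \<in> ?S" for ns
  proof -
    have "(?f \<circ> (#) 1) ns = wick_coeff L ns * pairings_sum G ((t, c, z, j, k) # expand L ns)"
      by simp
    also have "pairings_sum G ((t, c, z, j, k) # expand L ns) =
      (\<Sum>p<length (expand L ns). \<kappa> (expand L ns ! p) * pairings_sum G (remove_at p (expand L ns)))"
      unfolding pairings_sum_Cons \<kappa>_def by (simp cong: if_cong)
    also have "\<dots> = (\<Sum>p<length L. of_nat (ns ! p) * \<kappa> (apsnd elementary_of (L ! p)) *
                         pairings_sum G (expand L (ns[p := ns ! p - 1])))"
      using that by (intro sum_remove_at_expand) auto
    finally show ?thesis
      by (simp add: sum_distrib_left mult_ac)
  qed
  moreover have "((\<lambda>ns. \<Sum>p<length L. \<kappa> (apsnd elementary_of (L ! p)) *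
           (wick_coeff L ns * (of_nat (ns ! p) * pairings_sum G (expand L (ns[p := ns ! p - 1])))))
      has_sum (\<Sum>p<length L. \<kappa> (apsnd elementary_of (L ! p)) *
         (contraction_weight (snd (snd (snd (L ! p)))) * tagged_wick G (contract p L)))) ?S"
    by (intro has_sum_finite_sum has_sum_cmult_right has_sum_contract) auto
  ultimately have "((?f \<circ> (#) 1) has_sum (\<Sum>p<length L. \<kappa> (apsnd elementary_of (L ! p)) *
         (contraction_weight (snd (snd (snd (L ! p)))) * tagged_wick G (contract p L)))) ?S"
    by (subst has_sum_cong)
  hence "(?f has_sum (\<Sum>p<length L. \<kappa> (apsnd elementary_of (L ! p)) *
         (contraction_weight (snd (snd (snd (L ! p)))) * tagged_wick G (contract p L)))) ((#) 1 ` ?S)"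
    by (subst has_sum_reindex[OF inj])
  moreover have "?f ns = 0" if "ns \<in> ?S' - (#) 1 ` ?S" for ns
  proof -
    have "length ns = Suc (length L)"
      using that by simp
    then obtain n ms where ns: "ns = n # ms" "ms \<in> ?S"
      by (auto simp: length_Suc_conv)
    hence "n \<noteq> 1"
      using that by auto
    thus ?thesis
      by (simp add: ns)
  qed
  ultimately have "(?f has_sum (\<Sum>p<length L. \<kappa> (apsnd elementary_of (L ! p)) *
         (contraction_weight (snd (snd (snd (L ! p)))) * tagged_wick G (contract p L)))) ?S'"
    by (subst has_sum_cong_neutral[where T = "(#) 1 ` ?S" and g = ?f]) auto
  hence "tagged_wick G (?x # L) = (\<Sum>p<length L. \<kappa> (apsnd elementary_of (L ! p)) *
         (contraction_weight (snd (snd (snd (L ! p)))) * tagged_wick G (contract p L)))"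
    unfolding tagged_wick_def[of G "?x # L"] by (rule infsumI)
  also have "\<dots> = (\<Sum>p<length L.
        (if fst (L ! p) = t then 0
         else pair_expectation G (c, z, j, k) (elementary_of (snd (L ! p))) *
                contraction_weight (snd (snd (snd (L ! p))))) *
        tagged_wick G (contract p L))"
    by (intro sum.cong) (auto simp: \<kappa>_def)
  finally show ?thesis .
qed

subsection \<open>Renaming of tags\<close>

text \<open>Tags enter only through the question whether two of them are equal.\<close>

lemma pairings_sum_retag:
  assumes "inj_on f (fst ` set xs)"
  shows "pairings_sum G (map (apfst f) xs) = pairings_sum G xs"
  using assms
proof (induction "length xs" arbitrary: xs rule: less_induct)
  case less
  show ?case
  proof (cases xs)
    case (Cons x ys)
    have "pairings_sum G (map (apfst f) (remove_at p ys)) = pairings_sum G (remove_at p ys)"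
      if "p < length ys" for p
      using that set_remove_at[of p ys]
      by (intro less inj_on_subset[OF less(2)]) (auto simp: Cons length_remove_at)
    moreover have "f (fst (ys ! p)) = f (fst x) \<longleftrightarrow> fst (ys ! p) = fst x" if "p <
        length ys" for p
      using that less(2) by (auto simp: Cons inj_on_def)
    ultimately show ?thesis
      unfolding Cons list.map pairings_sum_Cons
      by (intro sum.cong) (auto simp: map_remove_at)
  qed auto
qed

lemma tagged_wick_retag:
  assumes "inj_on f (fst ` set L)"
  shows "tagged_wick G (map (apfst f) L) = tagged_wick G L"
proof -
  have "pairings_sum G (expand (map (apfst f) L) ns) = pairings_sum G (expand L ns)"
    if "length ns = length L" for ns
  proof -
    have "expand (map (apfst f) L) ns = map (apfst f) (expand L ns)"
      using that by (induction ns L rule: list_induct2) auto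
    moreover have "inj_on f (fst ` set (expand L ns))"
      using set_expand[OF that] by (intro inj_on_subset[OF assms]) force
    ultimately show ?thesis
      by (simp add: pairings_sum_retag)
  qed
  moreover have "wick_coeff (map (apfst f) L) ns = wick_coeff L ns" for ns
    unfolding wick_coeff_def by (intro prod.cong) auto
  ultimately show ?thesis
    unfolding tagged_wick_def length_map by (intro infsum_cong) simp
qed

definition tagged_from :: "nat \<Rightarrow> placed list list \<Rightarrow> (nat \<times> placed) list" where
  "tagged_from k ms = concat (map (\<lambda>(i, m). map (Pair i) m) (List.enumerate k ms))"

lemma tagged_from_Nil [simp]: "tagged_from k [] = []"
  by (simp add: tagged_from_def)

lemma tagged_from_Cons [simp]:
  "tagged_from k (m # ms) = map (Pair k) m @ tagged_from (Suc k) ms"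
  by (simp add: tagged_from_def)

lemma tagged_eq: "tagged = tagged_from 0"
  by (simp add: fun_eq_iff tagged_def tagged_from_def)

lemma tagged_from_retag: "map (apfst Suc) (tagged_from k ms) = tagged_from (Suc k) ms"
  by (induction ms arbitrary: k) auto

lemma tagged_from_ge: "x \<in> set (tagged_from k ms) \<Longrightarrow> fst x \<ge> k"
  by (induction ms arbitrary: k) (auto dest: Suc_leD)

lemma snd_tagged_from: "snd ` set (tagged_from k ms) = (\<Union>m\<in>set ms. set m)"
  by (induction ms arbitrary: k) (auto simp: image_Un image_image)

text \<open>In a product of two functionals the test monomials start at tag 2. Retagging gives a
  single functional the same tail \<open>tagged_from 2 ms\<close>, so both kinds of correlations
  become sums over one list; \<open>s = 1\<close> lets a vertex factor keep the tag it has as second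
  functional.\<close>

lemma wick_correlation_head:
  assumes "s < 2"
  shows "wick_correlation G (m # ms) = tagged_wick G (map (Pair s) m @ tagged_from 2 ms)"
proof -
  define f where "f = (\<lambda>i. if i = 0 then s else Suc i)"
  let ?L = "map (Pair 0) m @ tagged_from 1 ms"
  have "map (apfst f) (tagged_from 1 ms) = map (apfst Suc) (tagged_from 1 ms)"
  proof (intro map_cong refl)
    fix x assume "x \<in> set (tagged_from 1 ms)"
    hence "fst x \<ge> 1"
      by (rule tagged_from_ge)
    thus "apfst f x = apfst Suc x"
      by (cases x) (simp add: f_def)
  qed
  hence "map (apfst f) ?L = map (Pair s) m @ tagged_from 2 ms"
    by (simp add: tagged_from_retag numeral_2_eq_2) (simp add: f_def)
  moreover have "inj_on f (fst ` set ?L)"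
  proof (rule inj_on_subset)
    show "inj_on f UNIV"
      by (rule inj_onI) (use assms in \<open>auto simp: f_def split: if_splits\<close>)
  qed auto
  ultimately have "tagged_wick G ?L = tagged_wick G (map (Pair s) m @ tagged_from 2 ms)"
    using tagged_wick_retag[of f ?L G] by (simp only:)
  thus ?thesis
    by (simp add: wick_correlation_eq tagged_eq)
qed

lemma wick_correlation_head2:
  "wick_correlation G (m # m' # ms) =
     tagged_wick G (map (Pair 0) m @ map (Pair 1) m' @ tagged_from 2 ms)"
  by (simp add: wick_correlation_eq tagged_eq numeral_2_eq_2)

text \<open>In \<open>wsum1\<close> and \<open>wsum2\<close> one or two derivatives are contracted
    with the factors in \<open>R\<close>, while the
  factors in \<open>P\<close> are spectators. The contraction values are an argument, so that these
      expressions
  are linear in them.\<close>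

definition wsum1 ::
    "(complex \<Rightarrow> complex \<Rightarrow> real) \<Rightarrow> (placed \<Rightarrow> complex)
        \<Rightarrow> (nat \<times> placed) list \<Rightarrow>
     (nat \<times> placed) list \<Rightarrow> complex" where
  "wsum1 G g P R = (\<Sum>p<length R. g (snd (R ! p)) * tagged_wick G (P @ contract p R))"

definition wsum2 ::
    "(complex \<Rightarrow> complex \<Rightarrow> real) \<Rightarrow> (placed \<Rightarrow> complex)
        \<Rightarrow> (placed \<Rightarrow> complex) \<Rightarrow>
     (nat \<times> placed) list \<Rightarrow> (nat \<times> placed) list \<Rightarrow> complex" where
  "wsum2 G g h P R = (\<Sum>p<length R. g (snd (R ! p)) * wsum1 G h P (contract p R))"

definition der_contraction ::
    "(complex \<Rightarrow> complex \<Rightarrow> real) \<Rightarrow> chart \<Rightarrow> complex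
        \<Rightarrow> nat \<Rightarrow> placed \<Rightarrow> complex" where
  "der_contraction G c z j u =
     pair_expectation G (c, z, j, 0) (elementary_of u) * contraction_weight (snd (snd u))"

lemma set_contract: "set (contract p R) \<subseteq> set R"
  using set_remove_at[of p R] by (auto simp: contract_def split: factor.splits)

lemma contract_tag:
  assumes "\<And>x. x \<in> set R \<Longrightarrow> fst x \<noteq> t" "x \<in> set (contract p R)"
  shows "fst x \<noteq> t"
  using assms set_contract by blast

lemma contract_append_left: "p < length P \<Longrightarrow> contract p (P @ R) = contract p P @ R"
  by (auto simp: contract_def nth_append remove_at_def split: factor.splits)

lemma contract_append_right: "contract (length P + p) (P @ R) = P @ contract p R"
  by (auto simp: contract_def nth_append remove_at_def split: factor.splits)

text \<open>\<open>P\<close> holds the factors accompanying the derivative, where a contraction is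
  forbidden by an equal tag or produces a pole; \<open>R\<close> holds the test factors, where every
  contraction is allowed.\<close>

lemma tagged_wick_Der_split:
  assumes "\<And>x. x \<in> set R \<Longrightarrow> fst x \<noteq> t"
  shows "tagged_wick G ((t, c, z, Der j 0) # P @ R) =
           (\<Sum>p<length P. (if fst (P ! p) = t then 0 else der_contraction G c z j (snd (P ! p))) *
                          tagged_wick G (contract p P @ R)) +
           wsum1 G (der_contraction G c z j) P R"
proof -
  define F where "F = (\<lambda>p. (if fst ((P @ R) ! p) = t then 0 else der_contraction G c z j
      (snd ((P @ R) ! p))) *
                          tagged_wick G (contract p (P @ R)))"
  have "tagged_wick G ((t, c, z, Der j 0) # P @ R) = (\<Sum>p<length P + length R. F p)"
    unfolding tagged_wick_Der_Cons F_def der_contraction_def by simp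
  also have "{..<length P + length R} = {..<length P} \<union> (+) (length P) ` {..<length R}"
    by (simp add: lessThan_atLeast0 image_add_atLeastLessThan add.commute ivl_disj_un)
  also have "sum F \<dots> = sum F {..<length P} + sum F ((+) (length P) ` {..<length R})"
    by (intro sum.union_disjoint) auto
  also have "sum F {..<length P} =
      (\<Sum>p<length P. (if fst (P ! p) = t then 0 else der_contraction G c z j (snd (P ! p))) *
                          tagged_wick G (contract p P @ R))"
    by (intro sum.cong) (auto simp: F_def nth_append contract_append_left)
  also have "sum F ((+) (length P) ` {..<length R}) = (\<Sum>p<length R. F (length P + p))"
    by (subst sum.reindex) auto
  also have "\<dots> = wsum1 G (der_contraction G c z j) P R"
    unfolding wsum1_def
  proof (intro sum.cong refl)
    fix p assume "p \<in> {..<length R}"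
    hence "fst (R ! p) \<noteq> t"
      using assms by auto
    thus "F (length P + p) = der_contraction G c z j (snd (R ! p)) * tagged_wick G (P @ contract p R)"
      by (simp add: F_def contract_append_right)
  qed
  finally show ?thesis .
qed

lemma tagged_wick_Der:
  assumes "\<And>x. x \<in> set R \<Longrightarrow> fst x \<noteq> t" "\<And>x. x \<in> set P
      \<Longrightarrow> fst x = t"
  shows "tagged_wick G ((t, c, z, Der j 0) # P @ R) = wsum1 G (der_contraction G c z j) P R"
proof -
  have "(\<Sum>p<length P. (if fst (P ! p) = t then 0 else der_contraction G c z j (snd (P ! p))) *
                          tagged_wick G (contract p P @ R)) = 0"
    using assms(2) by (intro sum.neutral) auto
  thus ?thesis
    using tagged_wick_Der_split[OF assms(1), where R = R] by simp
qed

lemma tagged_wick_Der_Der: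
  assumes "\<And>x. x \<in> set R \<Longrightarrow> fst x \<noteq> t" "\<And>x. x \<in> set P
      \<Longrightarrow> fst x = t"
  shows "tagged_wick G ((t, c, z, Der i 0) # (t, c, z, Der j 0) # P @ R) =
           wsum2 G (der_contraction G c z i) (der_contraction G c z j) P R"
proof -
  have "tagged_wick G ((t, c, z, Der j 0) # P @ contract p R) =
          wsum1 G (der_contraction G c z j) P (contract p R)" for p
    using assms contract_tag[of R t] by (intro tagged_wick_Der) blast+
  moreover have "tagged_wick G ((t, c, z, Der i 0) # ((t, c, z, Der j 0) # P) @ R) =
      wsum1 G (der_contraction G c z i) ((t, c, z, Der j 0) # P) R"
    by (rule tagged_wick_Der) (use assms in \<open>auto simp del: split_paired_All\<close>)
  ultimately show ?thesis
    by (simp add: wsum1_def[of _ _ "_ # _"] wsum2_def)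
qed

lemma tagged_wick_Der_pole:
  assumes "\<And>x. x \<in> set R \<Longrightarrow> fst x \<noteq> t" "s \<noteq> t"
  shows "tagged_wick G ((t, c, z, Der j 0) # (s, d, y, WExp \<alpha>) # R) =
           der_contraction G c z j (d, y, WExp \<alpha>) * tagged_wick G ((s, d, y, WExp \<alpha>) # R) +
           wsum1 G (der_contraction G c z j) [(s, d, y, WExp \<alpha>)] R"
  using tagged_wick_Der_split[OF assms(1), where P = "[(s, d, y, WExp \<alpha>)]" and R = R] assms(2)
  by (simp add: contract_def)

text \<open>Each derivative is contracted with the nearby exponential or with \<open>R\<close>. The
  exponential survives the first contraction and is available for the second, whence the product of
  two pole factors.\<close>

lemma tagged_wick_Der_Der_pole:
  assumes "\<And>x. x \<in> set R \<Longrightarrow> fst x \<noteq> t" "s \<noteq> t"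
  shows "tagged_wick G ((t, c, z, Der i 0) # (t, c, z, Der j 0) # (s, d, y, WExp \<alpha>) # R) =
           der_contraction G c z i (d, y, WExp \<alpha>) * der_contraction G c z j (d, y, WExp \<alpha>) *
             tagged_wick G ((s, d, y, WExp \<alpha>) # R) +
           der_contraction G c z i (d, y, WExp \<alpha>) * 
             wsum1 G (der_contraction G c z j) [(s, d, y, WExp \<alpha>)] R +
           der_contraction G c z j (d, y, WExp \<alpha>) * 
             wsum1 G (der_contraction G c z i) [(s, d, y, WExp \<alpha>)] R +
           wsum2 G (der_contraction G c z i) (der_contraction G c z j) [(s, d, y, WExp \<alpha>)] R"
proof -
  let ?V = "(s, d, y, WExp \<alpha>)"
  have "tagged_wick G ((t, c, z, Der j 0) # ?V # contract p R) =
           der_contraction G c z j (d, y, WExp \<alpha>) * tagged_wick G (?V # contract p R) +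
           wsum1 G (der_contraction G c z j) [?V] (contract p R)" for p
    using assms contract_tag[of R t] by (intro tagged_wick_Der_pole) blast+
  hence "wsum1 G (der_contraction G c z i) [(t, c, z, Der j 0), ?V] R =
      der_contraction G c z j (d, y, WExp \<alpha>) * wsum1 G (der_contraction G c z i) [?V] R +
      wsum2 G (der_contraction G c z i) (der_contraction G c z j) [?V] R"
    by (simp add: wsum1_def[of _ "der_contraction G c z i"] wsum2_def sum_distrib_left
        algebra_simps sum.distrib)
  moreover have "tagged_wick G ((t, c, z, Der j 0) # ?V # R) =
      der_contraction G c z j (d, y, WExp \<alpha>) * tagged_wick G (?V # R) +
      wsum1 G (der_contraction G c z j) [?V] R"
    using assms by (rule tagged_wick_Der_pole)
  ultimately show ?thesis
    using tagged_wick_Der_split[OF assms(1), where P = "[(t, c, z, Der j 0), ?V]" and R = R and j =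
        i and c = c and z = z and G = G] assms(2)
    by (simp add: contract_def remove_at_def algebra_simps)
qed

text \<open>Unlike an exponential, the nearby derivative is used up, either by the first one or by a
  factor of \<open>R\<close>.\<close>

lemma tagged_wick_Der_Der_pole':
  assumes "\<And>x. x \<in> set R \<Longrightarrow> fst x \<noteq> t" "\<And>x. x \<in> set R
      \<Longrightarrow> fst x \<noteq> s" "s \<noteq> t"
  shows "tagged_wick G ((t, c, z, Der i 0) # (s, d, y, Der j 0) # R) =
           pair_expectation G (c, z, i, 0) (d, y, j, 0) * tagged_wick G R +
           wsum2 G (der_contraction G c z i) (der_contraction G d y j) [] R"
proof -
  have "tagged_wick G ((s, d, y, Der j 0) # contract p R) =
           wsum1 G (der_contraction G d y j) [] (contract p R)" for p
    using tagged_wick_Der[of "contract p R" s "[]"] contract_tag[OF assms(2)] by simp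
  hence "wsum1 G (der_contraction G c z i) [(s, d, y, Der j 0)] R =
      wsum2 G (der_contraction G c z i) (der_contraction G d y j) [] R"
    by (simp add: wsum1_def[of _ _ "[_]"] wsum2_def)
  thus ?thesis
    using tagged_wick_Der_split[OF assms(1), where P = "[(s, d, y, Der j 0)]" and R = R and j = i
        and c = c and z = z and G = G] assms(3)
    by (simp add: contract_def remove_at_def der_contraction_def contraction_weight_def)
qed

subsection \<open>Correlations with a fixed choice of test monomials\<close>

text \<open>By multilinearity an identity in correlations may be checked for each choice of one
  monomial from every test functional; this moves the sums over \<open>product_lists\<close> out of
  the way.\<close>

definition mono_corr ::
    "(complex \<Rightarrow> complex \<Rightarrow> real) \<Rightarrow> functional \<Rightarrow>
        placed list list \<Rightarrow> complex" where
  "mono_corr G F ms = (\<Sum>(s, m)\<leftarrow>F. s * wick_correlation G (m # ms))"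

definition mono_corr2 ::
    "(complex \<Rightarrow> complex \<Rightarrow> real) \<Rightarrow> functional \<Rightarrow>
        functional \<Rightarrow> placed list list \<Rightarrow> complex" where
  "mono_corr2 G F F' ms =
     (\<Sum>(s, m)\<leftarrow>F. \<Sum>(s', m')\<leftarrow>F'. s * s' * wick_correlation G (m # m' # ms))"

lemma correlation_Nil_Cons [simp]: "correlation G ([] # Fs) = 0"
  by (simp add: correlation_def)

lemma correlation_Cons_Cons:
  "correlation G ((x # F) # Fs) =
     (\<Sum>ts\<leftarrow>product_lists Fs. prod_list (map fst ts) *
        (fst x * wick_correlation G (snd x # map snd ts))) + correlation G (F # Fs)"
  by (simp add: correlation_def o_def mult_ac)

lemma correlation_eq_mono_corr:
  "correlation G (F # Fs) =
     (\<Sum>ts\<leftarrow>product_lists Fs. prod_list (map fst ts) * mono_corr G F (map snd ts))"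
proof (induction F)
  case Nil
  then show ?case by (simp add: mono_corr_def)
next
  case (Cons x F)
  then show ?case
    by (simp add: correlation_Cons_Cons mono_corr_def case_prod_beta sum_list_addf distrib_left)
qed

lemma correlation_eq_mono_corr2:
  "correlation G (F # F' # Fs) =
     (\<Sum>ts\<leftarrow>product_lists Fs. prod_list (map fst ts) * mono_corr2 G F F' (map snd ts))"
proof (induction F)
  case Nil
  then show ?case by (simp add: mono_corr2_def)
next
  case (Cons x F)
  have "(\<Sum>ts\<leftarrow>product_lists (F' # Fs). prod_list (map fst ts) *
          (fst x * wick_correlation G (snd x # map snd ts))) =
        (\<Sum>ts\<leftarrow>product_lists Fs. prod_list (map fst ts) *
          (\<Sum>(s', m')\<leftarrow>F'. fst x * s' * wick_correlation G (snd x # m' # map snd ts)))"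
    by (induction F')
       (auto simp: o_def sum_list_addf distrib_left mult_ac)
  then show ?case
    using Cons
    by (simp add: correlation_Cons_Cons mono_corr2_def case_prod_beta sum_list_addf distrib_left)
qed

lemma mono_corr_at_point:
  "mono_corr G (at_point X c z) ms =
     (\<Sum>(f, p)\<leftarrow>X. f c z * wick_correlation G (map (\<lambda>u. (c, z, u)) p # ms))"
  by (simp add: mono_corr_def at_point_def o_def case_prod_unfold)

lemma mono_corr_append: "mono_corr G (F @ F') ms = mono_corr G F ms + mono_corr G F' ms"
  by (simp add: mono_corr_def)

lemma at_point_add: "at_point (field_add X Y) c z = at_point X c z @ at_point Y c z"
  by (simp add: at_point_def field_add_def)

lemma correlation_append:
  "correlation G ((F @ F') # Fs) = correlation G (F # Fs) + correlation G (F' # Fs)"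
  by (simp add: correlation_eq_mono_corr mono_corr_append distrib_left sum_list_addf)

lemma correlation_scale:
  "correlation G (at_point (field_scale s X) c z # Fs) = s * correlation G (at_point X c z # Fs)"
proof -
  have "mono_corr G (at_point (field_scale s X) c z) ms = s * mono_corr G (at_point X c z) ms" for ms
    by (simp add: mono_corr_at_point field_scale_def o_def case_prod_beta
        sum_list_const_mult[symmetric] mult.assoc)
  thus ?thesis
    by (simp add: correlation_eq_mono_corr sum_list_const_mult[symmetric] mult_ac)
qed

definition good_monomials :: "complex set \<Rightarrow> complex \<Rightarrow> placed list list
    \<Rightarrow> bool" where
  "good_monomials D x ms \<longleftrightarrow>
     (\<forall>m\<in>set ms. \<forall>(d, y, u)\<in>set m. local_chart D d \<and> y \<in> coords d
         \<and> point_of d y \<noteq> x)"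

lemma product_lists_mem:
  "ts \<in> set (product_lists Zs) \<Longrightarrow> t \<in> set ts \<Longrightarrow>
      \<exists>Z\<in>set Zs. t \<in> set Z"
proof (induction Zs arbitrary: ts)
  case (Cons Z Zs)
  then obtain t' ts' where "ts = t' # ts'" "t' \<in> set Z" "ts' \<in> set (product_lists Zs)"
    by auto
  then show ?case
    using Cons by (cases "t = t'") auto
qed auto

lemma good_monomials_product_lists:
  assumes "test_product D Zs" "x \<notin> all_nodes Zs" "ts \<in> set (product_lists Zs)"
  shows "good_monomials D x (map snd ts)"
  unfolding good_monomials_def
proof (intro ballI)
  fix m v assume m: "m \<in> set (map snd ts)" "v \<in> set m"
  obtain s where "(s, m) \<in> set ts"
    using m by auto
  then obtain Z where Z: "Z \<in> set Zs" "(s, m) \<in> set Z"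
    using product_lists_mem[OF assms(3)] by blast
  obtain d y u where v: "v = (d, y, u)"
    by (cases v)
  have "functional_in D Z"
    using assms(1) Z by (simp add: test_product_def)
  hence "\<forall>(c, z, _)\<in>set m. local_chart D c \<and> z \<in> coords c"
    using Z unfolding functional_in_def by blast
  hence "local_chart D d \<and> y \<in> coords d"
    using m by (auto simp: v)
  moreover have "(\<lambda>(c, z, _). point_of c z) v \<in> all_nodes Zs"
    unfolding all_nodes_def nodes_def using Z m by blast
  hence "point_of d y \<noteq> x"
    using assms(2) by (auto simp: v)
  ultimately show "case v of (d, y, u) \<Rightarrow>
      local_chart D d \<and> y \<in> coords d \<and> point_of d y \<noteq> x"
    by (simp add: v)
qed

section \<open>Contractions in local charts as holomorphic functions of the position\<close>

locale green_domain =
  fixes D :: "complex set" and G :: "complex \<Rightarrow> complex \<Rightarrow> real" and w ::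
      "complex \<Rightarrow> complex"
  assumes open_D: "open D" and holo_w: "w holomorphic_on D" and inj_w: "inj_on w D"
    and Im_w: "\<And>x. x \<in> D \<Longrightarrow> Im (w x) > 0"
    and green: "\<And>x y. x \<in> D \<Longrightarrow> y \<in> D \<Longrightarrow> x \<noteq> y
        \<Longrightarrow> G x y = half_plane_green (w x) (w y)"
begin

lemma open_coords: "local_chart D c \<Longrightarrow> open (coords c)"
  unfolding local_chart_def coords_def by (auto intro!: open_mapping_thm3)

lemma point_of_mem: "local_chart D c \<Longrightarrow> x \<in> coords c \<Longrightarrow> point_of c
    x \<in> fst c"
  unfolding local_chart_def coords_def point_of_def by (auto simp: the_inv_into_f_f)

lemma point_of_in_D: "local_chart D c \<Longrightarrow> x \<in> coords c \<Longrightarrow> point_of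
    c x \<in> D"
  using point_of_mem[of c x] by (auto simp: local_chart_def)

lemma point_of_inj:
  "local_chart D c \<Longrightarrow> x \<in> coords c \<Longrightarrow> y \<in> coords c
      \<Longrightarrow> point_of c x = point_of c y \<longleftrightarrow> x = y"
  unfolding local_chart_def coords_def point_of_def by (auto simp: the_inv_into_f_f)

lemma point_of_holomorphic:
  assumes "local_chart D c"
  shows "point_of c holomorphic_on coords c"
proof -
  have c: "snd c holomorphic_on fst c" "open (fst c)" "inj_on (snd c) (fst c)"
    using assms by (auto simp: local_chart_def)
  obtain g where g: "g holomorphic_on coords c" "\<And>z. z \<in> fst c \<Longrightarrow> g (snd c z) = z"
    using holomorphic_has_inverse[OF c] unfolding coords_def by metis
  show ?thesis
    by (rule holomorphic_transform[OF g(1)])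
       (use g(2) c(3) in \<open>auto simp: coords_def point_of_def the_inv_into_f_f\<close>)
qed

lemma in_chart_holomorphic:
  assumes "local_chart D c"
  shows "in_chart w c holomorphic_on coords c"
  unfolding in_chart_def using point_of_in_D[OF assms]
  by (intro holomorphic_on_compose holomorphic_on_subset[OF holo_w] point_of_holomorphic assms) auto

lemma in_chart_inj:
  assumes "local_chart D c" "local_chart D d" "x \<in> coords c" "y \<in> coords d"
  shows "in_chart w c x = in_chart w d y \<longleftrightarrow> point_of c x = point_of d y"
  using inj_onD[OF inj_w _ point_of_in_D[OF assms(1,3)] point_of_in_D[OF assms(2,4)]]
  by (auto simp: in_chart_def)

lemma Im_in_chart: "local_chart D c \<Longrightarrow> x \<in> coords c \<Longrightarrow> Im
    (in_chart w c x) > 0"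
  using Im_w point_of_in_D by (simp add: in_chart_def)

lemma in_chart_neq_cnj:
  assumes "local_chart D c" "local_chart D d" "x \<in> coords c" "y \<in> coords d"
  shows "in_chart w c x \<noteq> cnj (in_chart w d y)"
  using Im_in_chart[OF assms(1,3)] Im_in_chart[OF assms(2,4)] by (auto simp: complex_eq_iff)

lemma green_in_charts:
  assumes "local_chart D c" "local_chart D d" "x \<in> coords c" "y \<in> coords d" "point_of c x
      \<noteq> point_of d y"
  shows "G (point_of c x) (point_of d y) = half_plane_green (in_chart w c x) (in_chart w d y)"
  using green point_of_in_D assms by (simp add: in_chart_def)

definition off_node :: "chart \<Rightarrow> placed \<Rightarrow> complex set" where
  "off_node c = (\<lambda>(d, y, u). {x \<in> coords c. point_of c x \<noteq> point_of d y})"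

lemma off_node_eq:
  assumes "local_chart D c" "local_chart D d" "y \<in> coords d"
  shows "off_node c (d, y, u) = coords c \<inter> in_chart w c -` (- {in_chart w d y})"
  using in_chart_inj[OF assms(1,2) _ assms(3)] by (auto simp: off_node_def)

lemma open_off_node:
  assumes "local_chart D c" "local_chart D d" "y \<in> coords d"
  shows "open (off_node c (d, y, u))"
  unfolding off_node_eq[OF assms]
  using open_coords[OF assms(1)] in_chart_holomorphic[OF assms(1)]
  by (intro continuous_open_preimage holomorphic_on_imp_continuous_on) auto

text \<open>The inner derivatives of \<open>pair_expectation\<close>, viewed as a function of a
  point of \<open>D\<close>; only the outer derivative involves the chart of the first
  argument.\<close>

definition green_partial :: "chart \<Rightarrow> nat \<Rightarrow> nat \<Rightarrow> complex
    \<Rightarrow> complex \<Rightarrow> complex" where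
  "green_partial d l m y p = (dz ^^ l) ((dzbar ^^ m) (\<lambda>y. of_real (G p (point_of d y)))) y"

lemma pair_expectation_green_partial:
  "pair_expectation G (c, x, j, 0) (d, y, l, m) = 2 * (dz ^^ j) (\<lambda>x. green_partial d l m y
      (point_of c x)) x"
  by (simp add: green_partial_def)

lemma dzbar_funpow_cong_open:
  assumes "open U" "z \<in> U" "\<And>x. x \<in> U \<Longrightarrow> f x = g x"
  shows "(dzbar ^^ n) f z = (dzbar ^^ n) g z"
  using assms(2)
proof (induction n arbitrary: z)
  case (Suc n)
  then show ?case
    using assms(1) by (auto intro!: dzbar_cong_open[of U])
qed (use assms in auto)

text \<open>Derivatives at \<open>y\<close> see only a neighbourhood of \<open>y\<close>, which can
  be taken to avoid the point of \<open>x\<close>; there \<open>G\<close> is given by the explicit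
  formula.\<close>

lemma green_partial_eq:
  assumes "local_chart D c" "local_chart D d" "y \<in> coords d" "x \<in> off_node c (d, y, u)"
  shows "green_partial d l m y (point_of c x) =
           (dz ^^ l) ((dzbar ^^ m) (\<lambda>y. of_real (half_plane_green (in_chart w c x) (in_chart
               w d y)))) y"
proof -
  have x: "x \<in> coords c" "point_of c x \<noteq> point_of d y"
    using assms(4) by (auto simp: off_node_def)
  have y: "y \<in> off_node d (c, x, u)"
    using assms(3) x(2) by (simp add: off_node_def)
  have U: "open (off_node d (c, x, u))"
    by (rule open_off_node) (use assms x in auto)
  have "(dzbar ^^ m) (\<lambda>y. of_real (G (point_of c x) (point_of d y))) y' =
      (dzbar ^^ m) (\<lambda>y. of_real (half_plane_green (in_chart w c x) (in_chart w d y))) y'"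
    if "y' \<in> off_node d (c, x, u)" for y'
  proof (rule dzbar_funpow_cong_open[OF U that])
    fix y'' assume "y'' \<in> off_node d (c, x, u)"
    hence "G (point_of c x) (point_of d y'') = half_plane_green (in_chart w c x) (in_chart w d y'')"
      by (intro green_in_charts assms x) (auto simp: off_node_def)
    thus "complex_of_real (G (point_of c x) (point_of d y'')) =
            of_real (half_plane_green (in_chart w c x) (in_chart w d y''))"
      by simp
  qed
  thus ?thesis
    unfolding green_partial_def by (rule dz_funpow_cong_open[OF U y])
qed

lemma dz_green_partial_00:
  assumes "local_chart D c" "local_chart D d" "y \<in> coords d" "x \<in> off_node c (d, y, u)"
  shows "dz (\<lambda>x. green_partial d 0 0 y (point_of c x)) x =
      (deriv (in_chart w c) x / (in_chart w d y - in_chart w c x) -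
       deriv (in_chart w c) x / (cnj (in_chart w d y) - in_chart w c x)) / 2"
proof -
  have x: "x \<in> coords c" "point_of c x \<noteq> point_of d y"
    using assms(4) by (auto simp: off_node_def)
  have "dz (\<lambda>x. green_partial d 0 0 y (point_of c x)) x =
      dz (\<lambda>x. of_real (half_plane_green (in_chart w d y) (in_chart w c x))) x"
    by (rule dz_cong_open[OF open_off_node[OF assms(1-3)] assms(4)])
       (use green_partial_eq[OF assms(1-3), of _ u 0 0] in \<open>simp add: half_plane_green_commute\<close>)
  also have "\<dots> = (deriv (in_chart w c) x / (in_chart w d y - in_chart w c x) -
       deriv (in_chart w c) x / (cnj (in_chart w d y) - in_chart w c x)) / 2"
    using assms x in_chart_inj[OF assms(1,2) x(1) assms(3)] in_chart_neq_cnj[OF assms(1,2) x(1) assms(3)]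
    by (intro half_plane_green_derivative(2) holomorphic_derivI[OF in_chart_holomorphic open_coords]) auto
  finally show ?thesis .
qed

text \<open>A single \<open>dz\<close> removes the antiholomorphic part of \<open>P + cnj Q\<close>.
  The case \<open>l = m = 0\<close> uses the explicit kernel, since the undifferentiated logarithm
  has in general no single-valued splitting of this form.\<close>

lemma dz_green_partial_holomorphic:
  assumes "local_chart D c" "local_chart D d" "y \<in> coords d"
  shows "dz (\<lambda>x. green_partial d l m y (point_of c x)) holomorphic_on off_node c (d, y, u)"
proof -
  let ?X = "off_node c (d, y, u)"
  have X: "open ?X"
    using assms by (rule open_off_node)
  have sub: "?X \<subseteq> coords c"
    by (auto simp: off_node_def)
  have W: "in_chart w c holomorphic_on ?X" "deriv (in_chart w c) holomorphic_on ?X"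
    using in_chart_holomorphic[OF assms(1)] holomorphic_deriv[OF _ open_coords[OF assms(1)]] sub
    by (auto intro: holomorphic_on_subset)
  have ne: "in_chart w d y \<noteq> in_chart w c x" "cnj (in_chart w d y) \<noteq> in_chart w c x"
      if "x \<in> ?X" for x
    using that in_chart_neq_cnj[OF assms(1,2) _ assms(3), of x] unfolding off_node_eq[OF assms] by auto
  show ?thesis
  proof (cases "l > 0 \<or> m > 0")
    case False
    have "(\<lambda>x. (deriv (in_chart w c) x / (in_chart w d y - in_chart w c x) -
       deriv (in_chart w c) x / (cnj (in_chart w d y) - in_chart w c x)) / 2) holomorphic_on ?X"
      using ne by (intro holomorphic_on_divide holomorphic_on_diff holomorphic_on_const W) auto
    thus ?thesis
      by (rule holomorphic_transform) (use False dz_green_partial_00[OF assms] in auto)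
  next
    case True
    obtain P Q where PQ: "P holomorphic_on upper_half_plane - {in_chart w d y}"
        "Q holomorphic_on upper_half_plane - {in_chart w d y}"
      "\<And>a. a \<in> upper_half_plane - {in_chart w d y} \<Longrightarrow>
       (dz ^^ l) ((dzbar ^^ m) (\<lambda>y. of_real (half_plane_green a (in_chart w d y)))) y = P a
           + cnj (Q a)"
      using half_plane_green_higher_derivatives[OF open_coords[OF assms(2)] in_chart_holomorphic[OF assms(2)]
          Im_in_chart[OF assms(2)] assms(3) True] by blast
    have img: "in_chart w c ` ?X \<subseteq> upper_half_plane - {in_chart w d y}"
      using Im_in_chart[OF assms(1)] unfolding off_node_eq[OF assms] by (auto simp: upper_half_plane_def)
    have P: "(\<lambda>x. P (in_chart w c x)) holomorphic_on ?X" and Q: "(\<lambda>x. Q (in_chart w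
        c x)) holomorphic_on ?X"
      using holomorphic_on_compose_gen[OF W(1) PQ(1) img] holomorphic_on_compose_gen[OF W(1) PQ(2) img]
      by (simp_all add: o_def)
    have "dz (\<lambda>x. green_partial d l m y (point_of c x)) x = deriv (\<lambda>x. P (in_chart w c x)) x"
      if x: "x \<in> ?X" for x
    proof -
      have "dz (\<lambda>x. green_partial d l m y (point_of c x)) x =
          dz (\<lambda>x. P (in_chart w c x) + cnj (Q (in_chart w c x))) x"
        by (rule dz_cong_open[OF X x])
           (use green_partial_eq[OF assms] PQ(3) img in \<open>simp add: image_subset_iff\<close>)
      also have "\<dots> = deriv (\<lambda>x. P (in_chart w c x)) x + cnj (dzbar (\<lambda>x. Q
          (in_chart w c x)) x)"
        using holomorphic_on_imp_differentiable[OF P X x] holomorphic_on_imp_differentiable[OF Q X x]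
          dz_holomorphic_on[OF P X x]
        by (simp add: dz_add dz_cnj differentiable_cnj)
      finally show ?thesis
        using dzbar_holomorphic_on[OF Q X x] by simp
    qed
    thus ?thesis
      using holomorphic_deriv[OF P X] by (subst holomorphic_cong[OF refl])
  qed
qed

lemma der_contraction_1:
  "der_contraction G c x (Suc 0) (d, y, u) =
     2 * contraction_weight u * dz (\<lambda>x. green_partial d (fst (snd (snd (elementary_of (d, y, u)))))
       (snd (snd (snd (elementary_of (d, y, u))))) y (point_of c x)) x"
  by (cases u) (simp_all add: der_contraction_def green_partial_def)

text \<open>The first-order contraction is holomorphic in the position, so each further
  \<open>dz\<close> is a complex derivative.\<close>

lemma der_contraction_Suc:
  assumes "local_chart D c" "local_chart D d" "y \<in> coords d" "x \<in> off_node c (d, y, u)"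
  shows "der_contraction G c x (Suc n) (d, y, u) =
           (deriv ^^ n) (\<lambda>x. der_contraction G c x (Suc 0) (d, y, u)) x"
proof -
  obtain l m where lm: "elementary_of (d, y, u) = (d, y, l, m)"
    by (cases u) auto
  let ?g = "\<lambda>x. green_partial d l m y (point_of c x)"
  let ?X = "off_node c (d, y, u)"
  have X: "open ?X" and g: "dz ?g holomorphic_on ?X"
    using open_off_node dz_green_partial_holomorphic assms by blast+
  have "(dz ^^ Suc n) ?g x = (dz ^^ n) (dz ?g) x"
    by (simp only: funpow_Suc_right o_def)
  also have "\<dots> = (deriv ^^ n) (dz ?g) x"
    by (rule dz_funpow_holomorphic_on[OF g X assms(4)])
  finally have "der_contraction G c x (Suc n) (d, y, u) = 2 * contraction_weight u * (deriv ^^ n) (dz ?g) x"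
    unfolding der_contraction_def lm pair_expectation_green_partial by simp
  also have "\<dots> = (deriv ^^ n) (\<lambda>x. 2 * contraction_weight u * dz ?g x) x"
    by (rule higher_deriv_cmult[OF g assms(4) X, symmetric])
  also have "(\<lambda>x. 2 * contraction_weight u * dz ?g x) = (\<lambda>x. der_contraction G c x
      (Suc 0) (d, y, u))"
    by (simp add: der_contraction_1 lm)
  finally show ?thesis .
qed

lemma der_contraction_holomorphic:
  assumes "local_chart D c" "local_chart D d" "y \<in> coords d"
  shows "(\<lambda>x. der_contraction G c x (Suc n) (d, y, u)) holomorphic_on off_node c (d, y, u)"
proof -
  have 1: "(\<lambda>x. der_contraction G c x (Suc 0) (d, y, u)) holomorphic_on off_node c (d, y, u)"
    unfolding der_contraction_1 by (intro holomorphic_intros dz_green_partial_holomorphic assms)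
  have "(deriv ^^ n) (\<lambda>x. der_contraction G c x (Suc 0) (d, y, u)) holomorphic_on off_node c
      (d, y, u)"
    by (intro holomorphic_higher_deriv 1 open_off_node assms)
  thus ?thesis
    by (rule holomorphic_transform) (simp add: der_contraction_Suc[OF assms])
qed

text \<open>The Taylor coefficients of a contraction are contractions of higher derivatives at the
  base point. This is why the expansion coefficients are again fields, built from
  \<open>Der (Suc n) 0\<close>.\<close>

lemma der_contraction_fps:
  assumes "local_chart D c" "local_chart D d" "y \<in> coords d" "z \<in> off_node c (d, y, u)"
  shows "(\<lambda>\<epsilon>. der_contraction G c (z + \<epsilon>) (Suc j) (d, y, u)) has_fps_expansion
           Abs_fps (\<lambda>n. der_contraction G c z (Suc (j + n)) (d, y, u) / fact n)"
proof -
  let ?X = "off_node c (d, y, u)" and ?f = "\<lambda>j x. der_contraction G c x (Suc j) (d, y, u)"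
  have X: "open ?X"
    by (rule open_off_node[OF assms(1-3)])
  have "?f j analytic_on {z}"
    using der_contraction_holomorphic[OF assms(1-3), of j u] X assms(4) analytic_at by blast
  hence "(\<lambda>\<epsilon>. ?f j (z + \<epsilon>)) has_fps_expansion fps_expansion (?f j) z"
    by (rule analytic_at_imp_has_fps_expansion)
  moreover have "(deriv ^^ n) (?f j) z = ?f (j + n) z" for n
  proof -
    have "(deriv ^^ n) (?f j) z = (deriv ^^ n) ((deriv ^^ j) (?f 0)) z"
      by (rule higher_deriv_cong_ev)
         (auto intro!: eventually_mono[OF eventually_nhds_in_open[OF X assms(4)]]
            simp: der_contraction_Suc[OF assms(1-3), of _ u j])
    also have "\<dots> = (deriv ^^ (n + j)) (?f 0) z"
      by (simp add: funpow_add)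
    also have "\<dots> = ?f (j + n) z"
      by (simp add: der_contraction_Suc[OF assms, of "j + n"] add.commute)
    finally show ?thesis .
  qed
  ultimately show ?thesis
    by (simp add: fps_expansion_def)
qed

lemma der_contraction_WExp:
  assumes "local_chart D c" "x \<in> coords c" "y \<in> coords c" "x \<noteq> y"
  shows "der_contraction G c x 1 (c, y, WExp \<alpha>) =
     \<alpha> * (deriv (in_chart w c) x / (in_chart w c x - cnj (in_chart w c y)) -
          deriv (in_chart w c) x / (in_chart w c x - in_chart w c y))"
proof -
  have "x \<in> off_node c (c, y, WExp \<alpha>)"
    using assms by (simp add: off_node_def point_of_inj)
  hence "der_contraction G c x 1 (c, y, WExp \<alpha>) =
    \<alpha> * (deriv (in_chart w c) x / (in_chart w c y - in_chart w c x) -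
       deriv (in_chart w c) x / (cnj (in_chart w c y) - in_chart w c x))"
    by (simp add: der_contraction_1 contraction_weight_def dz_green_partial_00[OF assms(1,1,3)])
  moreover have e: "deriv (in_chart w c) x / (a - in_chart w c x) = - (deriv (in_chart w c) x /
      (in_chart w c x - a))" for a
    by (metis minus_diff_eq minus_divide_right)
  ultimately show ?thesis
    by (simp only: e) (simp add: right_diff_distrib)
qed

text \<open>After the inner derivative the image term is antiholomorphic in \<open>x\<close>; the
  outer \<open>dz\<close> kills it and only the singular term remains.\<close>

lemma pair_expectation_11:
  assumes "local_chart D c" "x \<in> coords c" "y \<in> coords c" "x \<noteq> y"
  shows "pair_expectation G (c, x, 1, 0) (c, y, 1, 0) =
     - (deriv (in_chart w c) x * deriv (in_chart w c) y / (in_chart w c x - in_chart w c y)\<^sup>2)"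
proof -
  let ?W = "in_chart w c" and ?u = "Der 1 0"
  let ?X = "off_node c (c, y, ?u)"
  have x: "x \<in> ?X"
    using assms by (simp add: off_node_def point_of_inj)
  have X: "open ?X"
    using assms by (intro open_off_node)
  define k where "k = deriv ?W y"
  have ne: "?W x' - ?W y \<noteq> 0" "cnj (?W x') - ?W y \<noteq> 0" if "x' \<in> ?X" for x'
    using that in_chart_neq_cnj[OF assms(1,1) _ assms(3), of x'] unfolding off_node_eq[OF assms(1,1,3)]
    by (auto simp: complex_eq_iff)
  have f1: "green_partial c 1 0 y (point_of c x') = (k / (?W x' - ?W y) - k / (cnj (?W x') - ?W y)) / 2"
    if x': "x' \<in> ?X" for x'
  proof -
    have "green_partial c 1 0 y (point_of c x') =
        dz (\<lambda>y. of_real (half_plane_green (in_chart w c x') (in_chart w c y))) y"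
      using green_partial_eq[OF assms(1,1,3) x', of 1 0] by simp
    also have "\<dots> = (k / (?W x' - ?W y) - k / (cnj (?W x') - ?W y)) / 2"
      unfolding k_def using ne[OF x'] assms
      by (intro half_plane_green_derivative(2) holomorphic_derivI[OF in_chart_holomorphic open_coords]) auto
    finally show ?thesis .
  qed
  have f2: "(k / A - k / B) / 2 = k / 2 / A + cnj (- cnj k / 2 / cnj B)" for A B
    by (simp add: diff_divide_distrib mult.commute)
  have "dz (\<lambda>x. green_partial c 1 0 y (point_of c x)) x =
      dz (\<lambda>x'. k / 2 / (?W x' - ?W y) +
              cnj (- cnj k / 2 / cnj (cnj (?W x') - ?W y))) x"
    by (intro dz_cong_open[OF X x]) (simp only: f1 f2)
  also have "(\<lambda>x'. k / 2 / (?W x' - ?W y) +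
              cnj (- cnj k / 2 / cnj (cnj (?W x') - ?W y))) =
      (\<lambda>x'. k / 2 / (?W x' - ?W y) + cnj (- cnj k / 2 / (?W x' - cnj (?W y))))"
    by simp
  also have "dz (\<lambda>x'. k / 2 / (?W x' - ?W y) + cnj (- cnj k / 2 / (?W x' - cnj (?W y)))) x =
      - (k / 2 * deriv ?W x / (?W x - ?W y)\<^sup>2)"
  proof -
    have W: "(?W has_field_derivative deriv ?W x) (at x)"
      using assms by (intro holomorphic_derivI[OF in_chart_holomorphic open_coords]) auto
    have ne2: "?W x - cnj (?W y) \<noteq> 0"
      using in_chart_neq_cnj[OF assms(1,1,2,3)] by simp
    have pole: "((\<lambda>x'. r / (?W x' - a)) has_field_derivative - (r * deriv ?W x / (?W x -
        a)\<^sup>2)) (at x)"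
      if "?W x - a \<noteq> 0" for r a
      using W that by (auto intro!: derivative_eq_intros simp: power2_eq_square)
    note f = pole[OF ne(1)[OF x], of "k / 2"] and g = pole[OF ne2, of "- cnj k / 2"]
    have diff: "(\<lambda>x'. k / 2 / (?W x' - ?W y)) differentiable (at x)"
      "(\<lambda>x'. - cnj k / 2 / (?W x' - cnj (?W y))) differentiable (at x)"
      using f g by (auto simp: differentiable_def has_field_derivative_def)
    show ?thesis
      by (subst dz_add[OF diff(1) differentiable_cnj[OF diff(2)]])
         (simp only: dz_cnj[OF diff(2)] dz_holomorphic[OF f] dzbar_holomorphic[OF g], simp)
  qed
  finally have "dz (\<lambda>x. green_partial c 1 0 y (point_of c x)) x = - (k / 2 * deriv ?W x /
      (?W x - ?W y)\<^sup>2)" .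
  thus ?thesis
    unfolding pair_expectation_green_partial by (simp add: k_def)
qed

end

subsection \<open>Dependence on the position of the derivatives\<close>

lemma has_fps_expansion_wsum1:
  assumes "\<And>x. x \<in> set R \<Longrightarrow> (\<lambda>\<epsilon>. g \<epsilon> (snd x))
      has_fps_expansion Abs_fps (\<lambda>n. g' n (snd x))"
  shows "(\<lambda>\<epsilon>. wsum1 G (g \<epsilon>) P R) has_fps_expansion Abs_fps (\<lambda>n.
      wsum1 G (g' n) P R)"
proof -
  have "(\<lambda>\<epsilon>. wsum1 G (g \<epsilon>) P R) has_fps_expansion
      (\<Sum>p<length R. Abs_fps (\<lambda>n. g' n (snd (R ! p))) * fps_const (tagged_wick G (P @
          contract p R)))"
    unfolding wsum1_def using assms
    by (intro has_fps_expansion_sum has_fps_expansion_mult has_fps_expansion_const) auto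
  also have "(\<Sum>p<length R. Abs_fps (\<lambda>n. g' n (snd (R ! p))) * fps_const (tagged_wick G
      (P @ contract p R))) =
      Abs_fps (\<lambda>n. wsum1 G (g' n) P R)"
    by (intro fps_ext) (simp add: wsum1_def fps_sum_nth)
  finally show ?thesis .
qed

lemma has_fps_expansion_wsum2:
  assumes "\<And>x. x \<in> set R \<Longrightarrow> (\<lambda>\<epsilon>. g \<epsilon> (snd x))
      has_fps_expansion Abs_fps (\<lambda>n. g' n (snd x))"
    "\<And>x. x \<in> set R \<Longrightarrow> (\<lambda>\<epsilon>. h \<epsilon> (snd x))
        has_fps_expansion Abs_fps (\<lambda>n. h' n (snd x))"
  shows "(\<lambda>\<epsilon>. wsum2 G (g \<epsilon>) (h \<epsilon>) P R) has_fps_expansion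
           Abs_fps (\<lambda>n. \<Sum>i\<le>n. wsum2 G (g' i) (h' (n - i)) P R)"
proof -
  have "(\<lambda>\<epsilon>. wsum1 G (h \<epsilon>) P (contract p R)) has_fps_expansion Abs_fps
      (\<lambda>n. wsum1 G (h' n) P (contract p R))" for p
    using assms(2) set_contract[of p R] by (intro has_fps_expansion_wsum1) blast
  hence "(\<lambda>\<epsilon>. wsum2 G (g \<epsilon>) (h \<epsilon>) P R) has_fps_expansion
      (\<Sum>p<length R. Abs_fps (\<lambda>n. g' n (snd (R ! p))) * Abs_fps (\<lambda>n. wsum1 G (h'
          n) P (contract p R)))"
    unfolding wsum2_def using assms(1)
    by (intro has_fps_expansion_sum has_fps_expansion_mult) auto
  also have "(\<Sum>p<length R. Abs_fps (\<lambda>n. g' n (snd (R ! p))) * Abs_fps (\<lambda>n.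
      wsum1 G (h' n) P (contract p R))) =
      Abs_fps (\<lambda>n. \<Sum>i\<le>n. wsum2 G (g' i) (h' (n - i)) P R)"
    by (intro fps_ext) (simp add: wsum2_def fps_sum_nth fps_mult_nth atMost_atLeast0 sum.swap[of _
        "{..<length R}"])
  finally show ?thesis .
qed

lemma holomorphic_on_wsum1:
  assumes "\<And>x. x \<in> set R \<Longrightarrow> (\<lambda>\<epsilon>. g \<epsilon> (snd x))
      holomorphic_on A"
  shows "(\<lambda>\<epsilon>. wsum1 G (g \<epsilon>) P R) holomorphic_on A"
  unfolding wsum1_def using assms by (intro holomorphic_intros) auto

lemma holomorphic_on_wsum2:
  assumes "\<And>x. x \<in> set R \<Longrightarrow> (\<lambda>\<epsilon>. g \<epsilon> (snd x))
      holomorphic_on A"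
    "\<And>x. x \<in> set R \<Longrightarrow> (\<lambda>\<epsilon>. h \<epsilon> (snd x)) holomorphic_on A"
  shows "(\<lambda>\<epsilon>. wsum2 G (g \<epsilon>) (h \<epsilon>) P R) holomorphic_on A"
proof -
  have "(\<lambda>\<epsilon>. wsum1 G (h \<epsilon>) P (contract p R)) holomorphic_on A" for p
    using assms(2) set_contract[of p R] by (intro holomorphic_on_wsum1) blast
  thus ?thesis
    unfolding wsum2_def using assms(1) by (intro holomorphic_intros) auto
qed

lemma wsum1_divide: "wsum1 G (\<lambda>u. g u / s) P R = wsum1 G g P R / s"
  by (simp add: wsum1_def sum_divide_distrib)

lemma wsum2_divide: "wsum2 G (\<lambda>u. g u / s) (\<lambda>u. h u / t) P R = wsum2 G g h P R / (s * t)"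
  by (simp add: wsum2_def wsum1_divide sum_divide_distrib)

section \<open>Operator product expansions\<close>

text \<open>Poles enter below as a power series divided by a power of the coordinate difference.
  Agreement is demanded on a punctured neighbourhood only, which leaves the value at coinciding
  points free.\<close>

lemma has_laurent_expansion_of_fps:
  assumes "f has_fps_expansion P" "\<forall>\<^sub>F \<epsilon> in at 0. g \<epsilon> = f \<epsilon>
      / \<epsilon> ^ k"
  shows "g has_laurent_expansion fls_shift (int k) (fps_to_fls P)"
proof -
  have "(\<lambda>\<epsilon>. f \<epsilon> * \<epsilon> powi (- int k)) has_laurent_expansion
      fls_shift (int k) (fps_to_fls P)"
    by (intro has_laurent_expansion_shift' has_laurent_expansion_fps assms(1))
  moreover have ev: "\<forall>\<^sub>F \<epsilon> in at 0. f \<epsilon> * \<epsilon> powi (- int k)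
      = g \<epsilon>"
    using assms(2) by eventually_elim (simp add: power_int_minus divide_inverse)
  ultimately show ?thesis
    by (simp only: has_laurent_expansion_cong[OF ev refl])
qed

lemma eventually_at_0_shift:
  fixes z :: complex
  assumes "open U" "z \<in> U"
  shows "\<forall>\<^sub>F \<epsilon> in at 0. z + \<epsilon> \<in> U \<and> \<epsilon> \<noteq> 0"
proof -
  have "((\<lambda>\<epsilon>. z + \<epsilon>) \<longlongrightarrow> z + 0) (at 0)"
    by (intro tendsto_intros)
  hence "\<forall>\<^sub>F \<epsilon> in at 0. z + \<epsilon> \<in> U"
    using assms by (auto simp: tendsto_def)
  thus ?thesis
    by (simp add: eventually_conj eventually_neq_at_within)
qed

lemma finite_all_nodes: "finite (all_nodes Zs)"
  by (auto simp: all_nodes_def nodes_def)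

lemma functional_in_at_point:
  "local_chart D c \<Longrightarrow> z \<in> coords c \<Longrightarrow> functional_in D (at_point X c z)"
  by (auto simp: functional_in_def at_point_def)

lemma nodes_at_point: "nodes (at_point X c z) \<subseteq> {point_of c z}"
  by (auto simp: nodes_def at_point_def)

lemma test_product_Cons:
  assumes "local_chart D c" "z \<in> coords c" "test_product D Zs" "point_of c z \<notin> all_nodes Zs"
  shows "test_product D (at_point X c z # Zs)"
  using assms nodes_at_point[of X c z] functional_in_at_point[OF assms(1,2)]
  by (auto simp: test_product_def all_nodes_def)

lemma all_nodes_Cons: "all_nodes (Z # Zs) = nodes Z \<union> all_nodes Zs"
  by (simp add: all_nodes_def)

lemma field_eqI:
  assumes "\<And>c z ms. local_chart D c \<Longrightarrow> z \<in> coords c \<Longrightarrow>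
      good_monomials D (point_of c z) ms \<Longrightarrow>
             mono_corr G (at_point X c z) ms = mono_corr G (at_point Y c z) ms"
  shows "field_eq D G X Y"
  unfolding field_eq_def
proof safe
  fix c1 c2 z Zs
  assume *: "local_chart D (c1, c2)" "z \<in> coords (c1, c2)" "test_product D Zs"
    "point_of (c1, c2) z \<notin> all_nodes Zs"
  show "correlation G (at_point X (c1, c2) z # Zs) = correlation G (at_point Y (c1, c2) z # Zs)"
    unfolding correlation_eq_mono_corr
    by (intro arg_cong[of _ _ sum_list] map_cong refl arg_cong2[of _ _ _ _ "(*)"]
          assms[OF *(1,2) good_monomials_product_lists[OF *(3,4)]])
qed

lemma field_eqD:
  assumes "field_eq D G X Y" "local_chart D c" "z \<in> coords c" "test_product D Zs"
    "point_of c z \<notin> all_nodes Zs"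
  shows "correlation G (at_point X c z # Zs) = correlation G (at_point Y c z # Zs)"
  using assms unfolding field_eq_def by blast

lemma field_eq_sym: "field_eq D G X Y \<Longrightarrow> field_eq D G Y X"
  unfolding field_eq_def by metis

lemma field_eq_trans: "field_eq D G X Y \<Longrightarrow> field_eq D G Y Z \<Longrightarrow> field_eq D G X Z"
  unfolding field_eq_def by metis

lemma field_eq_add:
  "field_eq D G X X' \<Longrightarrow> field_eq D G Y Y' \<Longrightarrow> field_eq D G (field_add X
      Y) (field_add X' Y')"
  unfolding field_eq_def at_point_add correlation_append by metis

lemma field_eq_scale: "field_eq D G X X' \<Longrightarrow> field_eq D G (field_scale s X) (field_scale s X')"
  unfolding field_eq_def correlation_scale by metis

text \<open>Two expansions of the same pair are Laurent expansions of the same function, so their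
  coefficients agree in every correlation and the chosen value may be exchanged for an explicit
  one.\<close>

lemma ope_product_field_eq:
  assumes "ope D G X Y C"
  shows "field_eq D G (ope_product D G X Y) (C 0)"
  unfolding field_eq_def
proof (intro allI impI)
  fix c z Zs
  assume *: "local_chart D c \<and> z \<in> coords c \<and> test_product D Zs \<and> point_of c z
      \<notin> all_nodes Zs"
  let ?f = "\<lambda>\<epsilon>. correlation G (at_point X c (z + \<epsilon>) # at_point Y c z # Zs)"
  have **: "\<exists>F. ?f has_laurent_expansion F \<and> (\<forall>n. fls_nth F n = correlation G
      (at_point (C n) c z # Zs))"
    if "ope D G X Y C" for C
    using that * unfolding ope_def by blast
  have "ope D G X Y (SOME C. ope D G X Y C)"
    using assms by (rule someI[of "ope D G X Y" C])
  then obtain F where F: "?f has_laurent_expansion F"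
    "\<And>n. fls_nth F n = correlation G (at_point ((SOME C. ope D G X Y C) n) c z # Zs)"
    using ** by blast
  obtain F' where F': "?f has_laurent_expansion F'"
    "\<And>n. fls_nth F' n = correlation G (at_point (C n) c z # Zs)"
    using **[OF assms] by blast
  have "F = F'"
    using F(1) F'(1) by (rule has_laurent_expansion_unique)
  thus "correlation G (at_point (ope_product D G X Y) c z # Zs) = correlation G (at_point (C 0) c z # Zs)"
    unfolding ope_product_def using F(2)[of 0] F'(2)[of 0] by simp
qed

lemma has_laurent_expansion_sum_list:
  assumes "\<And>t. t \<in> set ts \<Longrightarrow> \<exists>F. f t has_laurent_expansion F \<and>
      (\<forall>n. fls_nth F n = k t n)"
  shows "\<exists>F. (\<lambda>\<epsilon>. \<Sum>t\<leftarrow>ts. s t * f t \<epsilon>)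
      has_laurent_expansion F \<and>
             (\<forall>n. fls_nth F n = (\<Sum>t\<leftarrow>ts. s t * k t n))"
  using assms
proof (induction ts)
  case Nil
  then show ?case
    by (intro exI[of _ 0]) simp
next
  case (Cons t ts)
  have "\<exists>F. f t has_laurent_expansion F \<and> (\<forall>n. fls_nth F n = k t n)"
    by (rule Cons.prems) simp
  then obtain F where F1: "f t has_laurent_expansion F" "\<And>n. fls_nth F n = k t n"
    by blast
  have "\<exists>F. (\<lambda>\<epsilon>. \<Sum>t\<leftarrow>ts. s t * f t \<epsilon>)
      has_laurent_expansion F \<and>
             (\<forall>n. fls_nth F n = (\<Sum>t\<leftarrow>ts. s t * k t n))"
    by (rule Cons.IH, rule Cons.prems) simp
  then obtain F' where F2: "(\<lambda>\<epsilon>. \<Sum>t\<leftarrow>ts. s t * f t \<epsilon>)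
      has_laurent_expansion F'"
    "\<And>n. fls_nth F' n = (\<Sum>t\<leftarrow>ts. s t * k t n)"
    by blast
  note F = F1 F2
  have "(\<lambda>\<epsilon>. s t * f t \<epsilon> + (\<Sum>t\<leftarrow>ts. s t * f t \<epsilon>))
      has_laurent_expansion (fls_const (s t) * F + F')"
    using F by (intro has_laurent_expansion_add has_laurent_expansion_cmult_left)
  then show ?case
    using F by (intro exI[of _ "fls_const (s t) * F + F'"]) simp
qed

lemma opeI:
  assumes "holomorphic_field D G X" "\<And>n. fock_space_field D (C n)"
    "\<And>c z ms. local_chart D c \<Longrightarrow> z \<in> coords c \<Longrightarrow>
        good_monomials D (point_of c z) ms \<Longrightarrow>
       \<exists>F. (\<lambda>\<epsilon>. mono_corr2 G (at_point X c (z + \<epsilon>)) (at_point Y c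
           z) ms) has_laurent_expansion F \<and>
           (\<forall>n. fls_nth F n = mono_corr G (at_point (C n) c z) ms)"
  shows "ope D G X Y C"
  unfolding ope_def
proof (intro conjI allI impI assms(1,2))
  fix c z Zs
  assume "local_chart D c \<and> z \<in> coords c \<and> test_product D Zs \<and> point_of c z
      \<notin> all_nodes Zs"
  hence *: "local_chart D c" "z \<in> coords c" "test_product D Zs" "point_of c z \<notin> all_nodes Zs"
    by auto
  show "\<exists>F. (\<lambda>\<epsilon>. correlation G (at_point X c (z + \<epsilon>) # at_point Y
      c z # Zs)) has_laurent_expansion F \<and>
          (\<forall>n. fls_nth F n = correlation G (at_point (C n) c z # Zs))"
    unfolding correlation_eq_mono_corr2 correlation_eq_mono_corr[where Fs = Zs]
    by (intro has_laurent_expansion_sum_list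
          assms(3)[OF *(1,2) good_monomials_product_lists[OF *(3,4)]])
qed

context green_domain
begin

lemma finite_coords_nodes:
  assumes "local_chart D c" "finite N"
  shows "finite {x \<in> coords c. point_of c x \<in> N}"
proof (rule finite_imageD)
  show "finite (point_of c ` {x \<in> coords c. point_of c x \<in> N})"
    using assms(2) by (rule finite_subset[rotated]) auto
  show "inj_on (point_of c) {x \<in> coords c. point_of c x \<in> N}"
    using point_of_inj[OF assms(1)] by (auto simp: inj_on_def)
qed

lemma open_coords_off_nodes:
  assumes "local_chart D c"
  shows "open {x \<in> coords c. point_of c x \<notin> all_nodes Zs}"
proof -
  have "open (coords c - {x \<in> coords c. point_of c x \<in> all_nodes Zs})"
    using open_coords[OF assms] finite_coords_nodes[OF assms finite_all_nodes, of Zs]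
    by (intro open_Diff finite_imp_closed)
  also have "coords c - {x \<in> coords c. point_of c x \<in> all_nodes Zs} =
      {x \<in> coords c. point_of c x \<notin> all_nodes Zs}"
    by blast
  finally show ?thesis .
qed

lemma holomorphic_field_cong:
  assumes "field_eq D G X X'" "holomorphic_field D G X"
  shows "holomorphic_field D G X'"
  unfolding holomorphic_field_def
proof (intro allI impI)
  fix c Zs
  assume *: "local_chart D c \<and> test_product D Zs"
  hence "(\<lambda>z. correlation G (at_point X c z # Zs)) holomorphic_on {z \<in> coords c.
      point_of c z \<notin> all_nodes Zs}"
    using assms(2) unfolding holomorphic_field_def by blast
  thus "(\<lambda>z. correlation G (at_point X' c z # Zs)) holomorphic_on {z \<in> coords c.
      point_of c z \<notin> all_nodes Zs}"
    by (rule holomorphic_transform) (use * field_eqD[OF assms(1)] in blast)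
qed

text \<open>For small nonzero \<epsilon> the point at \<open>z + \<epsilon>\<close> differs from the
  node of \<open>Y\<close>, so \<open>Y\<close> can be counted among the test functionals and the
  field equality applies.\<close>

lemma ope_cong_left:
  assumes "field_eq D G X X'" "ope D G X Y C"
  shows "ope D G X' Y C"
  unfolding ope_def
proof (intro conjI allI impI)
  show "holomorphic_field D G X'"
    using assms holomorphic_field_cong unfolding ope_def by blast
  show "fock_space_field D (C n)" for n
    using assms(2) unfolding ope_def by blast
  fix c z Zs
  assume *: "local_chart D c \<and> z \<in> coords c \<and> test_product D Zs \<and> point_of c z
      \<notin> all_nodes Zs"
  let ?f = "\<lambda>X \<epsilon>. correlation G (at_point X c (z + \<epsilon>) # at_point Y c z # Zs)"
  let ?U = "{x \<in> coords c. point_of c x \<notin> all_nodes Zs}"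
  obtain F where F: "?f X has_laurent_expansion F"
    "\<And>n. fls_nth F n = correlation G (at_point (C n) c z # Zs)"
    using assms(2) * unfolding ope_def by metis
  have test: "test_product D (at_point Y c z # Zs)"
    using * by (intro test_product_Cons) auto
  have "\<forall>\<^sub>F \<epsilon> in at 0. z + \<epsilon> \<in> ?U \<and> \<epsilon> \<noteq> 0"
    using * by (intro eventually_at_0_shift open_coords_off_nodes) auto
  hence "\<forall>\<^sub>F \<epsilon> in at 0. ?f X \<epsilon> = ?f X' \<epsilon>"
  proof eventually_elim
    case (elim \<epsilon>)
    have "point_of c (z + \<epsilon>) \<noteq> point_of c z"
      using elim * by (subst point_of_inj) auto
    hence "point_of c (z + \<epsilon>) \<notin> all_nodes (at_point Y c z # Zs)"
      using elim nodes_at_point[of Y c z] by (auto simp: all_nodes_Cons)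
    thus ?case
      using elim * by (intro field_eqD[OF assms(1) _ _ test]) auto
  qed
  hence "?f X has_laurent_expansion F \<longleftrightarrow> ?f X' has_laurent_expansion F"
    by (rule has_laurent_expansion_cong) (rule refl)
  hence "?f X' has_laurent_expansion F"
    using F(1) by blast
  thus "\<exists>F. ?f X' has_laurent_expansion F \<and> (\<forall>n. fls_nth F n = correlation G
      (at_point (C n) c z # Zs))"
    using F(2) by blast
qed

lemma holomorphic_fieldI:
  assumes "\<And>c ms U. local_chart D c \<Longrightarrow> U \<subseteq> coords c \<Longrightarrow>
      open U \<Longrightarrow>
     (\<And>z. z \<in> U \<Longrightarrow> good_monomials D (point_of c z) ms) \<Longrightarrow>
     (\<lambda>z. mono_corr G (at_point X c z) ms) holomorphic_on U"
  shows "holomorphic_field D G X"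
  unfolding holomorphic_field_def
proof (intro allI impI)
  fix c Zs
  assume "local_chart D c \<and> test_product D Zs"
  hence *: "local_chart D c" "test_product D Zs"
    by auto
  let ?U = "{z \<in> coords c. point_of c z \<notin> all_nodes Zs}"
  have "(\<lambda>z. mono_corr G (at_point X c z) (map snd ts)) holomorphic_on ?U"
    if "ts \<in> set (product_lists Zs)" for ts
    using * that open_coords_off_nodes[OF *(1), of Zs]
    by (intro assms) (auto intro: good_monomials_product_lists)
  hence "(\<lambda>z. \<Sum>ts\<leftarrow>tss. prod_list (map fst ts) * mono_corr G (at_point X c z)
      (map snd ts)) holomorphic_on ?U"
    if "set tss \<subseteq> set (product_lists Zs)" for tss
    using that by (induction tss) (auto intro!: holomorphic_intros)
  thus "(\<lambda>z. correlation G (at_point X c z # Zs)) holomorphic_on ?U"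
    unfolding correlation_eq_mono_corr by blast
qed

lemma good_monomials_off_node:
  assumes "good_monomials D (point_of c z) ms" "z \<in> coords c" "p \<in> set (tagged_from 2 ms)"
  obtains d y u where "snd p = (d, y, u)" "local_chart D d" "y \<in> coords d" "z \<in> off_node c (d, y, u)"
proof -
  have "snd p \<in> (\<Union>m\<in>set ms. set m)"
    using assms(3) snd_tagged_from[of 2 ms] by blast
  then obtain m where m: "m \<in> set ms" "snd p \<in> set m"
    by blast
  obtain d y u where p: "snd p = (d, y, u)"
    by (cases "snd p")
  have "local_chart D d \<and> y \<in> coords d \<and> point_of d y \<noteq> point_of c z"
    using assms(1) m unfolding good_monomials_def p by fastforce
  thus ?thesis
    using that[OF p] assms(2) by (auto simp: off_node_def)
qed

lemma der_contraction_fps_tagged: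
  assumes "local_chart D c" "z \<in> coords c" "good_monomials D (point_of c z) ms"
    "p \<in> set (tagged_from 2 ms)"
  shows "(\<lambda>\<epsilon>. der_contraction G c (z + \<epsilon>) (Suc j) (snd p)) has_fps_expansion
           Abs_fps (\<lambda>n. der_contraction G c z (Suc (j + n)) (snd p) / fact n)"
proof -
  obtain d y u where "snd p = (d, y, u)" "local_chart D d" "y \<in> coords d" "z \<in> off_node c (d, y, u)"
    using good_monomials_off_node[OF assms(3,2,4)] .
  thus ?thesis
    using der_contraction_fps[OF assms(1)] by simp
qed

lemma der_contraction_holomorphic_tagged:
  assumes "local_chart D c" "U \<subseteq> coords c" "\<And>z. z \<in> U \<Longrightarrow>
      good_monomials D (point_of c z) ms"
    "p \<in> set (tagged_from 2 ms)"
  shows "(\<lambda>x. der_contraction G c x (Suc j) (snd p)) holomorphic_on U"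
proof (cases "U = {}")
  case False
  \<comment> \<open>A point of \<open>U\<close> reveals that the node of the factor lies in a local
    chart.\<close>
  then obtain z0 where z0: "z0 \<in> U"
    by blast
  obtain d y u where p: "snd p = (d, y, u)" "local_chart D d" "y \<in> coords d"
    using good_monomials_off_node[OF assms(3)[OF z0] subsetD[OF assms(2) z0] assms(4)] .
  have "U \<subseteq> off_node c (d, y, u)"
  proof
    fix z assume z: "z \<in> U"
    obtain d' y' u' where "snd p = (d', y', u')" "z \<in> off_node c (d', y', u')"
      using good_monomials_off_node[OF assms(3)[OF z] subsetD[OF assms(2) z] assms(4)] .
    thus "z \<in> off_node c (d, y, u)"
      using p(1) by simp
  qed
  thus ?thesis
    unfolding p(1) using der_contraction_holomorphic[OF assms(1) p(2,3)] holomorphic_on_subset by blast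
qed (simp add: holomorphic_on_def)

end

section \<open>Expansions of the uniformizing map\<close>

lemma fps_mult_nth_2:
  "fps_nth (f * g) 2 = fps_nth f 0 * fps_nth g 2 + fps_nth f 1 * fps_nth g 1 + fps_nth f 2 * fps_nth g 0"
  by (simp add: fps_mult_nth numeral_2_eq_2)

locale uniformizer =
  fixes U :: "complex set" and W :: "complex \<Rightarrow> complex"
  assumes open_U: "open U" and holo: "W holomorphic_on U" and inj: "inj_on W U"
    and Im_pos: "\<And>z. z \<in> U \<Longrightarrow> Im (W z) > 0"
begin

definition pre_schwarzian :: "complex \<Rightarrow> complex" where
  "pre_schwarzian z = deriv (deriv W) z / deriv W z"

definition image_pole :: "complex \<Rightarrow> complex" where
  "image_pole z = deriv W z / (W z - cnj (W z))"

definition deriv_fps :: "complex \<Rightarrow> complex fps" where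
  "deriv_fps z = fps_expansion (deriv W) z"

text \<open>The series of \<open>(W (z + \<epsilon>) - W z) / \<epsilon>\<close>: the shift drops
  the constant term \<open>W z\<close> and divides by the variable.\<close>

definition quotient_fps :: "complex \<Rightarrow> complex fps" where
  "quotient_fps z = fps_shift 1 (fps_expansion W z)"

definition image_fps :: "complex \<Rightarrow> complex fps" where
  "image_fps z = fps_expansion W z - fps_const (cnj (W z))"

text \<open>\<epsilon> times the kernel that a current at \<open>z + \<epsilon>\<close> contributes
  when contracted with an exponential at \<open>z\<close>, up to the factor \<alpha>. The first
  summand is the regular image term, the second carries the simple pole.\<close>

definition pole_fps :: "complex \<Rightarrow> complex fps" where
  "pole_fps z = fps_X * (deriv_fps z * inverse (image_fps z)) - deriv_fps z * inverse (quotient_fps z)"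

text \<open>\<open>\<epsilon>\<^sup>2\<close> times the expectation of two currents at
  \<open>z + \<epsilon>\<close> and \<open>z\<close>.\<close>

definition dpole_fps :: "complex \<Rightarrow> complex fps" where
  "dpole_fps z = - (fps_const (deriv W z) * deriv_fps z * inverse (quotient_fps z * quotient_fps z))"

lemma deriv_nz: "z \<in> U \<Longrightarrow> deriv W z \<noteq> 0"
  by (rule holomorphic_injective_imp_regular[OF holo open_U inj])

lemma holo_deriv: "deriv W holomorphic_on U"
  by (rule holomorphic_deriv[OF holo open_U])

lemma holo_deriv2: "deriv (deriv W) holomorphic_on U"
  by (rule holomorphic_deriv[OF holo_deriv open_U])

lemma holo_pre_schwarzian: "pre_schwarzian holomorphic_on U"
  unfolding pre_schwarzian_def using deriv_nz by (intro holomorphic_intros holo_deriv holo_deriv2) auto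

lemma cnj_neq: "z \<in> U \<Longrightarrow> x \<in> U \<Longrightarrow> W x - cnj (W z) \<noteq> 0"
  using Im_pos[of z] Im_pos[of x] by (auto simp: complex_eq_iff)

lemma quotient_fps_0: "z \<in> U \<Longrightarrow> fps_nth (quotient_fps z) 0 \<noteq> 0"
  using deriv_nz by (simp add: quotient_fps_def fps_expansion_def)

lemma image_fps_0: "z \<in> U \<Longrightarrow> fps_nth (image_fps z) 0 \<noteq> 0"
  using cnj_neq by (simp add: image_fps_def fps_expansion_def)

lemma smooth_W: "smooth_on U W" "smooth_on U (deriv W)" "smooth_on U pre_schwarzian"
  by (intro smooth_on_holomorphic open_U holo holo_deriv holo_pre_schwarzian)+

lemma smooth_fps_pole: "smooth_fps U pole_fps"
proof -
  have E: "smooth_fps U (fps_expansion W)" "smooth_fps U deriv_fps"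
    unfolding deriv_fps_def by (intro smooth_fps_expansion open_U holo holo_deriv)+
  have "smooth_fps U quotient_fps"
    using E(1) by (auto simp: smooth_fps_def quotient_fps_def)
  moreover have "smooth_fps U image_fps"
    unfolding image_fps_def by (intro smooth_fps_diff smooth_fps_fps_const smooth_on_cnj open_U E smooth_W)
  ultimately show ?thesis
    unfolding pole_fps_def using quotient_fps_0 image_fps_0
    by (intro smooth_fps_diff smooth_fps_mult smooth_fps_inverse smooth_fps_const open_U E)
qed

lemma smooth_fps_dpole: "smooth_fps U dpole_fps"
proof -
  have E: "smooth_fps U (fps_expansion W)" "smooth_fps U deriv_fps"
    unfolding deriv_fps_def by (intro smooth_fps_expansion open_U holo holo_deriv)+
  have "smooth_fps U quotient_fps"
    using E(1) by (auto simp: smooth_fps_def quotient_fps_def)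
  thus ?thesis
    unfolding dpole_fps_def using quotient_fps_0
    by (intro smooth_fps_minus smooth_fps_mult smooth_fps_inverse smooth_fps_fps_const open_U E smooth_W) auto
qed

lemma fps_holo: "f holomorphic_on U \<Longrightarrow> z \<in> U \<Longrightarrow>
    (\<lambda>\<epsilon>. f (z + \<epsilon>)) has_fps_expansion fps_expansion f z"
  by (rule analytic_at_imp_has_fps_expansion) (use open_U analytic_at in blast)

definition quotient_fun :: "complex \<Rightarrow> complex \<Rightarrow> complex" where
  "quotient_fun z \<epsilon> = (if \<epsilon> = 0 then deriv W z else (W (z + \<epsilon>) - W z) /
      \<epsilon>)"

lemma quotient_fun_fps:
  assumes "z \<in> U"
  shows "quotient_fun z has_fps_expansion quotient_fps z"
proof -
  let ?F = "fps_expansion W z - fps_const (W z)"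
  have "(\<lambda>\<epsilon>. W (z + \<epsilon>) - W z) has_fps_expansion ?F"
    by (intro has_fps_expansion_diff fps_holo has_fps_expansion_const holo assms)
  moreover have "1 \<le> subdegree ?F"
  proof (rule subdegree_geI)
    have "fps_nth ?F 1 \<noteq> 0"
      using deriv_nz[OF assms] by (simp add: fps_expansion_def)
    thus "?F \<noteq> 0"
      by (metis fps_zero_nth)
  qed (simp add: fps_expansion_def)
  moreover have "deriv W z = fps_nth ?F 1"
    by (simp add: fps_expansion_def)
  ultimately have "(\<lambda>\<epsilon>. if \<epsilon> = 0 then deriv W z else (W (z + \<epsilon>) -
      W z) / \<epsilon> ^ 1) has_fps_expansion fps_shift 1 ?F"
    by (rule has_fps_expansion_shift)
  moreover have "fps_shift 1 ?F = quotient_fps z"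
    unfolding quotient_fps_def by (intro fps_ext) simp
  ultimately show ?thesis
    unfolding quotient_fun_def by (simp cong: if_cong)
qed

definition pole_fun :: "complex \<Rightarrow> complex \<Rightarrow> complex" where
  "pole_fun z \<epsilon> = \<epsilon> * (deriv W (z + \<epsilon>) * inverse (W (z + \<epsilon>) -
      cnj (W z))) -
                  deriv W (z + \<epsilon>) * inverse (quotient_fun z \<epsilon>)"

lemma pole_fun_fps: "z \<in> U \<Longrightarrow> pole_fun z has_fps_expansion pole_fps z"
  unfolding pole_fun_def pole_fps_def deriv_fps_def image_fps_def using image_fps_0[of z] quotient_fps_0[of z]
  by (intro fps_expansion_intros quotient_fun_fps fps_holo holo holo_deriv) (auto simp: image_fps_def)

lemma pole_fun_eq:
  "\<epsilon> \<noteq> 0 \<Longrightarrow> deriv W (z + \<epsilon>) / (W (z + \<epsilon>) - cnj (W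
      z)) - deriv W (z + \<epsilon>) / (W (z + \<epsilon>) - W z) =
     pole_fun z \<epsilon> / \<epsilon>"
proof -
  assume e: "\<epsilon> \<noteq> 0"
  hence "inverse (quotient_fun z \<epsilon>) = \<epsilon> / (W (z + \<epsilon>) - W z)"
    by (simp add: quotient_fun_def)
  thus ?thesis
    using e by (simp add: pole_fun_def diff_divide_distrib) (simp add: divide_inverse)
qed

definition dpole_fun :: "complex \<Rightarrow> complex \<Rightarrow> complex" where
  "dpole_fun z \<epsilon> = - (deriv W z * deriv W (z + \<epsilon>) * inverse (quotient_fun z
      \<epsilon> * quotient_fun z \<epsilon>))"

lemma dpole_fun_fps: "z \<in> U \<Longrightarrow> dpole_fun z has_fps_expansion dpole_fps z"
  unfolding dpole_fun_def dpole_fps_def deriv_fps_def using quotient_fps_0[of z]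
  by (intro fps_expansion_intros quotient_fun_fps fps_holo holo_deriv) auto

lemma dpole_fun_eq:
  "\<epsilon> \<noteq> 0 \<Longrightarrow> - (deriv W (z + \<epsilon>) * deriv W z / (W (z +
      \<epsilon>) - W z)\<^sup>2) = dpole_fun z \<epsilon> / \<epsilon> ^ 2"
  by (simp add: dpole_fun_def quotient_fun_def power2_eq_square mult.commute)

text \<open>Eliminates the third derivative of \<open>W\<close>. It also shows that
  \<open>N' - N\<^sup>2 / 2\<close>, with \<open>N\<close> the pre-Schwarzian, is the Schwarzian
  derivative of \<open>W\<close>.\<close>

lemma deriv_pre_schwarzian:
  assumes "z \<in> U"
  shows "deriv pre_schwarzian z = deriv (deriv (deriv W)) z / deriv W z - (pre_schwarzian z)\<^sup>2"
proof -
  have "(pre_schwarzian has_field_derivative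
      (deriv (deriv (deriv W)) z * deriv W z - deriv (deriv W) z * deriv (deriv W) z) / (deriv W z *
          deriv W z)) (at z)"
    unfolding pre_schwarzian_def[abs_def] using deriv_nz[OF assms] assms
    by (intro DERIV_divide holomorphic_derivI[OF holo_deriv open_U] holomorphic_derivI[OF holo_deriv2 open_U])
  hence "deriv pre_schwarzian z = (deriv (deriv (deriv W)) z * deriv W z - deriv (deriv W) z * deriv
      (deriv W) z) / (deriv W z * deriv W z)"
    by (rule DERIV_imp_deriv)
  thus ?thesis
    using deriv_nz[OF assms] by (simp add: pre_schwarzian_def diff_divide_distrib power2_eq_square)
qed

lemma pole_fps_nth:
  assumes "z \<in> U"
  shows "fps_nth (pole_fps z) 0 = -1"
    and "fps_nth (pole_fps z) 1 = image_pole z - pre_schwarzian z / 2"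
    and "fps_nth (pole_fps z) 2 =
      pre_schwarzian z * image_pole z - (image_pole z)\<^sup>2 - deriv pre_schwarzian z / 3 -
          (pre_schwarzian z)\<^sup>2 / 12"
proof -
  define w1 w2 w3 d where "w1 = deriv W z" and "w2 = deriv (deriv W) z" and "w3 = deriv (deriv (deriv W)) z"
    and "d = W z - cnj (W z)"
  have nz: "w1 \<noteq> 0" "d \<noteq> 0"
    using deriv_nz cnj_neq assms by (auto simp: w1_def d_def)
  have E: "fps_nth (deriv_fps z) 0 = w1" "fps_nth (deriv_fps z) 1 = w2" "fps_nth (deriv_fps z) 2 = w3 / 2"
    by (simp_all add: deriv_fps_def fps_expansion_def w1_def w2_def w3_def numeral_2_eq_2)
  have Q1: "fps_nth (quotient_fps z) 0 = w1" "fps_nth (quotient_fps z) 1 = w2 / 2" "fps_nth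
      (quotient_fps z) 2 = w3 / 6"
    by (simp_all add: quotient_fps_def fps_expansion_def w1_def w2_def w3_def numeral_2_eq_2 numeral_3_eq_3)
  have Q2: "fps_nth (image_fps z) 0 = d" "fps_nth (image_fps z) 1 = w1"
    by (simp_all add: image_fps_def fps_expansion_def w1_def d_def)
  \<comment> \<open>The quotients are found from the equations
    \<open>r * quotient_fps z = deriv_fps z\<close> and
    \<open>s * image_fps z = deriv_fps z\<close>, solved order by order.\<close>
  define r where "r = deriv_fps z * inverse (quotient_fps z)"
  define s where "s = deriv_fps z * inverse (image_fps z)"
  have "r * quotient_fps z = deriv_fps z"
    using inverse_mult_eq_1[OF quotient_fps_0[OF assms]] by (simp add: r_def mult.assoc)
  hence r: "fps_nth (r * quotient_fps z) n = fps_nth (deriv_fps z) n" for n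
    by simp
  have "s * image_fps z = deriv_fps z"
    using inverse_mult_eq_1[OF image_fps_0[OF assms]] by (simp add: s_def mult.assoc)
  hence s: "fps_nth (s * image_fps z) n = fps_nth (deriv_fps z) n" for n
    by simp
  have r0: "fps_nth r 0 = 1"
    using r[of 0] nz by (simp add: E Q1)
  have "fps_nth r 0 * (w2 / 2) + fps_nth r 1 * w1 = w2"
    using r[of 1] by (simp add: fps_mult_nth_1 E Q1 del: One_nat_def)
  hence r1: "fps_nth r 1 = (w2 / w1) / 2"
    using nz by (simp add: r0 field_simps)
  have "fps_nth r 0 * (w3 / 6) + fps_nth r 1 * (w2 / 2) + fps_nth r 2 * w1 = w3 / 2"
    using r[of 2] by (simp add: fps_mult_nth_2 E Q1 del: One_nat_def)
  hence "fps_nth r 2 * w1 = w3 / 2 - (fps_nth r 0 * (w3 / 6) + fps_nth r 1 * (w2 / 2))"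
    by (simp add: eq_diff_eq add.commute del: One_nat_def)
  also have "\<dots> = w3 / 3 - (w2 / w1) * w2 / 4"
    using nz unfolding r0 r1 by (simp add: field_simps)
  finally have "fps_nth r 2 * w1 = w3 / 3 - (w2 / w1) * w2 / 4" .
  hence "fps_nth r 2 = (w3 / 3 - (w2 / w1) * w2 / 4) / w1"
    using nz by (simp add: eq_divide_eq)
  hence r2: "fps_nth r 2 = (w3 / w1) / 3 - (w2 / w1)\<^sup>2 / 4"
    by (simp add: diff_divide_distrib power2_eq_square mult_ac)
  have s0: "fps_nth s 0 = w1 / d"
    using s[of 0] nz by (simp add: E Q2 field_simps)
  have "fps_nth s 0 * w1 + fps_nth s 1 * d = w2"
    using s[of 1] by (simp add: fps_mult_nth_1 E Q2 del: One_nat_def)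
  hence "fps_nth s 1 = (w2 - (w1 / d) * w1) / d"
    using nz by (simp add: s0 eq_divide_eq) (simp add: algebra_simps)
  hence s1: "fps_nth s 1 = (w2 / w1) * (w1 / d) - (w1 / d)\<^sup>2"
    using nz by (simp add: diff_divide_distrib power2_eq_square)
  have p: "pole_fps z = fps_X * s - r"
    by (simp add: pole_fps_def r_def s_def)
  have N: "pre_schwarzian z = w2 / w1" "image_pole z = w1 / d" "deriv pre_schwarzian z = w3 / w1 -
      (w2 / w1)\<^sup>2"
    using deriv_pre_schwarzian[OF assms] by (simp_all add: pre_schwarzian_def image_pole_def w1_def
        w2_def w3_def d_def)
  show "fps_nth (pole_fps z) 0 = -1"
    by (simp add: p r0)
  show "fps_nth (pole_fps z) 1 = image_pole z - pre_schwarzian z / 2"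
    by (simp add: p r1[unfolded One_nat_def] s0 N)
  have "fps_nth (pole_fps z) 2 = fps_nth s 1 - fps_nth r 2"
    by (simp add: p)
  also have "\<dots> = pre_schwarzian z * image_pole z - (image_pole z)\<^sup>2 - deriv
      pre_schwarzian z / 3 - (pre_schwarzian z)\<^sup>2 / 12"
    unfolding N r2 s1 by (simp add: field_simps)
  finally show "fps_nth (pole_fps z) 2 =
      pre_schwarzian z * image_pole z - (image_pole z)\<^sup>2 - deriv pre_schwarzian z / 3 -
          (pre_schwarzian z)\<^sup>2 / 12" .
qed

text \<open>The constant term left after the double pole is \<open>- 1 / 6\<close> of the Schwarzian
  derivative. With the factor \<open>- 1 / 2\<close> of the Virasoro field it becomes the
  \<open>1 / 12\<close> in \<open>schwarzian_term\<close>.\<close>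

lemma dpole_fps_nth:
  assumes "z \<in> U"
  shows "fps_nth (dpole_fps z) 2 = - (deriv pre_schwarzian z - (pre_schwarzian z)\<^sup>2 / 2) / 6"
proof -
  define w1 w2 w3 where "w1 = deriv W z" and "w2 = deriv (deriv W) z" and "w3 = deriv (deriv (deriv W)) z"
  have nz: "w1 \<noteq> 0"
    using deriv_nz assms by (auto simp: w1_def)
  have E: "fps_nth (deriv_fps z) 0 = w1" "fps_nth (deriv_fps z) 1 = w2" "fps_nth (deriv_fps z) 2 = w3 / 2"
    by (simp_all add: deriv_fps_def fps_expansion_def w1_def w2_def w3_def numeral_2_eq_2)
  have Q1: "fps_nth (quotient_fps z) 0 = w1" "fps_nth (quotient_fps z) 1 = w2 / 2" "fps_nth
      (quotient_fps z) 2 = w3 / 6"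
    by (simp_all add: quotient_fps_def fps_expansion_def w1_def w2_def w3_def numeral_2_eq_2 numeral_3_eq_3)
  define Q where "Q = quotient_fps z * quotient_fps z"
  have Q: "fps_nth Q 0 = w1 * w1" "fps_nth Q 1 = w1 * w2" "fps_nth Q 2 = w2 * w2 / 4 + w1 * w3 / 3"
    by (simp_all add: Q_def fps_mult_nth_1 fps_mult_nth_2 Q1 field_simps del: One_nat_def)
  have "fps_nth Q 0 \<noteq> 0"
    using Q nz by simp
  hence "dpole_fps z * Q = - (fps_const w1 * deriv_fps z)"
    using inverse_mult_eq_1[of Q] by (simp add: dpole_fps_def Q_def[symmetric] mult.assoc w1_def)
  hence b: "fps_nth (dpole_fps z * Q) n = - (w1 * fps_nth (deriv_fps z) n)" for n
    by simp
  let ?b = "fps_nth (dpole_fps z)"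
  have b0: "?b 0 = -1"
    using b[of 0] nz by (simp add: Q E eq_neg_iff_add_eq_0) (metis add.commute distrib_right mult_1
        mult_eq_0_iff)
  have "?b 0 * (w1 * w2) + ?b 1 * (w1 * w1) = - (w1 * w2)"
    using b[of 1] by (simp add: fps_mult_nth_1 Q E del: One_nat_def)
  hence b1: "?b 1 = 0"
    using nz by (simp add: b0 del: One_nat_def)
  have "?b 0 * (w2 * w2 / 4 + w1 * w3 / 3) + ?b 1 * (w1 * w2) + ?b 2 * (w1 * w1) = - (w1 * (w3 / 2))"
    using b[of 2] by (simp add: fps_mult_nth_2 Q E del: One_nat_def)
  hence "?b 2 * (w1 * w1) = w2 * w2 / 4 - w1 * w3 / 6"
    by (simp add: b0 b1 algebra_simps del: One_nat_def)
  hence "?b 2 = (w2 * w2 / 4 - w1 * w3 / 6) / (w1 * w1)"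
    using nz by (simp add: eq_divide_eq)
  also have "\<dots> = (w2 / w1)\<^sup>2 / 4 - (w3 / w1) / 6"
    using nz by (simp add: diff_divide_distrib power2_eq_square mult.commute)
  also have "\<dots> = - (deriv pre_schwarzian z - (pre_schwarzian z)\<^sup>2 / 2) / 6"
    unfolding deriv_pre_schwarzian[OF assms] by (simp add: pre_schwarzian_def w1_def w2_def w3_def
        field_simps)
  finally show ?thesis .
qed

end

section \<open>The coefficient of the vertex field\<close>

locale uniformizer_arg = uniformizer +
  fixes \<theta> :: "complex \<Rightarrow> real"
  assumes cont_arg: "continuous_on U \<theta>"
    and arg: "\<And>z. z \<in> U \<Longrightarrow> deriv W z = of_real (cmod (deriv W z)) * cis (\<theta> z)"
begin

text \<open>The branch is only known to be continuous. Near \<open>z\<close> its increment is the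
  principal argument of \<open>deriv W x / deriv W z\<close>, which is the imaginary part of a
  holomorphic logarithm.\<close>

lemma has_derivative_arg:
  assumes z: "z \<in> U"
  shows "(\<theta> has_derivative (\<lambda>h. Im (pre_schwarzian z * h))) (at z)"
proof -
  define r where "r = (\<lambda>x. deriv W x / deriv W z)"
  have nz: "deriv W z \<noteq> 0"
    using deriv_nz z .
  have "(r has_field_derivative pre_schwarzian z) (at z)"
    unfolding r_def pre_schwarzian_def by (intro DERIV_cdivide holomorphic_derivI[OF holo_deriv open_U z])
  moreover have r1: "r z = 1"
    using nz by (simp add: r_def)
  ultimately have "((\<lambda>x. Ln (r x)) has_field_derivative pre_schwarzian z) (at z)"
    by (auto intro!: derivative_eq_intros)
  hence "((\<lambda>x. Im (Ln (r x))) has_derivative (\<lambda>h. Im (pre_schwarzian z * h))) (at z)"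
    unfolding has_field_derivative_def by (rule has_derivative_Im)
  hence deriv: "((\<lambda>x. \<theta> z + Im (Ln (r x))) has_derivative (\<lambda>h. Im
      (pre_schwarzian z * h))) (at z)"
    using has_derivative_add[OF has_derivative_const, of _ _ "at z" "\<theta> z"] by fastforce
  \<comment> \<open>Radius \<open>pi\<close> keeps the increment of the branch in the principal
    range.\<close>
  have op: "open {x \<in> U. \<theta> x \<in> ball (\<theta> z) pi}"
    using continuous_open_preimage[OF cont_arg open_U open_ball[of "\<theta> z" pi]] by (simp add:
        vimage_def Int_def)
  have eq: "\<theta> z + Im (Ln (r x)) = \<theta> x" if x: "x \<in> {x \<in> U. \<theta> x \<in>
      ball (\<theta> z) pi}" for x
  proof -
    have "r x = rcis (cmod (deriv W x) / cmod (deriv W z)) (\<theta> x - \<theta> z)"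
      using arg[of x] arg[OF z] x unfolding r_def
      by (metis (no_types, lifting) mem_Collect_eq rcis_def rcis_divide)
    moreover have "cmod (deriv W x) / cmod (deriv W z) > 0"
      using x nz deriv_nz by simp
    moreover have "\<theta> x - \<theta> z \<in> {-pi<..pi}"
      using x by (auto simp: dist_real_def abs_if split: if_splits)
    ultimately have "Arg (r x) = \<theta> x - \<theta> z"
      by (intro Arg_unique')
    moreover have "r x \<noteq> 0"
      using x nz deriv_nz by (simp add: r_def)
    ultimately show ?thesis
      by (simp add: Arg_eq_Im_Ln)
  qed
  show ?thesis
    by (rule has_derivative_transform_within_open[OF deriv op _ eq]) (use z in auto)
qed

lemma dz_arg:
  assumes "z \<in> U"
  shows "dz (\<lambda>x. of_real (- 2 * b * \<theta> x)) z = \<i> * of_real b * pre_schwarzian z"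
proof -
  have "((\<lambda>x. complex_of_real (- 2 * b * \<theta> x)) has_derivative (\<lambda>h. of_real (-
      2 * b * Im (pre_schwarzian z * h)))) (at z)"
    by (intro has_derivative_of_real has_derivative_mult_right has_derivative_arg assms)
  thus ?thesis
    by (subst dz_eq) (auto simp: complex_eq_iff)
qed

text \<open>The logarithm splits as \<open>ln (2 * Im (W x)) - ln (cmod (deriv W x))\<close>. Since
  \<open>W - cnj W = 2 * \<i> * Im W\<close>, the first part contributes twice
  \<open>image_pole\<close>, the second the pre-Schwarzian.\<close>

lemma has_derivative_ln_radius:
  assumes z: "z \<in> U"
  shows "((\<lambda>x. ln (cmod ((W x - cnj (W x)) / deriv W x))) has_derivative
           (\<lambda>h. Re ((2 * image_pole z - pre_schwarzian z) * h))) (at z)"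
proof -
  have W: "(W has_derivative (\<lambda>h. deriv W z * h)) (at z)"
    using holomorphic_derivI[OF holo open_U z] by (simp add: has_field_derivative_def)
  have "((\<lambda>x. ln (2 * Im (W x))) has_derivative (\<lambda>h. 2 * Im (deriv W z * h) *
      inverse (2 * Im (W z)))) (at z)"
    using Im_pos[OF z] by (intro has_derivative_ln has_derivative_mult_right has_derivative_Im W) auto
  moreover have "((\<lambda>x. Re (complex_of_real (ln (cmod (deriv W x))))) has_derivative
      (\<lambda>h. Re (complex_of_real (Re (deriv (deriv W) z / deriv W z * h))))) (at z)"
    by (intro has_derivative_Re has_derivative_ln_cmod holomorphic_derivI[OF holo_deriv open_U z] deriv_nz z)
  ultimately have "((\<lambda>x. ln (2 * Im (W x)) - Re (complex_of_real (ln (cmod (deriv W x)))))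
      has_derivative
      (\<lambda>h. 2 * Im (deriv W z * h) * inverse (2 * Im (W z)) - Re (complex_of_real (Re (deriv
          (deriv W) z / deriv W z * h))))) (at z)"
    by (rule has_derivative_diff)
  moreover have "2 * Im (deriv W z * h) * inverse (2 * Im (W z)) - Re (complex_of_real (Re (deriv
      (deriv W) z / deriv W z * h))) =
      Re ((2 * image_pole z - pre_schwarzian z) * h)" for h
  proof -
    have "2 * image_pole z * h = deriv W z * h / (\<i> * of_real (Im (W z)))"
      unfolding image_pole_def complex_diff_cnj using Im_pos[OF z] by (simp add: field_simps)
    hence "Re (2 * image_pole z * h) = Re (deriv W z * h / (\<i> * of_real (Im (W z))))"
      by simp
    also have "\<dots> = Im (deriv W z * h) / Im (W z)"
      by (simp add: Re_divide power2_eq_square)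
    finally have "Re (2 * image_pole z * h) = Im (deriv W z * h) / Im (W z)" .
    moreover have "Re ((2 * image_pole z - pre_schwarzian z) * h) = Re (2 * image_pole z * h) - Re
        (pre_schwarzian z * h)"
      by (simp only: left_diff_distrib minus_complex.simps)
    moreover have "2 * Im (deriv W z * h) * inverse (2 * Im (W z)) = Im (deriv W z * h) / Im (W z)"
      by (simp only: divide_inverse inverse_mult_distrib) simp
    ultimately show ?thesis
      by (simp only: Re_complex_of_real pre_schwarzian_def)
  qed
  ultimately have *: "((\<lambda>x. ln (2 * Im (W x)) - Re (complex_of_real (ln (cmod (deriv W
      x))))) has_derivative
      (\<lambda>h. Re ((2 * image_pole z - pre_schwarzian z) * h))) (at z)"
    by simp
  show ?thesis
  proof (rule has_derivative_transform_within_open[OF * open_U z])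
    fix x assume x: "x \<in> U"
    have "cmod (W x - cnj (W x)) = 2 * Im (W x)"
      unfolding complex_diff_cnj using Im_pos[OF x] by (simp add: norm_mult)
    thus "ln (2 * Im (W x)) - Re (complex_of_real (ln (cmod (deriv W x)))) = ln (cmod ((W x - cnj (W
        x)) / deriv W x))"
      using Im_pos[OF x] deriv_nz[OF x] by (simp add: norm_divide ln_div)
  qed
qed

definition vertex_coeff :: "complex \<Rightarrow> real \<Rightarrow> complex \<Rightarrow> complex" where
  "vertex_coeff \<alpha> b z = exp (- 2 * \<alpha> * of_real b * of_real (\<theta> z)) *
     of_real (cmod ((W z - cnj (W z)) / deriv W z)) powr \<alpha>\<^sup>2"

definition vertex_log_dz :: "complex \<Rightarrow> real \<Rightarrow> complex \<Rightarrow> complex" where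
  "vertex_log_dz \<alpha> b z = \<alpha>\<^sup>2 * image_pole z + (\<i> * \<alpha> * of_real b -
      \<alpha>\<^sup>2 / 2) * pre_schwarzian z"

lemma vertex_coeff_derivative:
  assumes z: "z \<in> U"
  shows "vertex_coeff \<alpha> b differentiable (at z)"
    and "dz (vertex_coeff \<alpha> b) z = vertex_coeff \<alpha> b z * vertex_log_dz \<alpha> b z"
    and "dzbar (vertex_coeff \<alpha> b) z = vertex_coeff \<alpha> b z *
      (\<alpha>\<^sup>2 * cnj (image_pole z) + (- \<i> * \<alpha> * of_real b - \<alpha>\<^sup>2 /
          2) * cnj (pre_schwarzian z))"
proof -
  \<comment> \<open>A logarithm of the coefficient: the radius is positive, so the complex power is
    the exponential of its real logarithm times \<open>\<alpha>\<^sup>2\<close>.\<close>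
  define L where "L = (\<lambda>x. (- 2 * \<alpha> * of_real b) * complex_of_real (\<theta> x) +
    \<alpha>\<^sup>2 * complex_of_real (ln (cmod ((W x - cnj (W x)) / deriv W x))))"
  define L' where "L' = (\<lambda>h. (- 2 * \<alpha> * of_real b) * complex_of_real (Im
      (pre_schwarzian z * h)) +
    \<alpha>\<^sup>2 * complex_of_real (Re ((2 * image_pole z - pre_schwarzian z) * h)))"
  have "(L has_derivative L') (at z)"
    unfolding L_def L'_def
    by (intro has_derivative_add has_derivative_mult_right has_derivative_of_real
        has_derivative_arg has_derivative_ln_radius z)
  moreover have "(exp has_derivative (\<lambda>h. exp (L z) * h)) (at (L z))"
    using DERIV_exp[of "L z"] by (simp add: has_field_derivative_def)
  ultimately have exp_L: "((\<lambda>x. exp (L x)) has_derivative (\<lambda>h. exp (L z) * L' h)) (at z)"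
    by (rule has_derivative_compose)
  have v: "exp (L x) = vertex_coeff \<alpha> b x" if x: "x \<in> U" for x
  proof -
    have "cmod ((W x - cnj (W x)) / deriv W x) > 0"
      using cnj_neq[OF x x] deriv_nz[OF x] by simp
    thus ?thesis
      unfolding L_def exp_add by (simp add: vertex_coeff_def powr_def Ln_of_real)
  qed
  have *: "(vertex_coeff \<alpha> b has_derivative (\<lambda>h. vertex_coeff \<alpha> b z * L' h)) (at z)"
    using has_derivative_transform_within_open[OF exp_L open_U z v] v[OF z] by simp
  show "vertex_coeff \<alpha> b differentiable (at z)"
    using * by (auto simp: differentiable_def)
  \<comment> \<open>Twice the two Wirtinger derivatives of the real-linear maps
    \<open>h \<mapsto> Im (k * h)\<close> and \<open>h \<mapsto> Re (k * h)\<close>.\<close>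
  have Im1: "complex_of_real (Im k) - \<i> * complex_of_real (Im (k * \<i>)) = - \<i> * k"
    "complex_of_real (Im k) + \<i> * complex_of_real (Im (k * \<i>)) = \<i> * cnj k"
    "complex_of_real (Re k) - \<i> * complex_of_real (Re (k * \<i>)) = k"
    "complex_of_real (Re k) + \<i> * complex_of_real (Re (k * \<i>)) = cnj k" for k
    by (simp_all add: complex_eq_iff)
  have "L' 1 - \<i> * L' \<i> = (- 2 * \<alpha> * of_real b) * (complex_of_real (Im (pre_schwarzian
      z)) - \<i> * complex_of_real (Im (pre_schwarzian z * \<i>))) +
     \<alpha>\<^sup>2 * (complex_of_real (Re (2 * image_pole z - pre_schwarzian z)) - \<i> *
         complex_of_real (Re ((2 * image_pole z - pre_schwarzian z) * \<i>)))"
    unfolding L'_def mult_1_right by algebra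
  also have "\<dots> = 2 * vertex_log_dz \<alpha> b z"
    unfolding Im1 vertex_log_dz_def by (simp add: algebra_simps)
  finally show "dz (vertex_coeff \<alpha> b) z = vertex_coeff \<alpha> b z * vertex_log_dz \<alpha> b z"
    unfolding dz_eq[OF *] by (simp add: algebra_simps)
  have "L' 1 + \<i> * L' \<i> = (- 2 * \<alpha> * of_real b) * (complex_of_real (Im (pre_schwarzian
      z)) + \<i> * complex_of_real (Im (pre_schwarzian z * \<i>))) +
     \<alpha>\<^sup>2 * (complex_of_real (Re (2 * image_pole z - pre_schwarzian z)) + \<i> *
         complex_of_real (Re ((2 * image_pole z - pre_schwarzian z) * \<i>)))"
    unfolding L'_def mult_1_right by algebra
  also have "\<dots> = 2 * (\<alpha>\<^sup>2 * cnj (image_pole z) + (- \<i> * \<alpha> * of_real b -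
      \<alpha>\<^sup>2 / 2) * cnj (pre_schwarzian z))"
    unfolding Im1 by (simp add: algebra_simps)
  finally have "L' 1 + \<i> * L' \<i> = 2 * (\<alpha>\<^sup>2 * cnj (image_pole z) + (- \<i> *
      \<alpha> * of_real b - \<alpha>\<^sup>2 / 2) * cnj (pre_schwarzian z))" .
  moreover have "dzbar (vertex_coeff \<alpha> b) z = vertex_coeff \<alpha> b z * ((L' 1 + \<i> * L'
      \<i>) / 2)"
    unfolding dzbar_eq[OF *] by (simp add: algebra_simps)
  ultimately show "dzbar (vertex_coeff \<alpha> b) z = vertex_coeff \<alpha> b z *
      (\<alpha>\<^sup>2 * cnj (image_pole z) + (- \<i> * \<alpha> * of_real b - \<alpha>\<^sup>2 /
          2) * cnj (pre_schwarzian z))"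
    by (simp only: nonzero_mult_div_cancel_left[of "2 :: complex", OF zero_neq_numeral[symmetric]])
qed

lemma smooth_image_pole: "smooth_on U image_pole"
proof -
  have "smooth_on U (\<lambda>z. deriv W z * inverse (W z + -1 * cnj (W z)))"
    using cnj_neq
    by (intro smooth_on_mult smooth_on_inverse smooth_on_add smooth_on_const smooth_on_cnj open_U
        smooth_W) auto
  thus ?thesis
    by (simp add: image_pole_def[abs_def] divide_inverse)
qed

text \<open>Differentiate \<open>image_pole * (W - cnj W) = deriv W\<close>; the conjugate has
  vanishing \<open>dz\<close>.\<close>

lemma dz_image_pole:
  assumes z: "z \<in> U"
  shows "dz image_pole z = pre_schwarzian z * image_pole z - (image_pole z)\<^sup>2"
proof -
  let ?d = "\<lambda>z. W z + -1 * cnj (W z)"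
  have d: "?d differentiable (at z)"
    using smooth_on_imp_differentiable[OF _ z]
    by (intro smooth_on_imp_differentiable[OF _ z] smooth_on_add smooth_on_mult smooth_on_const
        smooth_on_cnj open_U smooth_W)
  have W: "W differentiable (at z)"
    using smooth_W(1) z by (rule smooth_on_imp_differentiable)
  have "dz (\<lambda>x. -1 * cnj (W x)) z = -1 * cnj (dzbar W z)"
    by (simp only: dz_cmult[OF differentiable_cnj[OF W]] dz_cnj[OF W])
  moreover have "dz ?d z = dz W z + dz (\<lambda>x. -1 * cnj (W x)) z"
    by (intro dz_add W differentiable_mult differentiable_const differentiable_cnj)
  ultimately have dd: "dz ?d z = deriv W z"
    by (simp add: dz_holomorphic_on[OF holo open_U z] dzbar_holomorphic_on[OF holo open_U z])
  have "dz (\<lambda>z. image_pole z * ?d z) z = dz (deriv W) z"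
    by (rule dz_cong_open[OF open_U z]) (use cnj_neq in \<open>simp add: image_pole_def\<close>)
  also have "\<dots> = deriv (deriv W) z"
    by (rule dz_holomorphic_on[OF holo_deriv open_U z])
  also have "dz (\<lambda>z. image_pole z * ?d z) z = dz image_pole z * (W z - cnj (W z)) +
      image_pole z * deriv W z"
    by (simp only: dz_mult[OF smooth_on_imp_differentiable[OF smooth_image_pole z] d] dd) simp
  finally have "dz image_pole z * (W z - cnj (W z)) = deriv (deriv W) z - image_pole z * deriv W z"
    by (simp add: algebra_simps)
  hence "dz image_pole z = (deriv (deriv W) z - image_pole z * deriv W z) / (W z - cnj (W z))"
    using cnj_neq[OF z z] by (simp add: eq_divide_eq)
  thus ?thesis
    using deriv_nz[OF z] by (simp add: image_pole_def pre_schwarzian_def diff_divide_distrib power2_eq_square)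
qed

lemma smooth_vertex_log_dz: "smooth_on U (vertex_log_dz \<alpha> b)"
  unfolding vertex_log_dz_def[abs_def]
  by (intro smooth_on_add smooth_on_mult smooth_on_const open_U smooth_W smooth_image_pole)

lemma smooth_vertex_coeff: "smooth_on U (vertex_coeff \<alpha> b)"
proof (rule smooth_on_log_derivative[OF open_U])
  show "smooth_on U (vertex_log_dz \<alpha> b)"
    by (rule smooth_vertex_log_dz)
  show "smooth_on U (\<lambda>z. \<alpha>\<^sup>2 * cnj (image_pole z) + (- \<i> * \<alpha> *
      of_real b - \<alpha>\<^sup>2 / 2) * cnj (pre_schwarzian z))"
    by (intro smooth_on_add smooth_on_mult smooth_on_const smooth_on_cnj open_U smooth_W smooth_image_pole)
qed (use vertex_coeff_derivative in auto)

lemma dz_vertex_log_dz: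
  assumes z: "z \<in> U"
  shows "dz (vertex_log_dz \<alpha> b) z = \<alpha>\<^sup>2 * (pre_schwarzian z * image_pole z -
      (image_pole z)\<^sup>2) +
           (\<i> * \<alpha> * of_real b - \<alpha>\<^sup>2 / 2) * deriv pre_schwarzian z"
proof -
  have "image_pole differentiable (at z)" "pre_schwarzian differentiable (at z)"
    using smooth_on_imp_differentiable[OF smooth_image_pole z] smooth_on_imp_differentiable[OF
        smooth_W(3) z] .
  thus ?thesis
    unfolding vertex_log_dz_def[abs_def]
    by (subst dz_add) (simp_all add: dz_cmult dz_image_pole[OF z] dz_holomorphic_on[OF
        holo_pre_schwarzian open_U z])
qed

lemma dz_dz_vertex_coeff:
  assumes z: "z \<in> U"
  shows "dz (dz (vertex_coeff \<alpha> b)) z = vertex_coeff \<alpha> b z *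
           ((vertex_log_dz \<alpha> b z)\<^sup>2 + dz (vertex_log_dz \<alpha> b) z)"
proof -
  have "dz (dz (vertex_coeff \<alpha> b)) z = dz (\<lambda>x. vertex_coeff \<alpha> b x *
      vertex_log_dz \<alpha> b x) z"
    by (rule dz_cong_open[OF open_U z]) (rule vertex_coeff_derivative)
  also have "\<dots> = vertex_coeff \<alpha> b z * vertex_log_dz \<alpha> b z * vertex_log_dz \<alpha> b z +
      vertex_coeff \<alpha> b z * dz (vertex_log_dz \<alpha> b) z"
    using vertex_coeff_derivative[OF z] smooth_on_imp_differentiable[OF smooth_vertex_log_dz z]
    by (subst dz_mult) auto
  finally show ?thesis
    by (simp add: power2_eq_square algebra_simps)
qed

end

section \<open>Wick's formula for products of currents and vertex fields\<close>

lemma tagged_from_2_tags: "x \<in> set (tagged_from 2 ms) \<Longrightarrow> fst x \<noteq> 0" "x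
    \<in> set (tagged_from 2 ms) \<Longrightarrow> fst x \<noteq> Suc 0"
  using tagged_from_ge[of x 2 ms] by auto

lemma wick_Nil: "wick_correlation G ([] # ms) = tagged_wick G (tagged_from 2 ms)"
  by (simp add: wick_correlation_head[of 0])

lemma wick_Der:
  "wick_correlation G ([(c, z, Der j 0)] # ms) = wsum1 G (der_contraction G c z j) [] (tagged_from 2 ms)"
  using tagged_wick_Der[of "tagged_from 2 ms" 0 "[]"] tagged_from_2_tags
  by (simp add: wick_correlation_head[of 0] del: split_paired_All)

lemma wick_Der_Der:
  "wick_correlation G ([(c, z, Der i 0), (c, z, Der j 0)] # ms) =
     wsum2 G (der_contraction G c z i) (der_contraction G c z j) [] (tagged_from 2 ms)"
  using tagged_wick_Der_Der[of "tagged_from 2 ms" 0 "[]"] tagged_from_2_tags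
  by (simp add: wick_correlation_head[of 0] del: split_paired_All)

lemma wick_vertex:
  "wick_correlation G ([v] # ms) = tagged_wick G ((1, v) # tagged_from 2 ms)"
  by (simp add: wick_correlation_head[of 1])

lemma wick_Der_vertex:
  "wick_correlation G ([(c, z, Der j 0), v] # ms) =
     wsum1 G (der_contraction G c z j) [(1, v)] (tagged_from 2 ms)"
  using tagged_wick_Der[of "tagged_from 2 ms" 1 "[(1, v)]"] tagged_from_2_tags
  by (simp add: wick_correlation_head[of 1] del: split_paired_All)

lemma wick_Der_Der_vertex:
  "wick_correlation G ([(c, z, Der i 0), (c, z, Der j 0), v] # ms) =
     wsum2 G (der_contraction G c z i) (der_contraction G c z j) [(1, v)] (tagged_from 2 ms)"
  using tagged_wick_Der_Der[of "tagged_from 2 ms" 1 "[(1, v)]"] tagged_from_2_tags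
  by (simp add: wick_correlation_head[of 1] del: split_paired_All)

lemma wick2_Nil_Nil: "wick_correlation G ([] # [] # ms) = tagged_wick G (tagged_from 2 ms)"
  by (simp add: wick_correlation_head2)

lemma wick2_Nil_Der:
  "wick_correlation G ([] # [(c, z, Der j 0)] # ms) = wsum1 G (der_contraction G c z j) [] (tagged_from 2 ms)"
  using tagged_wick_Der[of "tagged_from 2 ms" 1 "[]"] tagged_from_2_tags
  by (simp add: wick_correlation_head2 del: split_paired_All)

lemma wick2_Der_Nil:
  "wick_correlation G ([(c, z, Der j 0)] # [] # ms) = wsum1 G (der_contraction G c z j) [] (tagged_from 2 ms)"
  using tagged_wick_Der[of "tagged_from 2 ms" 0 "[]"] tagged_from_2_tags
  by (simp add: wick_correlation_head2 del: split_paired_All)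

lemma wick2_Der_Der:
  "wick_correlation G ([(c, x, Der i 0)] # [(d, y, Der j 0)] # ms) =
     pair_expectation G (c, x, i, 0) (d, y, j, 0) * tagged_wick G (tagged_from 2 ms) +
     wsum2 G (der_contraction G c x i) (der_contraction G d y j) [] (tagged_from 2 ms)"
  using tagged_wick_Der_Der_pole'[of "tagged_from 2 ms" 0 1] tagged_from_2_tags
  by (simp add: wick_correlation_head2 del: split_paired_All)

lemma wick2_Nil_vertex:
  "wick_correlation G ([] # [v] # ms) = tagged_wick G ((1, v) # tagged_from 2 ms)"
  by (simp add: wick_correlation_head2)

lemma wick2_Der_vertex:
  "wick_correlation G ([(c, x, Der j 0)] # [(d, y, WExp \<alpha>)] # ms) =
     der_contraction G c x j (d, y, WExp \<alpha>) * tagged_wick G ((1, d, y, WExp \<alpha>) #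
         tagged_from 2 ms) +
     wsum1 G (der_contraction G c x j) [(1, d, y, WExp \<alpha>)] (tagged_from 2 ms)"
  using tagged_wick_Der_pole[of "tagged_from 2 ms" 0 1] tagged_from_2_tags
  by (simp add: wick_correlation_head2 del: split_paired_All)

lemma wick2_Der_Der_vertex:
  "wick_correlation G ([(c, x, Der i 0), (c, x, Der j 0)] # [(d, y, WExp \<alpha>)] # ms) =
     der_contraction G c x i (d, y, WExp \<alpha>) * der_contraction G c x j (d, y, WExp \<alpha>) *
       tagged_wick G ((1, d, y, WExp \<alpha>) # tagged_from 2 ms) +
     der_contraction G c x i (d, y, WExp \<alpha>) *
       wsum1 G (der_contraction G c x j) [(1, d, y, WExp \<alpha>)] (tagged_from 2 ms) +
     der_contraction G c x j (d, y, WExp \<alpha>) *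
       wsum1 G (der_contraction G c x i) [(1, d, y, WExp \<alpha>)] (tagged_from 2 ms) +
     wsum2 G (der_contraction G c x i) (der_contraction G c x j) [(1, d, y, WExp \<alpha>)]
         (tagged_from 2 ms)"
  using tagged_wick_Der_Der_pole[of "tagged_from 2 ms" 0 1] tagged_from_2_tags
  by (simp add: wick_correlation_head2 del: split_paired_All)

lemma mono_corr2_at_point:
  "mono_corr2 G (at_point X c x) (at_point Y d y) ms =
     (\<Sum>(f, p)\<leftarrow>X. \<Sum>(g, q)\<leftarrow>Y. f c x * g d y *
        wick_correlation G (map (\<lambda>u. (c, x, u)) p # map (\<lambda>u. (d, y, u)) q # ms))"
  by (simp add: mono_corr2_def at_point_def o_def case_prod_unfold)

text \<open>For the product of two currents, where only the left one moves.\<close>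

lemma has_fps_expansion_wsum2_left:
  assumes "\<And>x. x \<in> set R \<Longrightarrow> (\<lambda>\<epsilon>. g \<epsilon> (snd x))
      has_fps_expansion Abs_fps (\<lambda>n. g' n (snd x))"
  shows "(\<lambda>\<epsilon>. wsum2 G (g \<epsilon>) h P R) has_fps_expansion Abs_fps (\<lambda>n.
      wsum2 G (g' n) h P R)"
proof -
  have "(\<lambda>\<epsilon>. wsum2 G (g \<epsilon>) h P R) has_fps_expansion
      (\<Sum>p<length R. Abs_fps (\<lambda>n. g' n (snd (R ! p))) * fps_const (wsum1 G h P (contract p R)))"
    unfolding wsum2_def using assms
    by (intro has_fps_expansion_sum has_fps_expansion_mult has_fps_expansion_const) auto
  also have "(\<Sum>p<length R. Abs_fps (\<lambda>n. g' n (snd (R ! p))) * fps_const (wsum1 G h P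
      (contract p R))) =
      Abs_fps (\<lambda>n. wsum2 G (g' n) h P R)"
    by (intro fps_ext) (simp add: wsum2_def fps_sum_nth)
  finally show ?thesis .
qed

section \<open>The Virasoro field and its operator product expansion with the vertex field\<close>

lemma fock_space_field_Nil: "fock_space_field D []"
  by (simp add: fock_space_field_def)

lemma fock_space_field_Cons:
  "fock_space_field D ((f, p) # X) \<longleftrightarrow>
     (\<forall>c. local_chart D c \<longrightarrow> smooth_on (coords c) (f c)) \<and> fock_space_field D X"
  by (simp add: fock_space_field_def)

lemma fock_space_field_append:
  "fock_space_field D (X @ Y) \<longleftrightarrow> fock_space_field D X \<and> fock_space_field D Y"
  by (simp add: fock_space_field_def ball_Un)

lemma smooth_on_divide_const: "open U \<Longrightarrow> smooth_on U f \<Longrightarrow> smooth_on U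
    (\<lambda>z. f z / c)"
  using smooth_on_cmult[of U f "inverse c"] by (simp add: divide_inverse mult.commute)

lemma fock_space_field_map:
  "fock_space_field D (map (\<lambda>j. (f j, p j)) js) \<longleftrightarrow>
     (\<forall>j\<in>set js. \<forall>c. local_chart D c \<longrightarrow> smooth_on (coords c) (f j c))"
  by (auto simp: fock_space_field_def)

lemma sum_list_upt: "(\<Sum>j\<leftarrow>[0..<n]. f j) = (\<Sum>j<n. f j)"
  by (simp add: interv_sum_list_conv_sum_set_nat lessThan_atLeast0)

locale modified_field = green_domain +
  fixes \<theta> :: "chart \<Rightarrow> complex \<Rightarrow> real" and b :: real
  assumes arg_branch: "arg_branch D w \<theta>"
begin

abbreviation "W \<equiv> in_chart w"
abbreviation "N \<equiv> \<lambda>c. uniformizer.pre_schwarzian (W c)"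
abbreviation "NF \<equiv> \<lambda>c. fps_expansion (N c)"
abbreviation "ib \<equiv> \<i> * complex_of_real b"
abbreviation "J \<equiv> current \<theta> b"

lemma uniformizer_arg_chart:
  assumes "local_chart D c"
  shows "uniformizer_arg (coords c) (W c) (\<theta> c)"
proof
  show "open (coords c)"
    using assms by (rule open_coords)
  show "W c holomorphic_on coords c"
    using assms by (rule in_chart_holomorphic)
  show "inj_on (W c) (coords c)"
    using in_chart_inj[OF assms assms] point_of_inj[OF assms] by (auto simp: inj_on_def)
  show "Im (W c z) > 0" if "z \<in> coords c" for z
    using assms that by (rule Im_in_chart)
  show "continuous_on (coords c) (\<theta> c)"
    using arg_branch assms unfolding arg_branch_def by blast
  show "deriv (W c) z = of_real (cmod (deriv (W c) z)) * cis (\<theta> c z)" if "z \<in> coords c" for z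
    using arg_branch assms that unfolding arg_branch_def by blast
qed

lemma holomorphic_N: "local_chart D c \<Longrightarrow> N c holomorphic_on coords c"
  using uniformizer.holo_pre_schwarzian uniformizer_arg_chart uniformizer_arg.axioms(1) by blast

text \<open>\<open>\<epsilon>\<^sup>2\<close> times the scalar part of the product of currents at
  \<open>z + \<epsilon>\<close> and \<open>z\<close>: the pair expectation plus the product of the
  two deterministic parts \<open>ib * N\<close>.\<close>

definition current_scalar_fps :: "chart \<Rightarrow> complex \<Rightarrow> complex fps" where
  "current_scalar_fps c z =
     uniformizer.dpole_fps (W c) z + fps_X ^ 2 * (fps_const (ib\<^sup>2 * N c z) * NF c z)"

text \<open>The expansions below are written as a power series in the difference of the coordinates divided by
  its square, so the coefficient of order \<open>n\<close> comes from the index \<open>n + 2\<close>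
      of that power series.\<close>

definition current_ope :: "int \<Rightarrow> field" where
  "current_ope n = (if n < -2 then [] else
     (\<lambda>c z. fps_nth (current_scalar_fps c z) (nat (n + 2)), []) #
     (if nat (n + 2) < 2 then [] else
       [(\<lambda>c z. ib * N c z * (1 / fact (nat (n + 2) - 2)), [Der (Suc (nat (n + 2) - 2)) 0]),
        (\<lambda>c z. ib * fps_nth (NF c z) (nat (n + 2) - 2), [Der 1 0]),
        (\<lambda>c z. 1 / fact (nat (n + 2) - 2), [Der (Suc (nat (n + 2) - 2)) 0, Der 1 0])]))"

text \<open>One twelfth of the central charge \<open>1 - 12 * b\<^sup>2\<close> times the Schwarzian
  derivative of \<open>w\<close> in the chart.\<close>

definition schwarzian_term :: "chart \<Rightarrow> complex \<Rightarrow> complex" where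
  "schwarzian_term c z = (1 / 12 + ib\<^sup>2) * (deriv (N c) z - (N c z)\<^sup>2 / 2)"

text \<open>The Virasoro field written out in Wick products: the current is \<open>Der 1 0\<close>
  plus the scalar \<open>ib * N\<close>, and the contraction of two currents is already absorbed in
  the scalar term.\<close>

definition stress_field :: field where
  "stress_field =
     [(\<lambda>c z. - 1 / 2, [Der 1 0, Der 1 0]), (\<lambda>c z. - ib * N c z, [Der 1 0]),
         (\<lambda>c z. ib, [Der 2 0]),
      (schwarzian_term, [])]"

lemma smooth_fps_NF: "local_chart D c \<Longrightarrow> smooth_fps (coords c) (NF c)"
  using smooth_fps_expansion open_coords holomorphic_N by blast

lemma smooth_N: "local_chart D c \<Longrightarrow> smooth_on (coords c) (N c)"
  using smooth_on_holomorphic open_coords holomorphic_N by blast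

lemma smooth_fps_current_scalar:
  assumes "local_chart D c"
  shows "smooth_fps (coords c) (current_scalar_fps c)"
proof -
  interpret u: uniformizer_arg "coords c" "W c" "\<theta> c"
    by (rule uniformizer_arg_chart[OF assms])
  show ?thesis
    unfolding current_scalar_fps_def[abs_def]
    by (intro smooth_fps_add smooth_fps_mult smooth_fps_const smooth_fps_fps_const smooth_on_mult
        smooth_on_const u.smooth_fps_dpole smooth_fps_NF smooth_N open_coords assms)
qed

lemma fock_space_field_current_ope: "fock_space_field D (current_ope n)"
  using smooth_fps_current_scalar smooth_fps_NF unfolding smooth_fps_def
  by (auto simp: current_ope_def fock_space_field_Cons fock_space_field_Nil
      intro!: smooth_on_mult smooth_on_const smooth_on_divide_const smooth_N open_coords)

section \<open>The current, its operator product with itself, and the Virasoro field\<close>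

definition arg_scalar :: scalar_field where
  "arg_scalar c = dz (\<lambda>z. of_real (- 2 * b * \<theta> c z))"

text \<open>The formal Leibniz rule leaves a term with coefficient 0, the derivative of the constant
  1.\<close>

lemma current_eq:
  "J = [(\<lambda>c z. 0, [Der 0 0]), (\<lambda>c z. 1, [Der 1 0]), (arg_scalar, [])]"
  by (simp add: current_def d_field_def free_field_def arg_scalar_def[abs_def])

lemma dz_arg_chart:
  assumes "local_chart D c" "z \<in> coords c"
  shows "arg_scalar c z = ib * N c z"
proof -
  interpret u: uniformizer_arg "coords c" "W c" "\<theta> c"
    by (rule uniformizer_arg_chart[OF assms(1)])
  show ?thesis
    unfolding arg_scalar_def by (rule u.dz_arg[OF assms(2)])
qed

lemma dz_dz_arg_chart:
  assumes "local_chart D c" "z \<in> coords c"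
  shows "dz (arg_scalar c) z = ib * deriv (N c) z"
proof -
  have "dz (arg_scalar c) z = dz (\<lambda>z. ib * N c z) z"
    by (rule dz_cong_open[OF open_coords[OF assms(1)] assms(2)]) (rule dz_arg_chart[OF assms(1)])
  also have "\<dots> = ib * dz (N c) z"
    by (rule dz_cmult) (rule smooth_on_imp_differentiable[OF smooth_N[OF assms(1)] assms(2)])
  also have "dz (N c) z = deriv (N c) z"
    using holomorphic_N[OF assms(1)] open_coords[OF assms(1)] assms(2) by (rule dz_holomorphic_on)
  finally show ?thesis .
qed

lemma mono_corr_current:
  assumes "local_chart D c" "z \<in> coords c"
  shows "mono_corr G (at_point J c z) ms =
    wsum1 G (der_contraction G c z 1) [] (tagged_from 2 ms) + ib * N c z * tagged_wick G (tagged_from 2 ms)"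
  unfolding current_eq mono_corr_at_point using assms
  by (simp add: wick_Nil wick_Der dz_arg_chart)

lemma mono_corr2_current:
  assumes "local_chart D c" "x \<in> coords c" "z \<in> coords c"
  shows "mono_corr2 G (at_point J c x) (at_point J c z) ms =
    pair_expectation G (c, x, 1, 0) (c, z, 1, 0) * tagged_wick G (tagged_from 2 ms) +
    wsum2 G (der_contraction G c x 1) (der_contraction G c z 1) [] (tagged_from 2 ms) +
    ib * N c z * wsum1 G (der_contraction G c x 1) [] (tagged_from 2 ms) +
    ib * N c x * wsum1 G (der_contraction G c z 1) [] (tagged_from 2 ms) +
    ib * N c x * (ib * N c z) * tagged_wick G (tagged_from 2 ms)"
  unfolding current_eq mono_corr2_at_point using assms
  by (simp add: wick2_Nil_Nil wick2_Nil_Der wick2_Der_Nil wick2_Der_Der dz_arg_chart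
      del: pair_expectation.simps)

lemma holomorphic_current: "holomorphic_field D G J"
proof (rule holomorphic_fieldI)
  fix c ms U
  assume *: "local_chart D c" "U \<subseteq> coords c" "\<And>z. z \<in> U \<Longrightarrow>
      good_monomials D (point_of c z) ms"
  have "(\<lambda>z. wsum1 G (der_contraction G c z (Suc 0)) [] (tagged_from 2 ms) +
      ib * N c z * tagged_wick G (tagged_from 2 ms)) holomorphic_on U"
    using holomorphic_on_subset[OF holomorphic_N[OF *(1)] *(2)]
    by (intro holomorphic_intros holomorphic_on_wsum1
        der_contraction_holomorphic_tagged[OF *(1,2)]) (simp_all add: *(3))
  thus "(\<lambda>z. mono_corr G (at_point J c z) ms) holomorphic_on U"
    by (rule holomorphic_transform) (use mono_corr_current[OF *(1) subsetD[OF *(2)]] in simp)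
qed

lemma wsum1_fps:
  assumes "local_chart D c" "z \<in> coords c" "good_monomials D (point_of c z) ms"
  shows "(\<lambda>\<epsilon>. wsum1 G (der_contraction G c (z + \<epsilon>) (Suc j)) P (tagged_from
      2 ms)) has_fps_expansion
    Abs_fps (\<lambda>n. wsum1 G (der_contraction G c z (Suc (j + n))) P (tagged_from 2 ms) / fact n)"
  using has_fps_expansion_wsum1[where g = "\<lambda>\<epsilon>. der_contraction G c (z + \<epsilon>)
      (Suc j)" and
      g' = "\<lambda>n u. der_contraction G c z (Suc (j + n)) u / fact n", OF
          der_contraction_fps_tagged[OF assms]]
  unfolding wsum1_divide .

lemma ope_current: "ope D G J J current_ope"
proof (rule opeI)
  show "holomorphic_field D G J"
    by (rule holomorphic_current)
  show "fock_space_field D (current_ope n)" for n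
    by (rule fock_space_field_current_ope)
  fix c z ms
  assume c: "local_chart D c" and z: "z \<in> coords c" and good: "good_monomials D (point_of c z) ms"
  interpret u: uniformizer_arg "coords c" "W c" "\<theta> c"
    by (rule uniformizer_arg_chart[OF c])
  define R where "R = tagged_from 2 ms"
  define W0 where "W0 = tagged_wick G R"
  define d1 where "d1 = wsum1 G (der_contraction G c z 1) [] R"
  define D1 where "D1 = (\<lambda>\<epsilon>. wsum1 G (der_contraction G c (z + \<epsilon>) 1) [] R)"
  define D2 where "D2 = (\<lambda>\<epsilon>. wsum2 G (der_contraction G c (z + \<epsilon>) 1)
      (der_contraction G c z 1) [] R)"
  define F1 where "F1 = Abs_fps (\<lambda>n. wsum1 G (der_contraction G c z (Suc n)) [] R / fact n)"
  define F2 where "F2 = Abs_fps (\<lambda>n. wsum2 G (der_contraction G c z (Suc n))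
      (der_contraction G c z 1) [] R / fact n)"
  have D1: "D1 has_fps_expansion F1"
    using wsum1_fps[OF c z good, of 0] by (simp add: D1_def F1_def R_def)
  have "wsum2 G (\<lambda>u. der_contraction G c z (Suc n) u / s) h P R =
      wsum2 G (der_contraction G c z (Suc n)) h P R / s" for n s h P
    using wsum2_divide[of G _ s h 1] by simp
  hence D2: "D2 has_fps_expansion F2"
    using has_fps_expansion_wsum2_left[where g = "\<lambda>\<epsilon>. der_contraction G c (z +
        \<epsilon>) (Suc 0)" and
        g' = "\<lambda>n u. der_contraction G c z (Suc (0 + n)) u / fact n" and h = "der_contraction
            G c z 1" and P = "[]" and R = R and G = G,
        OF der_contraction_fps_tagged[OF c z good, folded R_def]]
    by (simp add: D2_def F2_def R_def)
  \<comment> \<open>The correlation multiplied by \<open>\<epsilon>\<^sup>2\<close>: the pair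
    expectation supplies the first term, and everything else is regular at \<epsilon> = 0.\<close>
  define f where "f = (\<lambda>\<epsilon>. u.dpole_fun z \<epsilon> * W0 + \<epsilon> ^ 2 * (D2
      \<epsilon> + ib * N c z * D1 \<epsilon> +
     ib * d1 * N c (z + \<epsilon>) + ib\<^sup>2 * N c z * W0 * N c (z + \<epsilon>)))"
  define T where "T = u.dpole_fps z * fps_const W0 + fps_X ^ 2 * (F2 + fps_const (ib * N c z) * F1 +
     fps_const (ib * d1) * NF c z + fps_const (ib\<^sup>2 * N c z * W0) * NF c z)"
  have NF: "(\<lambda>\<epsilon>. N c (z + \<epsilon>)) has_fps_expansion NF c z"
    by (rule u.fps_holo[OF u.holo_pre_schwarzian z])
  have f: "f has_fps_expansion T"
    unfolding f_def T_def
    by (intro has_fps_expansion_add has_fps_expansion_mult has_fps_expansion_const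
        has_fps_expansion_fps_X_power u.dpole_fun_fps[OF z] D1 D2 NF)
  have "\<forall>\<^sub>F \<epsilon> in at 0. z + \<epsilon> \<in> coords c \<and> \<epsilon> \<noteq> 0"
    by (rule eventually_at_0_shift[OF open_coords[OF c] z])
  hence "\<forall>\<^sub>F \<epsilon> in at 0. mono_corr2 G (at_point J c (z + \<epsilon>))
      (at_point J c z) ms = f \<epsilon> / \<epsilon> ^ 2"
  proof eventually_elim
    case (elim \<epsilon>)
    hence \<epsilon>: "z + \<epsilon> \<in> coords c" "\<epsilon> \<noteq> 0" "z + \<epsilon> \<noteq> z"
      by auto
    have pole: "pair_expectation G (c, z + \<epsilon>, 1, 0) (c, z, 1, 0) = u.dpole_fun z \<epsilon>
        / \<epsilon> ^ 2"
      unfolding pair_expectation_11[OF c \<epsilon>(1) z \<epsilon>(3)] by (rule u.dpole_fun_eq[OF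
          \<epsilon>(2)])
    have split: "(A + \<epsilon> ^ 2 * Y) / \<epsilon> ^ 2 = A / \<epsilon> ^ 2 + Y" for A Y
      using \<epsilon>(2) by (simp add: add_divide_distrib)
    show ?case
      unfolding mono_corr2_current[OF c \<epsilon>(1) z] pole
      unfolding R_def[symmetric] W0_def[symmetric] d1_def[symmetric] f_def D1_def D2_def split
      by (simp add: algebra_simps power2_eq_square[of "complex_of_real b"])
  qed
  hence "(\<lambda>\<epsilon>. mono_corr2 G (at_point J c (z + \<epsilon>)) (at_point J c z) ms)
      has_laurent_expansion
      fls_shift (int 2) (fps_to_fls T)"
    by (rule has_laurent_expansion_of_fps[OF f])
  moreover have "fls_nth (fls_shift (int 2) (fps_to_fls T)) n = mono_corr G (at_point (current_ope
      n) c z) ms" for n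
  proof (cases "n < -2")
    case True
    then show ?thesis
      by (simp add: current_ope_def mono_corr_at_point)
  next
    case False
    define m where "m = nat (n + 2)"
    have "fls_nth (fls_shift (int 2) (fps_to_fls T)) n = fps_nth T m"
      using False by (simp add: m_def)
    also have "\<dots> = mono_corr G (at_point (current_ope n) c z) ms"
      unfolding current_ope_def mono_corr_at_point m_def[symmetric] using False
      by (auto simp: T_def current_scalar_fps_def fps_X_power_mult_nth wick_Nil wick_Der wick_Der_Der
          R_def[symmetric] W0_def[symmetric] d1_def F1_def F2_def algebra_simps)
    finally show ?thesis .
  qed
  ultimately show "\<exists>F. (\<lambda>\<epsilon>. mono_corr2 G (at_point J c (z + \<epsilon>))
      (at_point J c z) ms) has_laurent_expansion F \<and>
           (\<forall>n. fls_nth F n = mono_corr G (at_point (current_ope n) c z) ms)"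
    by blast
qed

lemma mono_corr_stress:
  "mono_corr G (at_point stress_field c z) ms =
     - (1 / 2) * wsum2 G (der_contraction G c z 1) (der_contraction G c z 1) [] (tagged_from 2 ms)
     - ib * N c z * wsum1 G (der_contraction G c z 1) [] (tagged_from 2 ms)
     + ib * wsum1 G (der_contraction G c z 2) [] (tagged_from 2 ms)
     + schwarzian_term c z * tagged_wick G (tagged_from 2 ms)"
  unfolding stress_field_def mono_corr_at_point by (simp add: wick_Nil wick_Der wick_Der_Der)

text \<open>With \<open>S\<close> the Schwarzian derivative, the product of currents contributes the
  scalar \<open>S / 12 - ib\<^sup>2 * N\<^sup>2 / 2\<close> and the derivative of the current adds
  \<open>ib\<^sup>2 * N'\<close>; together they form \<open>schwarzian_term\<close>. The two mixed
  terms of the product coincide at order 0.\<close>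

lemma virasoro_field_eq: "field_eq D G stress_field (virasoro D G \<theta> b)"
proof -
  let ?X = "field_add (field_scale (- 1 / 2) (current_ope 0)) (field_scale ib (d_field J))"
  have "field_eq D G (ope_product D G J J) (current_ope 0)"
    by (rule ope_product_field_eq[OF ope_current])
  hence "field_eq D G (virasoro D G \<theta> b) ?X"
    unfolding virasoro_def by (intro field_eq_add field_eq_scale) (auto simp: field_eq_def)
  moreover have "field_eq D G stress_field ?X"
  proof (rule field_eqI)
    fix c z ms
    assume c: "local_chart D c" and z: "z \<in> coords c"
    interpret u: uniformizer_arg "coords c" "W c" "\<theta> c"
      by (rule uniformizer_arg_chart[OF c])
    define R where "R = tagged_from 2 ms"
    have s: "fps_nth (current_scalar_fps c z) 2 = - (deriv (N c) z - (N c z)\<^sup>2 / 2) / 6 +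
        ib\<^sup>2 * (N c z)\<^sup>2"
      by (simp add: current_scalar_fps_def u.dpole_fps_nth[OF z] fps_X_power_mult_nth fps_expansion_def
          power2_eq_square[of "N c z"])
    have "mono_corr G (at_point (field_scale (- 1 / 2) (current_ope 0)) c z) ms =
        - (1 / 2) * (fps_nth (current_scalar_fps c z) 2 * tagged_wick G R +
           2 * (ib * N c z) * wsum1 G (der_contraction G c z 1) [] R +
           wsum2 G (der_contraction G c z 1) (der_contraction G c z 1) [] R)"
      by (simp add: current_ope_def field_scale_def mono_corr_at_point wick_Nil wick_Der wick_Der_Der
          fps_expansion_def R_def algebra_simps)
    moreover have "d_field J = [(\<lambda>c z. 0, [Der 0 0]), (\<lambda>c z. 0, [Der 1 0]),
        (\<lambda>c z. 0, [Der 1 0]), (\<lambda>c z. 1, [Der 2 0]),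
        (\<lambda>c. dz (arg_scalar c), [])]"
      unfolding current_eq by (simp add: d_field_def numeral_2_eq_2)
    hence "mono_corr G (at_point (field_scale ib (d_field J)) c z) ms =
        ib * (wsum1 G (der_contraction G c z 2) [] R + ib * deriv (N c) z * tagged_wick G R)"
      using dz_dz_arg_chart[OF c z]
      by (simp add: field_scale_def mono_corr_at_point wick_Nil wick_Der R_def algebra_simps)
    ultimately show "mono_corr G (at_point stress_field c z) ms = mono_corr G (at_point ?X c z) ms"
      unfolding at_point_add mono_corr_append mono_corr_stress s schwarzian_term_def R_def[symmetric]
      by (simp add: algebra_simps power2_eq_square add_divide_distrib diff_divide_distrib)
  qed
  ultimately show ?thesis
    using field_eq_sym field_eq_trans by blast
qed

section \<open>The vertex field and its operator product with the Virasoro field\<close>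

definition vcoef :: "complex \<Rightarrow> scalar_field" where
  "vcoef \<alpha> c z = exp (- 2 * \<alpha> * of_real b * of_real (\<theta> c z)) *
     of_real (conformal_radius w c z) powr \<alpha>\<^sup>2"

lemma vertex_field_eq: "vertex_field w \<theta> b \<alpha> = [(vcoef \<alpha>, [WExp \<alpha>])]"
  by (simp add: vertex_field_def vcoef_def[abs_def])

lemma vcoef_eq:
  assumes "local_chart D c"
  shows "vcoef \<alpha> c = uniformizer_arg.vertex_coeff (W c) (\<theta> c) \<alpha> b"
proof -
  interpret u: uniformizer_arg "coords c" "W c" "\<theta> c"
    by (rule uniformizer_arg_chart[OF assms])
  show ?thesis
    by (simp add: fun_eq_iff vcoef_def u.vertex_coeff_def conformal_radius_def)
qed

text \<open>The contraction of \<open>Der 2 0\<close> is the derivative of that of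
  \<open>Der 1 0\<close> in the position, so one regular function \<open>f\<close> describes both,
  the second through the quotient rule for \<open>f \<epsilon> / \<epsilon>\<close>.\<close>

lemma vertex_contraction_expansion:
  assumes c: "local_chart D c" and z: "z \<in> coords c"
  obtains f where "f has_fps_expansion fps_const \<alpha> * uniformizer.pole_fps (W c) z"
    "\<forall>\<^sub>F \<epsilon> in at 0. der_contraction G c (z + \<epsilon>) 1 (c, z, WExp
        \<alpha>) = f \<epsilon> / \<epsilon> \<and>
       der_contraction G c (z + \<epsilon>) 2 (c, z, WExp \<alpha>) = (\<epsilon> * deriv f
           \<epsilon> - f \<epsilon>) / \<epsilon>\<^sup>2"
proof -
  interpret u: uniformizer_arg "coords c" "W c" "\<theta> c"
    by (rule uniformizer_arg_chart[OF c])
  define f where "f = (\<lambda>\<epsilon>. \<alpha> * u.pole_fun z \<epsilon>)"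
  have f: "f has_fps_expansion fps_const \<alpha> * u.pole_fps z"
    unfolding f_def by (intro has_fps_expansion_mult has_fps_expansion_const u.pole_fun_fps z)
  obtain S where S: "open S" "0 \<in> S" "f holomorphic_on S"
    using has_fps_expansion_imp_holomorphic[OF f] by metis
  have first: "der_contraction G c x 1 (c, z, WExp \<alpha>) = f (x - z) / (x - z)"
    if "x \<in> coords c" "x \<noteq> z" for x
    using u.pole_fun_eq[of "x - z" z] that unfolding der_contraction_WExp[OF c that(1) z that(2)] f_def
    by simp
  have "\<forall>\<^sub>F \<epsilon> in at 0. z + \<epsilon> \<in> coords c \<and> \<epsilon> \<noteq> 0"
    by (rule eventually_at_0_shift[OF open_coords[OF c] z])
  moreover have "\<forall>\<^sub>F \<epsilon> in at 0. 0 + \<epsilon> \<in> S \<and> \<epsilon> \<noteq> 0"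
    by (rule eventually_at_0_shift[OF S(1,2)])
  ultimately have "\<forall>\<^sub>F \<epsilon> in at 0. der_contraction G c (z + \<epsilon>) 1 (c,
      z, WExp \<alpha>) = f \<epsilon> / \<epsilon> \<and>
       der_contraction G c (z + \<epsilon>) 2 (c, z, WExp \<alpha>) = (\<epsilon> * deriv f
           \<epsilon> - f \<epsilon>) / \<epsilon>\<^sup>2"
  proof eventually_elim
    case (elim \<epsilon>)
    let ?x = "z + \<epsilon>" and ?V = "off_node c (c, z, WExp \<alpha>)"
    have "?x \<in> ?V"
      using elim z by (simp add: off_node_def point_of_inj[OF c])
    note V = open_off_node[OF c c z] this
    have "((\<lambda>x. x - z) has_field_derivative 1) (at ?x)"
      by (auto intro!: derivative_eq_intros)
    moreover have "(f has_field_derivative deriv f \<epsilon>) (at (?x - z))"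
      using elim S by (auto intro!: holomorphic_derivI)
    ultimately have "((\<lambda>x. f (x - z)) has_field_derivative deriv f \<epsilon> * 1) (at ?x)"
      using DERIV_chain2[of f "deriv f \<epsilon>" "\<lambda>x. x - z" ?x 1] by blast
    hence "((\<lambda>x. f (x - z) / (x - z)) has_field_derivative (\<epsilon> * deriv f \<epsilon>
        - f \<epsilon>) / \<epsilon>\<^sup>2) (at ?x)"
      using elim by (auto intro!: derivative_eq_intros simp: power2_eq_square)
    hence "((\<lambda>x. der_contraction G c x (Suc 0) (c, z, WExp \<alpha>)) has_field_derivative
        (\<epsilon> * deriv f \<epsilon> - f \<epsilon>) / \<epsilon>\<^sup>2) (at ?x)"
    proof (rule has_field_derivative_transform_within_open[OF _ V])
      fix x assume "x \<in> ?V"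
      hence "x \<in> coords c" "x \<noteq> z"
        by (auto simp: off_node_def)
      thus "f (x - z) / (x - z) = der_contraction G c x (Suc 0) (c, z, WExp \<alpha>)"
        using first by simp
    qed
    hence "deriv (\<lambda>x. der_contraction G c x (Suc 0) (c, z, WExp \<alpha>)) ?x = (\<epsilon>
        * deriv f \<epsilon> - f \<epsilon>) / \<epsilon>\<^sup>2"
      by (rule DERIV_imp_deriv)
    hence "der_contraction G c ?x 2 (c, z, WExp \<alpha>) = (\<epsilon> * deriv f \<epsilon> - f
        \<epsilon>) / \<epsilon>\<^sup>2"
      using der_contraction_Suc[OF c c z V(2), of 1] by (simp add: numeral_2_eq_2)
    thus ?case
      using first[of ?x] elim by simp
  qed
  thus ?thesis
    using that f by blast
qed

definition pole :: "complex \<Rightarrow> chart \<Rightarrow> complex \<Rightarrow> complex fps" where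
  "pole \<alpha> c z = fps_const \<alpha> * uniformizer.pole_fps (W c) z"

text \<open>With \<open>A = pole / \<epsilon>\<close> the contraction of a current with the
  exponential, this is \<open>\<epsilon>\<^sup>2\<close> times
  \<open>- A\<^sup>2 / 2 - ib * N * A + ib * A' + schwarzian_term\<close>, the part of the stress
  field using up no test factor.\<close>

definition vertex_scalar_fps :: "complex \<Rightarrow> chart \<Rightarrow> complex \<Rightarrow>
    complex fps" where
  "vertex_scalar_fps \<alpha> c z =
     fps_const (- 1 / 2) * (pole \<alpha> c z * pole \<alpha> c z) + fps_const (- ib) * (fps_X * (NF
         c z * pole \<alpha> c z)) +
     fps_const ib * (fps_X * fps_deriv (pole \<alpha> c z) - pole \<alpha> c z) +
     fps_X ^ 2 * fps_expansion (schwarzian_term c) z"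

text \<open>\<epsilon> times \<open>- A - ib * N\<close>, the factor of a single current left over
  for the test factors. The two ways of contracting only one current of the Wick square cancel the
  \<open>1 / 2\<close>.\<close>

definition vertex_current_fps :: "complex \<Rightarrow> chart \<Rightarrow> complex \<Rightarrow>
    complex fps" where
  "vertex_current_fps \<alpha> c z = fps_const (-1) * pole \<alpha> c z + fps_const (- ib) * (fps_X * NF c z)"

text \<open>Order \<open>n\<close> is index \<open>m = n + 2\<close> of a power series divided by
  \<open>\<epsilon>\<^sup>2\<close>. Terms with one leftover current carry one explicit factor
  \<epsilon>, hence \<open>m - 1 - j\<close>; the terms free of poles carry
  \<open>\<epsilon>\<^sup>2\<close>, hence \<open>m - 2\<close>. The factorials come from Taylor
  expansion of the currents.\<close>

definition vertex_ope :: "complex \<Rightarrow> int \<Rightarrow> field" where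
  "vertex_ope \<alpha> n = (if n < -2 then [] else
     (\<lambda>c z. vcoef \<alpha> c z * fps_nth (vertex_scalar_fps \<alpha> c z) (nat (n + 2)),
         [WExp \<alpha>]) #
     map (\<lambda>j. (\<lambda>c z. vcoef \<alpha> c z * fps_nth (vertex_current_fps \<alpha> c z)
         (nat (n + 2) - 1 - j) / fact j,
               [Der (Suc j) 0, WExp \<alpha>])) [0..<nat (n + 2)] @
     (if nat (n + 2) < 2 then [] else
       (\<lambda>c z. vcoef \<alpha> c z * ib / fact (nat (n + 2) - 2), [Der (nat (n + 2)) 0, WExp
           \<alpha>]) #
       map (\<lambda>i. (\<lambda>c z. vcoef \<alpha> c z * (- 1 / 2) / (fact i * fact (nat (n + 2) - 2 - i)),
                 [Der (Suc i) 0, Der (Suc (nat (n + 2) - 2 - i)) 0, WExp \<alpha>])) [0..<nat (n + 2) - 1]))"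

lemma holomorphic_schwarzian_term: "local_chart D c \<Longrightarrow> schwarzian_term c
    holomorphic_on coords c"
  unfolding schwarzian_term_def[abs_def]
  by (intro holomorphic_intros holomorphic_deriv holomorphic_N open_coords) auto

lemma smooth_fps_pole:
  assumes "local_chart D c"
  shows "smooth_fps (coords c) (pole \<alpha> c)"
proof -
  interpret u: uniformizer_arg "coords c" "W c" "\<theta> c"
    by (rule uniformizer_arg_chart[OF assms])
  show ?thesis
    unfolding pole_def[abs_def] by (intro smooth_fps_mult smooth_fps_const u.smooth_fps_pole u.open_U)
qed

lemma smooth_vcoef:
  assumes "local_chart D c"
  shows "smooth_on (coords c) (vcoef \<alpha> c)"
proof -
  interpret u: uniformizer_arg "coords c" "W c" "\<theta> c"
    by (rule uniformizer_arg_chart[OF assms])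
  show ?thesis
    unfolding vcoef_eq[OF assms] by (rule u.smooth_vertex_coeff)
qed

lemma smooth_fps_vertex:
  assumes "local_chart D c"
  shows "smooth_fps (coords c) (vertex_scalar_fps \<alpha> c)" "smooth_fps (coords c)
      (vertex_current_fps \<alpha> c)"
  unfolding vertex_scalar_fps_def[abs_def] vertex_current_fps_def[abs_def]
  by (intro smooth_fps_add smooth_fps_diff smooth_fps_mult smooth_fps_deriv smooth_fps_const smooth_fps_pole
      smooth_fps_NF smooth_fps_expansion holomorphic_schwarzian_term open_coords assms)+

lemma fock_space_field_vertex_ope: "fock_space_field D (vertex_ope \<alpha> n)"
proof -
  have "smooth_on (coords c) (\<lambda>z. vcoef \<alpha> c z * fps_nth (vertex_scalar_fps \<alpha> c z) k)"
    "smooth_on (coords c) (\<lambda>z. vcoef \<alpha> c z * fps_nth (vertex_current_fps \<alpha> c z) k / r)"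
    "smooth_on (coords c) (\<lambda>z. vcoef \<alpha> c z * r / s)"
    if "local_chart D c" for c k r s
    using smooth_fps_vertex[OF that] unfolding smooth_fps_def
    by (intro smooth_on_divide_const smooth_on_mult smooth_on_const smooth_vcoef open_coords that; blast)+
  thus ?thesis
    unfolding vertex_ope_def
    by (simp only: fock_space_field_Cons fock_space_field_append fock_space_field_map
        fock_space_field_Nil split: if_split) blast
qed

lemma holomorphic_stress: "holomorphic_field D G stress_field"
proof (rule holomorphic_fieldI)
  fix c ms U
  assume *: "local_chart D c" "U \<subseteq> coords c" "\<And>z. z \<in> U \<Longrightarrow>
      good_monomials D (point_of c z) ms"
  have "(\<lambda>z. - (1 / 2) * wsum2 G (der_contraction G c z (Suc 0)) (der_contraction G c z (Suc
      0)) [] (tagged_from 2 ms)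
     - ib * N c z * wsum1 G (der_contraction G c z (Suc 0)) [] (tagged_from 2 ms)
     + ib * wsum1 G (der_contraction G c z (Suc 1)) [] (tagged_from 2 ms)
     + schwarzian_term c z * tagged_wick G (tagged_from 2 ms)) holomorphic_on U"
    using holomorphic_on_subset[OF holomorphic_N[OF *(1)] *(2)]
      holomorphic_on_subset[OF holomorphic_schwarzian_term[OF *(1)] *(2)]
    by (intro holomorphic_intros holomorphic_on_wsum1 holomorphic_on_wsum2
        der_contraction_holomorphic_tagged[OF *(1,2)]) (simp_all add: *(3))
  thus "(\<lambda>z. mono_corr G (at_point stress_field c z) ms) holomorphic_on U"
    by (rule holomorphic_transform) (simp add: mono_corr_stress numeral_2_eq_2)
qed

lemma mono_corr2_stress_vertex:
  fixes c x z ms \<alpha>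
  defines "A \<equiv> der_contraction G c x 1 (c, z, WExp \<alpha>)"
    and "B \<equiv> der_contraction G c x 2 (c, z, WExp \<alpha>)"
    and "W0 \<equiv> tagged_wick G ((1, c, z, WExp \<alpha>) # tagged_from 2 ms)"
    and "D1 \<equiv> wsum1 G (der_contraction G c x 1) [(1, c, z, WExp \<alpha>)] (tagged_from 2 ms)"
    and "E1 \<equiv> wsum1 G (der_contraction G c x 2) [(1, c, z, WExp \<alpha>)] (tagged_from 2 ms)"
    and "D2 \<equiv> wsum2 G (der_contraction G c x 1) (der_contraction G c x 1) [(1, c, z, WExp
        \<alpha>)] (tagged_from 2 ms)"
  shows "mono_corr2 G (at_point stress_field c x) (at_point (vertex_field w \<theta> b \<alpha>) c z) ms =
    vcoef \<alpha> c z * (- (1 / 2) * (A * A * W0 + 2 * A * D1 + D2) - ib * N c x * (A * W0 + D1) +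
       ib * (B * W0 + E1) + schwarzian_term c x * W0)"
  unfolding stress_field_def vertex_field_eq mono_corr2_at_point
  by (simp add: wick2_Nil_vertex wick2_Der_vertex wick2_Der_Der_vertex assms(1-6)) (simp add: algebra_simps)

lemma ope_stress_vertex: "ope D G stress_field (vertex_field w \<theta> b \<alpha>) (vertex_ope \<alpha>)"
proof (rule opeI)
  show "holomorphic_field D G stress_field"
    by (rule holomorphic_stress)
  show "fock_space_field D (vertex_ope \<alpha> n)" for n
    by (rule fock_space_field_vertex_ope)
  fix c z ms
  assume c: "local_chart D c" and z: "z \<in> coords c" and good: "good_monomials D (point_of c z) ms"
  interpret u: uniformizer_arg "coords c" "W c" "\<theta> c"
    by (rule uniformizer_arg_chart[OF c])
  define R where "R = tagged_from 2 ms"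
  define V where "V = (1 :: nat, c, z, WExp \<alpha>)"
  define v where "v = vcoef \<alpha> c z"
  define W0 where "W0 = tagged_wick G (V # R)"
  define D1 where "D1 = (\<lambda>\<epsilon>. wsum1 G (der_contraction G c (z + \<epsilon>) 1) [V] R)"
  define E1 where "E1 = (\<lambda>\<epsilon>. wsum1 G (der_contraction G c (z + \<epsilon>) 2) [V] R)"
  define D2 where "D2 = (\<lambda>\<epsilon>. wsum2 G (der_contraction G c (z + \<epsilon>) 1)
      (der_contraction G c (z + \<epsilon>) 1) [V] R)"
  define F1 where "F1 = Abs_fps (\<lambda>n. wsum1 G (der_contraction G c z (Suc n)) [V] R / fact n)"
  define H1 where "H1 = Abs_fps (\<lambda>n. wsum1 G (der_contraction G c z (Suc (Suc n))) [V] R / fact n)"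
  define F2 where "F2 = Abs_fps (\<lambda>n. \<Sum>i\<le>n.
    wsum2 G (der_contraction G c z (Suc i)) (der_contraction G c z (Suc (n - i))) [V] R / (fact i *
        fact (n - i)))"
  have D1: "D1 has_fps_expansion F1"
    using wsum1_fps[OF c z good, of 0 "[V]"] by (simp add: D1_def F1_def R_def)
  have E1: "E1 has_fps_expansion H1"
    using wsum1_fps[OF c z good, of 1 "[V]"] by (simp add: E1_def H1_def R_def numeral_2_eq_2)
  have D2: "D2 has_fps_expansion F2"
    using has_fps_expansion_wsum2[where g = "\<lambda>\<epsilon>. der_contraction G c (z +
        \<epsilon>) (Suc 0)" and
        g' = "\<lambda>n u. der_contraction G c z (Suc (0 + n)) u / fact n" and
        h = "\<lambda>\<epsilon>. der_contraction G c (z + \<epsilon>) (Suc 0)" and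
        h' = "\<lambda>n u. der_contraction G c z (Suc (0 + n)) u / fact n" and P = "[V]" and R = R and G = G,
        OF der_contraction_fps_tagged[OF c z good, folded R_def] der_contraction_fps_tagged[OF c z
            good, folded R_def]]
    by (simp add: D2_def F2_def R_def wsum2_divide)
  have NF: "(\<lambda>\<epsilon>. N c (z + \<epsilon>)) has_fps_expansion NF c z"
    by (rule u.fps_holo[OF u.holo_pre_schwarzian z])
  have TF: "(\<lambda>\<epsilon>. schwarzian_term c (z + \<epsilon>)) has_fps_expansion
      fps_expansion (schwarzian_term c) z"
    by (rule u.fps_holo[OF holomorphic_schwarzian_term[OF c] z])
  obtain p where p: "p has_fps_expansion pole \<alpha> c z"
    and p_eq: "\<forall>\<^sub>F \<epsilon> in at 0. der_contraction G c (z + \<epsilon>) 1 (c, z,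
        WExp \<alpha>) = p \<epsilon> / \<epsilon> \<and>
       der_contraction G c (z + \<epsilon>) 2 (c, z, WExp \<alpha>) = (\<epsilon> * deriv p
           \<epsilon> - p \<epsilon>) / \<epsilon>\<^sup>2"
    using vertex_contraction_expansion[OF c z, of \<alpha>] unfolding pole_def by blast
  \<comment> \<open>\<open>\<epsilon>\<^sup>2\<close> times the correlation, sorted by the number of
    currents that remain for the test factors; the last line holds what is regular without any pole
    factor.\<close>
  define f where "f = (\<lambda>\<epsilon>. v * (W0 * (- 1 / 2 * (p \<epsilon> * p \<epsilon>) + -
      ib * (\<epsilon> * (N c (z + \<epsilon>) * p \<epsilon>)) +
      ib * (\<epsilon> * deriv p \<epsilon> - p \<epsilon>) + \<epsilon> ^ 2 * schwarzian_term c (z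
          + \<epsilon>)) +
     \<epsilon> * (D1 \<epsilon> * (-1 * p \<epsilon> + - ib * (\<epsilon> * N c (z + \<epsilon>)))) +
     \<epsilon> ^ 2 * (ib * E1 \<epsilon> + - 1 / 2 * D2 \<epsilon>)))"
  define T where "T = fps_const v * (fps_const W0 * vertex_scalar_fps \<alpha> c z +
     fps_X * (F1 * vertex_current_fps \<alpha> c z) + fps_X ^ 2 * (fps_const ib * H1 + fps_const (-
         1 / 2) * F2))"
  have f: "f has_fps_expansion T"
    unfolding f_def T_def vertex_scalar_fps_def vertex_current_fps_def
    by (intro has_fps_expansion_add has_fps_expansion_diff has_fps_expansion_mult has_fps_expansion_const
        has_fps_expansion_fps_X_power has_fps_expansion_fps_X has_fps_expansion_deriv p D1 E1 D2 NF TF)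
  have "\<forall>\<^sub>F \<epsilon> in at 0. z + \<epsilon> \<in> coords c \<and> \<epsilon> \<noteq> 0"
    by (rule eventually_at_0_shift[OF open_coords[OF c] z])
  with p_eq have "\<forall>\<^sub>F \<epsilon> in at 0. mono_corr2 G (at_point stress_field c (z +
      \<epsilon>))
      (at_point (vertex_field w \<theta> b \<alpha>) c z) ms = f \<epsilon> / \<epsilon> ^ 2"
  proof eventually_elim
    case (elim \<epsilon>)
    \<comment> \<open>Clears the denominators; \<open>q\<close> and \<open>q'\<close> stand for the
      values of \<open>p\<close> and its derivative.\<close>
    have alg: "v * (- (1 / 2) * (q / \<epsilon> * (q / \<epsilon>) * W0 + 2 * (q / \<epsilon>) * d +
        d2) - ib * n * (q / \<epsilon> * W0 + d) +
       ib * ((\<epsilon> * q' - q) / \<epsilon>\<^sup>2 * W0 + e) + t * W0) =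
      v * (W0 * (- 1 / 2 * (q * q) + - ib * (\<epsilon> * (n * q)) + ib * (\<epsilon> * q' - q) +
          \<epsilon> ^ 2 * t) +
         \<epsilon> * (d * (-1 * q + - ib * (\<epsilon> * n))) + \<epsilon> ^ 2 * (ib * e + - 1 / 2
             * d2)) / \<epsilon> ^ 2"
      for q q' d d2 e n t
      using elim by (simp add: field_simps power2_eq_square)
    show ?case
      unfolding mono_corr2_stress_vertex conjunct1[OF elim(1)] conjunct2[OF elim(1)] f_def
        R_def[symmetric] V_def[symmetric] W0_def[symmetric] v_def[symmetric]
        D1_def E1_def D2_def
      by (rule alg)
  qed
  hence "(\<lambda>\<epsilon>. mono_corr2 G (at_point stress_field c (z + \<epsilon>)) (at_point
      (vertex_field w \<theta> b \<alpha>) c z) ms)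
      has_laurent_expansion fls_shift (int 2) (fps_to_fls T)"
    by (rule has_laurent_expansion_of_fps[OF f])
  moreover have "fls_nth (fls_shift (int 2) (fps_to_fls T)) n = mono_corr G (at_point (vertex_ope
      \<alpha> n) c z) ms" for n
  proof (cases "n < -2")
    case True
    then show ?thesis
      by (simp add: vertex_ope_def mono_corr_at_point)
  next
    case False
    define m where "m = nat (n + 2)"
    have "fls_nth (fls_shift (int 2) (fps_to_fls T)) n = fps_nth T m"
      using False by (simp add: m_def)
    also have "\<dots> = v * (W0 * fps_nth (vertex_scalar_fps \<alpha> c z) m +
        (\<Sum>j<m. fps_nth F1 j * fps_nth (vertex_current_fps \<alpha> c z) (m - 1 - j)) +
        (if m < 2 then 0 else ib * fps_nth H1 (m - 2) - 1 / 2 * fps_nth F2 (m - 2)))"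
    proof -
      have "fps_nth (fps_X * (F1 * vertex_current_fps \<alpha> c z)) m =
          (\<Sum>j<m. fps_nth F1 j * fps_nth (vertex_current_fps \<alpha> c z) (m - 1 - j))"
      proof (cases m)
        case (Suc k)
        have "fps_nth (fps_X * (F1 * vertex_current_fps \<alpha> c z)) m = fps_nth (F1 *
            vertex_current_fps \<alpha> c z) k"
          by (simp add: Suc)
        also have "\<dots> = (\<Sum>j\<le>k. fps_nth F1 j * fps_nth (vertex_current_fps \<alpha> c
            z) (k - j))"
          by (simp add: fps_mult_nth atMost_atLeast0)
        finally show ?thesis
          by (simp add: Suc lessThan_Suc_atMost)
      qed simp
      thus ?thesis
        by (simp add: T_def fps_X_power_mult_nth)
    qed
    also have "\<dots> = mono_corr G (at_point (vertex_ope \<alpha> n) c z) ms"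
    proof (cases "m < 2")
      case True
      show ?thesis
        unfolding vertex_ope_def mono_corr_at_point m_def[symmetric] using True False
        by (simp add: wick_vertex wick_Der_vertex o_def sum_list_upt F1_def
            R_def[symmetric] V_def[symmetric, unfolded One_nat_def] W0_def[symmetric] v_def[symmetric]
            sum_distrib_left algebra_simps)
    next
      case m2: False
      then obtain k where k: "m = Suc (Suc k)"
        by (metis Suc_diff_Suc add_2_eq_Suc le_add_diff_inverse linorder_not_less)
      have "{..<Suc k} = {..k}"
        by auto
      thus ?thesis
        unfolding vertex_ope_def mono_corr_at_point m_def[symmetric] using False m2
        by (simp add: k wick_vertex wick_Der_vertex wick_Der_Der_vertex o_def sum_list_upt F1_def
            H1_def F2_def
            R_def[symmetric] V_def[symmetric, unfolded One_nat_def] W0_def[symmetric] v_def[symmetric]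
            sum_distrib_left sum_negf algebra_simps
            del: upt_Suc sum.lessThan_Suc)
    qed
    finally show ?thesis .
  qed
  ultimately show "\<exists>F. (\<lambda>\<epsilon>. mono_corr2 G (at_point stress_field c (z +
      \<epsilon>)) (at_point (vertex_field w \<theta> b \<alpha>) c z) ms)
        has_laurent_expansion F \<and> (\<forall>n. fls_nth F n = mono_corr G (at_point (vertex_ope
            \<alpha> n) c z) ms)"
    by blast
qed

lemma ope_virasoro_vertex: "ope D G (virasoro D G \<theta> b) (vertex_field w \<theta> b \<alpha>)
    (vertex_ope \<alpha>)"
  by (rule ope_cong_left[OF virasoro_field_eq ope_stress_vertex])

section \<open>The coefficient of order zero compared with the second derivative of the vertex
  field\<close>

lemma vertex_fps_nth:
  assumes c: "local_chart D c" and z: "z \<in> coords c"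
  defines "p1 \<equiv> uniformizer.image_pole (W c) z - N c z / 2"
    and "p2 \<equiv> N c z * uniformizer.image_pole (W c) z - (uniformizer.image_pole (W c)
        z)\<^sup>2 - deriv (N c) z / 3 - (N c z)\<^sup>2 / 12"
  shows "fps_nth (vertex_scalar_fps \<alpha> c z) 2 = \<alpha>\<^sup>2 * p2 - \<alpha>\<^sup>2 *
      p1\<^sup>2 / 2
           - ib * \<alpha> * (N c z * p1 - deriv (N c) z) + ib * \<alpha> * p2 + schwarzian_term c z"
    and "fps_nth (vertex_current_fps \<alpha> c z) 0 = \<alpha>"
    and "fps_nth (vertex_current_fps \<alpha> c z) 1 = - \<alpha> * p1 - ib * N c z"
proof -
  interpret u: uniformizer_arg "coords c" "W c" "\<theta> c"
    by (rule uniformizer_arg_chart[OF c])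
  have P: "fps_nth (pole \<alpha> c z) 0 = - \<alpha>" "fps_nth (pole \<alpha> c z) 1 = \<alpha> *
      p1" "fps_nth (pole \<alpha> c z) 2 = \<alpha> * p2"
    using u.pole_fps_nth[OF z] unfolding pole_def p1_def p2_def by simp_all
  have F: "fps_nth (NF c z) 0 = N c z" "fps_nth (NF c z) 1 = deriv (N c) z"
    "fps_nth (fps_expansion (schwarzian_term c) z) 0 = schwarzian_term c z"
    by (simp_all add: fps_expansion_def)
  have X: "fps_nth (fps_X * f) 2 = fps_nth f 1" for f :: "complex fps"
    by simp
  have X2: "fps_nth (fps_X ^ 2 * f) 2 = fps_nth f 0" for f :: "complex fps"
    by (simp add: fps_X_power_mult_nth)
  have d: "fps_nth (fps_deriv f) 1 = 2 * fps_nth f 2" for f :: "complex fps"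
    by (simp add: numeral_2_eq_2)
  show "fps_nth (vertex_scalar_fps \<alpha> c z) 2 = \<alpha>\<^sup>2 * p2 - \<alpha>\<^sup>2 * p1\<^sup>2 / 2
           - ib * \<alpha> * (N c z * p1 - deriv (N c) z) + ib * \<alpha> * p2 + schwarzian_term c z"
    unfolding vertex_scalar_fps_def fps_add_nth fps_sub_nth fps_mult_left_const_nth fps_mult_nth_1
      fps_mult_nth_2 X X2 d P F
    by (simp add: fps_mult_nth_1 fps_mult_nth_2 P F field_simps power2_eq_square del: One_nat_def)
  show "fps_nth (vertex_current_fps \<alpha> c z) 0 = \<alpha>"
    by (simp add: vertex_current_fps_def P)
  show "fps_nth (vertex_current_fps \<alpha> c z) 1 = - \<alpha> * p1 - ib * N c z"
    using P(2) F(1) by (simp add: vertex_current_fps_def)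
qed

text \<open>At order 0 the series index is 2, and the single-current terms use indices 1 and 0. The
  three identities match, after multiplication by \<open>2 * a\<^sup>2\<close>, the coefficients of
  \<open>[WExp \<alpha>]\<close>, \<open>[Der 1 0, WExp \<alpha>]\<close> and
  \<open>[Der 2 0, WExp \<alpha>]\<close>.\<close>

lemma vertex_ope_0:
  assumes c: "local_chart D c" and z: "z \<in> coords c" and ab: "2 * a * (a + b) = 1"
    and \<alpha>: "\<alpha> = \<i> * complex_of_real a"
  defines "g \<equiv> uniformizer_arg.vertex_log_dz (W c) \<alpha> b z"
    and "g' \<equiv> dz (uniformizer_arg.vertex_log_dz (W c) \<alpha> b) z"
  shows "2 * (complex_of_real a)\<^sup>2 * fps_nth (vertex_scalar_fps \<alpha> c z) 2 = g\<^sup>2 + g'"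
    and "2 * (complex_of_real a)\<^sup>2 * fps_nth (vertex_current_fps \<alpha> c z) 1 = 2 * \<alpha> * g"
    and "2 * (complex_of_real a)\<^sup>2 * (fps_nth (vertex_current_fps \<alpha> c z) 0 + ib) = \<alpha>"
proof -
  interpret u: uniformizer_arg "coords c" "W c" "\<theta> c"
    by (rule uniformizer_arg_chart[OF c])
  define A B where "A = complex_of_real a" and "B = complex_of_real b"
  define n n' t where "n = N c z" and "n' = deriv (N c) z" and "t = u.image_pole z"
  \<comment> \<open>In \<open>a\<^sup>2\<close> and \<open>a * b\<close> the hypothesis is linear,
    so \<open>C\<close> can be eliminated in favour of \<open>K\<close>.\<close>
  define K C where "K = A\<^sup>2" and "C = A * B"
  have "of_real (2 * a * (a + b)) = (1 :: complex)"
    by (simp only: ab of_real_1)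
  hence "2 * K + 2 * C = 1"
    by (simp add: A_def B_def K_def C_def algebra_simps power2_eq_square)
  hence C: "C = 1 / 2 - K"
    by (simp add: field_simps eq_diff_eq)
  have \<alpha>2: "\<alpha>\<^sup>2 = - K" "ib * \<alpha> = - C" "ib\<^sup>2 = - B\<^sup>2"
    by (simp_all add: \<alpha> A_def B_def K_def C_def complex_eq_iff power2_eq_square)
  have g: "g = - K * t + (K / 2 - C) * n" "g' = - K * (n * t - t\<^sup>2) + (K / 2 - C) * n'"
    using \<alpha>2 unfolding g_def g'_def u.dz_vertex_log_dz[OF z]
    by (simp_all add: u.vertex_log_dz_def n_def n'_def t_def mult_ac)
  \<comment> \<open>The Schwarzian term contains \<open>b\<^sup>2\<close> alone; the prefactor
    \<open>a\<^sup>2\<close> turns it into the square of \<open>C\<close>.\<close>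
  have KB: "K * B\<^sup>2 = C\<^sup>2"
    by (simp add: K_def C_def power_mult_distrib)
  define p1 p2 where "p1 = t - n / 2" and "p2 = n * t - t\<^sup>2 - n' / 3 - n\<^sup>2 / 12"
  have "2 * K * fps_nth (vertex_scalar_fps \<alpha> c z) 2 =
      2 * K * (- K * p2 + K * p1\<^sup>2 / 2 + C * (n * p1 - n') - C * p2 + 1 / 12 * (n' - n\<^sup>2 / 2)) -
      2 * (K * B\<^sup>2) * (n' - n\<^sup>2 / 2)"
    unfolding vertex_fps_nth(1)[OF c z] schwarzian_term_def \<alpha>2 n_def[symmetric] n'_def[symmetric]
      t_def[symmetric] p1_def[symmetric] p2_def[symmetric]
    by (simp add: algebra_simps)
  also have "\<dots> = g\<^sup>2 + g'"
    unfolding KB g C p1_def p2_def by (simp add: field_simps power2_eq_square)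
  finally show "2 * (complex_of_real a)\<^sup>2 * fps_nth (vertex_scalar_fps \<alpha> c z) 2 = g\<^sup>2 + g'"
    by (simp add: K_def A_def)
  \<comment> \<open>Likewise an isolated \<open>ib\<close> is absorbed by the prefactor.\<close>
  have KB': "K * ib = \<alpha> * C"
    by (simp add: K_def C_def \<alpha> A_def B_def power2_eq_square)
  have "2 * K * fps_nth (vertex_current_fps \<alpha> c z) 1 = - 2 * K * \<alpha> * (t - n / 2) - 2 *
      (K * ib) * n"
    unfolding vertex_fps_nth(3)[OF c z] n_def t_def by (simp add: algebra_simps)
  also have "\<dots> = 2 * \<alpha> * g"
    unfolding KB' g by (simp add: algebra_simps)
  finally show "2 * (complex_of_real a)\<^sup>2 * fps_nth (vertex_current_fps \<alpha> c z) 1 = 2 *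
      \<alpha> * g"
    by (simp add: K_def A_def)
  have "2 * K * (fps_nth (vertex_current_fps \<alpha> c z) 0 + ib) = 2 * K * \<alpha> + 2 * (K * ib)"
    unfolding vertex_fps_nth(2)[OF c z] by (simp add: algebra_simps)
  also have "\<dots> = \<alpha>"
    unfolding KB' C by (simp add: algebra_simps)
  finally show "2 * (complex_of_real a)\<^sup>2 * (fps_nth (vertex_current_fps \<alpha> c z) 0 + ib)
      = \<alpha>"
    by (simp add: K_def A_def)
qed

lemma vertex_ope_0_field_eq:
  assumes ab: "2 * a * (a + b) = 1" and \<alpha>: "\<alpha> = \<i> * complex_of_real a"
  shows "field_eq D G (vertex_ope \<alpha> 0)
    (field_scale (of_real (1 / (2 * a\<^sup>2))) (d_field (d_field (vertex_field w \<theta> b \<alpha>))))"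
proof (rule field_eqI)
  fix c z ms
  assume c: "local_chart D c" and z: "z \<in> coords c"
  interpret u: uniformizer_arg "coords c" "W c" "\<theta> c"
    by (rule uniformizer_arg_chart[OF c])
  have a: "a \<noteq> 0"
    using ab by auto
  define R where "R = tagged_from 2 ms"
  define V where "V = (Suc 0, c, z, WExp \<alpha>)"
  define v where "v = vcoef \<alpha> c z"
  define g where "g = u.vertex_log_dz \<alpha> b z"
  define g' where "g' = dz (u.vertex_log_dz \<alpha> b) z"
  define W0 where "W0 = tagged_wick G (V # R)"
  define D1 where "D1 = wsum1 G (der_contraction G c z (Suc 0)) [V] R"
  define E1 where "E1 = wsum1 G (der_contraction G c z 2) [V] R"
  define D2 where "D2 = wsum2 G (der_contraction G c z (Suc 0)) (der_contraction G c z (Suc 0)) [V] R"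
  define r where "r = complex_of_real (1 / (2 * a\<^sup>2))"
  have v: "dz (vcoef \<alpha> c) z = v * g" "dz (dz (vcoef \<alpha> c)) z = v * (g\<^sup>2 + g')"
    unfolding v_def g_def g'_def vcoef_eq[OF c]
    by (rule u.vertex_coeff_derivative(2)[OF z], rule u.dz_dz_vertex_coeff[OF z])
  have \<alpha>v: "dz (\<lambda>z. \<alpha> * vcoef \<alpha> c z) z = \<alpha> * (v * g)"
    using u.vertex_coeff_derivative(1)[OF z] unfolding v(1)[symmetric]
    by (intro dz_cmult) (simp add: vcoef_eq[OF c])
  \<comment> \<open>The term with one current appears twice, once for each order of differentiating
    the coefficient and the exponential; this gives the factor 2 before \<open>\<alpha> * g\<close>
    below.\<close>
  have "d_field (d_field (vertex_field w \<theta> b \<alpha>)) =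
     [(\<lambda>c. dz (dz (vcoef \<alpha> c)), [WExp \<alpha>]), (\<lambda>c z. \<alpha> * dz (vcoef
         \<alpha> c) z, [Der 1 0, WExp \<alpha>]),
      (\<lambda>c. dz (\<lambda>z. \<alpha> * vcoef \<alpha> c z), [Der 1 0, WExp \<alpha>]),
          (\<lambda>c z. \<alpha> * vcoef \<alpha> c z, [Der 2 0, WExp \<alpha>]),
      (\<lambda>c z. \<alpha> * (\<alpha> * vcoef \<alpha> c z), [Der 1 0, Der 1 0, WExp \<alpha>])]"
    unfolding vertex_field_eq by (simp add: d_field_def numeral_2_eq_2)
  hence rhs: "mono_corr G (at_point (field_scale r (d_field (d_field (vertex_field w \<theta> b
      \<alpha>)))) c z) ms =
      r * (v * ((g\<^sup>2 + g') * W0 + 2 * \<alpha> * g * D1 + \<alpha> * E1 + \<alpha>\<^sup>2 * D2))"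
    by (simp add: field_scale_def mono_corr_at_point wick_vertex wick_Der_vertex wick_Der_Der_vertex
        v \<alpha>v
        R_def[symmetric] V_def[symmetric] W0_def[symmetric] D1_def[symmetric] E1_def[symmetric]
            D2_def[symmetric]
        v_def[symmetric] algebra_simps power2_eq_square)
  \<comment> \<open>The entry \<open>j = 1\<close> of the single-current list and the separate
    \<open>ib\<close> term both carry \<open>Der 2 0\<close> and merge into the coefficient of
    \<open>E1\<close>.\<close>
  have lhs: "mono_corr G (at_point (vertex_ope \<alpha> 0) c z) ms =
      v * (fps_nth (vertex_scalar_fps \<alpha> c z) 2 * W0 + fps_nth (vertex_current_fps \<alpha> c
          z) 1 * D1 +
        (fps_nth (vertex_current_fps \<alpha> c z) 0 + ib) * E1 - 1 / 2 * D2)"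
    by (simp add: vertex_ope_def mono_corr_at_point wick_vertex wick_Der_vertex wick_Der_Der_vertex
        R_def[symmetric] V_def[symmetric] W0_def[symmetric] D1_def[symmetric] E1_def[symmetric]
            D2_def[symmetric]
        v_def[symmetric] upt_rec numeral_2_eq_2[symmetric] algebra_simps)
  have r: "r * (2 * (complex_of_real a)\<^sup>2) = 1"
    using a by (simp add: r_def)
  have cancel: "x = r * y" if "2 * (complex_of_real a)\<^sup>2 * x = y" for x y
  proof -
    have "r * y = r * (2 * (complex_of_real a)\<^sup>2) * x"
      unfolding that[symmetric] by (simp only: mult.assoc)
    thus ?thesis
      by (simp add: r)
  qed
  \<comment> \<open>The Wick square: its coefficient \<open>- 1 / 2\<close> matches because
    \<open>\<alpha>\<^sup>2 = - a\<^sup>2\<close>.\<close>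
  have "2 * (complex_of_real a)\<^sup>2 * (- 1 / 2) = \<alpha>\<^sup>2"
    by (simp add: \<alpha> complex_eq_iff power2_eq_square)
  note coeffs = cancel[OF vertex_ope_0(1)[OF c z ab \<alpha>]] cancel[OF vertex_ope_0(2)[OF c z ab \<alpha>]]
    cancel[OF vertex_ope_0(3)[OF c z ab \<alpha>]] cancel[OF this]
  have "mono_corr G (at_point (vertex_ope \<alpha> 0) c z) ms =
      v * (fps_nth (vertex_scalar_fps \<alpha> c z) 2 * W0 + fps_nth (vertex_current_fps \<alpha> c
          z) 1 * D1 +
        (fps_nth (vertex_current_fps \<alpha> c z) 0 + ib) * E1 + (- 1 / 2) * D2)"
    unfolding lhs by simp
  also have "\<dots> = r * (v * ((g\<^sup>2 + g') * W0 + 2 * \<alpha> * g * D1 + \<alpha> * E1 +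
      \<alpha>\<^sup>2 * D2))"
    unfolding coeffs g_def[symmetric] g'_def[symmetric] by (simp add: algebra_simps)
  finally show "mono_corr G (at_point (vertex_ope \<alpha> 0) c z) ms =
      mono_corr G (at_point (field_scale (of_real (1 / (2 * a\<^sup>2))) (d_field (d_field
          (vertex_field w \<theta> b \<alpha>)))) c z) ms"
    unfolding rhs[unfolded r_def] r_def .
qed

end

theorem proposition10p3:
  fixes D :: "complex set" and q :: "complex filter"
    and G :: "complex \<Rightarrow> complex \<Rightarrow> real"
    and w :: "complex \<Rightarrow> complex"
    and \<theta> :: "chart \<Rightarrow> complex \<Rightarrow> real"
    and a b :: real
  assumes "open D" and "D \<noteq> {}" and "simply_connected D"
    and "prime_end D q"
    and "dirichlet_green D G"
    and "conformal_to_half_plane D q w"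
    and "arg_branch D w \<theta>"
    and "2 * a * (a + b) = 1"
  shows "has_ope D G (current \<theta> b) (current \<theta> b) \<and>
         has_ope D G (virasoro D G \<theta> b) (vertex_field w \<theta> b (\<i> * of_real a)) \<and>
         field_eq D G
           (ope_product D G (virasoro D G \<theta> b) (vertex_field w \<theta> b (\<i> * of_real a)))
           (field_scale (of_real (1 / (2 * a\<^sup>2)))
             (d_field (d_field (vertex_field w \<theta> b (\<i> * of_real a)))))"
proof -
  have w: "conformal_onto D upper_half_plane w"
    using assms(6) by (simp add: conformal_to_half_plane_def)
  interpret modified_field D G w \<theta> b
  proof
    show "open D" "arg_branch D w \<theta>"
      by fact+
    show "w holomorphic_on D" "inj_on w D"
      using w by (auto simp: conformal_onto_def)
    show "Im (w x) > 0" if "x \<in> D" for x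
      using w that by (auto simp: conformal_onto_def upper_half_plane_def)
    show "G x y = half_plane_green (w x) (w y)" if "x \<in> D" "y \<in> D" "x \<noteq> y" for x y
      using assms(1-3,5) w that(2,1,3) by (rule dirichlet_green_formula)
  qed
  have "field_eq D G
      (ope_product D G (virasoro D G \<theta> b) (vertex_field w \<theta> b (\<i> * of_real a)))
      (vertex_ope (\<i> * of_real a) 0)"
    by (rule ope_product_field_eq[OF ope_virasoro_vertex])
  moreover have "field_eq D G (vertex_ope (\<i> * of_real a) 0)
      (field_scale (of_real (1 / (2 * a\<^sup>2))) (d_field (d_field (vertex_field w \<theta> b
          (\<i> * of_real a)))))"
    using assms(8) refl by (rule vertex_ope_0_field_eq)
  ultimately show ?thesis
    unfolding has_ope_def using ope_current ope_virasoro_vertex field_eq_trans by blast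
qed

end
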